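(* Let $n\ge1$. For the invariantly orthonormal passive generators on the canonical probe $|\psi_{\bm r}\rangle$, the Fisher matrix is diagonal with weights $\widetilde F_{\bm\alpha}(\bm r)=2\sinh^2[\bm\alpha(\bm r)]$ for every $\bm\alpha\in\Sigma_+$. For every $N>0$, the minimum weight $\min_{\bm\alpha\in\Sigma_+}\widetilde F_{\bm\alpha}(\bm r)$, maximized over $\bm r\in\overline{\mathcal C}=\{\bm r\in\mathbb R^n:r_1\ge\cdots\ge r_n\ge0\}$ with $\sum_{j=1}^n\sinh^2r_j=N$, has a unique maximizer, namely the spectrum on the dual-Weyl ray with that photon number: $r_j=(2n-2j+1)a$ for $j=1,\dots,n$, where $a>0$ is determined by $\sum_{j=1}^n\sinh^2[(2n-2j+1)a]=N$. Moreover, the Fisher eigenvalues and this optimum are independent of the passive Bloch--Messiah frame: for every passive Gaussian unitary $\hat U_1$, the Fisher matrix of the invariantly orthonormal passive generators on the state $\hat U_1|\psi_{\bm r}\rangle$ has the same eigenvalues (with multiplicity) as on $|\psi_{\bm r}\rangle$, so the same $\bm r$ is optimal.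
   Context: Bosonic modes: on the Fock space of $n$ bosonic modes let $\hat a_j,\hat a_j^\dagger$ be the annihilation and creation operators, $[\hat a_j,\hat a_k^\dagger]=\delta_{jk}$, and $|0\rangle$ the vacuum. For $\bm r\in\mathbb R^n$ the canonical probe is $|\psi_{\bm r}\rangle=\hat S(\bm r)|0\rangle$ with $\hat S(\bm r)=\prod_{j=1}^n \exp\!\big[\tfrac12 r_j(\hat a_j^2-\hat a_j^{\dagger 2})\big]$. A passive Gaussian unitary is a unitary $\hat U=e^{-i\hat{\bm a}^\dagger\bm h\hat{\bm a}}$ with $\bm h$ an $n\times n$ Hermitian matrix and $\hat{\bm a}=(\hat a_1,\dots,\hat a_n)^{\mathrm T}$ (up to a phase); every pure zero-mean Gaussian state has the form $\hat U_1|\psi_{\bm r}\rangle$ with $\hat U_1$ passive (Bloch--Messiah decomposition). Invariantly orthonormal passive generators: $\widetilde g_j^{\mathrm{rot}}=\hat a_j^\dagger\hat a_j$ ($1\le j\le n$), $\widetilde g_{jk}^{\mathrm{bsX}}=\tfrac1{\sqrt2}(\hat a_j^\dagger\hat a_k+\hat a_k^\dagger\hat a_j)$ and $\widetilde g_{jk}^{\mathrm{bsY}}=\tfrac{-i}{\sqrt2}(\hat a_j^\dagger\hat a_k-\hat a_k^\dagger\hat a_j)$ ($1\le j<k\le n$); writing each as $\hat{\bm a}^\dagger\bm h_\mu\hat{\bm a}$, they are orthonormal for the inner product $\operatorname{Re}\operatorname{Tr}(\bm h_\mu\bm h_\nu)$. The Fisher matrix of generators $\{\widetilde g_\mu\}$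 on a pure state is $\widetilde F_{\mu\nu}=2\langle\{\Delta\widetilde g_\mu,\Delta\widetilde g_\nu\}\rangle$, $\Delta\widetilde g_\mu=\widetilde g_\mu-\langle\widetilde g_\mu\rangle$, with expectation values in that state. Roots: $\Sigma_+=\{2\bm e_j\}_{j=1}^n\cup\{\bm e_j-\bm e_k,\bm e_j+\bm e_k\}_{1\le j<k\le n}$ with $\bm e_j(\bm r)=r_j$; weights are labelled by $2\bm e_j\leftrightarrow\widetilde g_j^{\mathrm{rot}}$, $\bm e_j-\bm e_k\leftrightarrow\widetilde g_{jk}^{\mathrm{bsY}}$, $\bm e_j+\bm e_k\leftrightarrow\widetilde g_{jk}^{\mathrm{bsX}}$. The dual-Weyl ray is the ray through $(2n-1,2n-3,\dots,3,1)$. *)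

theory Defs
  imports "HOL-Analysis.Infinite_Sum" "Jordan_Normal_Form.Schur_Decomposition"
    "Jordan_Normal_Form.Spectral_Radius"
begin

(* Modes are numbered 0, ..., n - 1, so the mode j of the usual 1-based numbering is j - 1 here.
   An occupation pattern is a function m :: nat => nat vanishing from n on, and a vector psi is
   given by its coefficients psi m = <m|psi> in the number basis. Operators are formal maps on
   coefficient families; on square-summable families whose image is again square-summable they are
   the usual unbounded operators, and products of operators are compositions. *)

type_synonym fvec = "(nat \<Rightarrow> nat) \<Rightarrow> complex"
type_synonym fop = "fvec \<Rightarrow> fvec"

definition occupations :: "nat \<Rightarrow> (nat \<Rightarrow> nat) set" where
  "occupations n = {m. \<forall>j\<ge>n. m j = 0}"

definition fock :: "nat \<Rightarrow> fvec set" where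
  "fock n = {\<psi>. (\<forall>m. m \<notin> occupations n \<longrightarrow> \<psi> m = 0) \<and>
                 (\<lambda>m. (cmod (\<psi> m))\<^sup>2) summable_on UNIV}"

definition finite_fock :: "nat \<Rightarrow> fvec set" where
  "finite_fock n = {\<psi> \<in> fock n. finite {m. \<psi> m \<noteq> 0}}"

definition fnorm :: "fvec \<Rightarrow> real" where
  "fnorm \<psi> = sqrt (\<Sum>\<^sub>\<infinity>m. (cmod (\<psi> m))\<^sup>2)"

definition fdist :: "fvec \<Rightarrow> fvec \<Rightarrow> real" where
  "fdist \<phi> \<psi> = fnorm (\<lambda>m. \<phi> m - \<psi> m)"

definition vacuum :: fvec where
  "vacuum m = (if m = (\<lambda>_. 0) then 1 else 0)"

(* a|m> = sqrt m |m-1> and adjoint, read off on coefficients. *)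

definition annih :: "nat \<Rightarrow> fop" where
  "annih j \<psi> = (\<lambda>m. complex_of_real (sqrt (real (m j + 1))) * \<psi> (m(j := m j + 1)))"

definition creat :: "nat \<Rightarrow> fop" where
  "creat j \<psi> = (\<lambda>m. complex_of_real (sqrt (real (m j))) * \<psi> (m(j := m j - 1)))"

lemma canonical_commutation:
  "annih j (creat k \<psi>) m - creat k (annih j \<psi>) m = (if j = k then \<psi> m else 0)"
proof (cases "j = k")
  case True
  have sq: "complex_of_real (sqrt (real x)) * complex_of_real (sqrt (real x)) = of_nat x"
    for x :: nat
    by (simp flip: of_real_mult)
  show ?thesis
  proof (cases "m k")
    case 0
    then show ?thesis using True by (simp add: annih_def creat_def)
  next
    case (Suc x)
    have m: "m(k := Suc x) = m" using Suc by auto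
    show ?thesis using True Suc sq[of "Suc (Suc x)"] sq[of "Suc x"]
      by (simp add: annih_def creat_def m algebra_simps del: of_nat_Suc)
        (simp add: algebra_simps)
  qed
next
  case False
  then show ?thesis by (simp add: annih_def creat_def fun_upd_twist)
qed


(* Exponential of a (formal) operator K that is essentially skew-adjoint on the finite-particle
   vectors. closure_dom is the domain of the closure of K restricted to those vectors, and
   evolves relates psi to the value u 1 of the strong solution of u' = K u, u 0 = psi. For
   such K this is the restriction of the unitary exp K of Stone's theorem to the domain of its
   generator; exp K on the whole Fock space is the norm closure of that isometric relation.
   Power series would not do: for quadratic K they converge on the vacuum only for small K. *)

definition closure_dom :: "nat \<Rightarrow> fop \<Rightarrow> fvec set" where
  "closure_dom n K = {\<psi> \<in> fock n. K \<psi> \<in> fock n \<and>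
     (\<forall>\<epsilon>>0. \<exists>\<chi>\<in>finite_fock n. fdist \<chi> \<psi> < \<epsilon> \<and> fdist (K \<chi>) (K \<psi>) < \<epsilon>)}"

definition strong_solution :: "nat \<Rightarrow> fop \<Rightarrow> (real \<Rightarrow> fvec) \<Rightarrow> bool" where
  "strong_solution n K u \<longleftrightarrow> (\<forall>t\<in>{0..1}. u t \<in> closure_dom n K \<and>
     ((\<lambda>s. fdist (\<lambda>m. (u s m - u t m) / of_real (s - t)) (K (u t))) \<longlongrightarrow> 0) (at t within {0..1}))"

definition evolves :: "nat \<Rightarrow> fop \<Rightarrow> fvec \<Rightarrow> fvec \<Rightarrow> bool" where
  "evolves n K \<psi> \<phi> \<longleftrightarrow> (\<exists>u. strong_solution n K u \<and> u 0 = \<psi> \<and> u 1 = \<phi>)"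

definition op_exp :: "nat \<Rightarrow> fop \<Rightarrow> fop" where
  "op_exp n K \<psi> = (THE \<phi>. \<phi> \<in> fock n \<and>
     (\<forall>\<epsilon>>0. \<exists>\<psi>' \<phi>'. evolves n K \<psi>' \<phi>' \<and> fdist \<psi>' \<psi> < \<epsilon> \<and> fdist \<phi>' \<phi> < \<epsilon>))"


definition squeeze_gen :: "nat \<Rightarrow> real \<Rightarrow> fop" where
  "squeeze_gen j x \<psi> = (\<lambda>m. of_real (x / 2) *
     (annih j (annih j \<psi>) m - creat j (creat j \<psi>) m))"

definition squeeze :: "nat \<Rightarrow> real vec \<Rightarrow> fop" where
  "squeeze n r = foldr (\<circ>) (map (\<lambda>j. op_exp n (squeeze_gen j (r $ j))) [0..<n]) id"

definition probe :: "nat \<Rightarrow> real vec \<Rightarrow> fvec" where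
  "probe n r = squeeze n r vacuum"

definition quadratic :: "nat \<Rightarrow> complex mat \<Rightarrow> fop" where
  "quadratic n h \<psi> = (\<lambda>m. \<Sum>j<n. \<Sum>k<n. h $$ (j, k) * creat j (annih k \<psi>) m)"

definition passive_gaussian :: "nat \<Rightarrow> fop \<Rightarrow> bool" where
  "passive_gaussian n U \<longleftrightarrow> (\<exists>h c. h \<in> carrier_mat n n \<and> mat_adjoint h = h \<and> cmod c = 1 \<and>
     (\<forall>\<psi>\<in>fock n. U \<psi> = (\<lambda>m. c * op_exp n (\<lambda>\<phi> m. - \<i> * quadratic n h \<phi> m) \<psi> m)))"


(* Labels of the positive roots: Long j is 2 e_j, Minus j k is e_j - e_k, Plus j k is e_j + e_k. *)

datatype root = Long nat | Minus nat nat | Plus nat nat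

fun root_val :: "root \<Rightarrow> real vec \<Rightarrow> real" where
  "root_val (Long j) r = 2 * r $ j"
| "root_val (Minus j k) r = r $ j - r $ k"
| "root_val (Plus j k) r = r $ j + r $ k"

definition pos_roots :: "nat \<Rightarrow> root set" where
  "pos_roots n = {Long j | j. j < n} \<union> {Minus j k | j k. j < k \<and> k < n}
     \<union> {Plus j k | j k. j < k \<and> k < n}"

definition root_list :: "nat \<Rightarrow> root list" where
  "root_list n = map Long [0..<n]
     @ concat (map (\<lambda>k. map (\<lambda>j. Minus j k) [0..<k]) [0..<n])
     @ concat (map (\<lambda>k. map (\<lambda>j. Plus j k) [0..<k]) [0..<n])"

lemma set_root_list: "set (root_list n) = pos_roots n"
  by (auto simp: root_list_def pos_roots_def)

lemma distinct_root_list: "distinct (root_list n)"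
proof -
  have "distinct (concat (map (\<lambda>k. map (\<lambda>j. f j k) [0..<k]) [0..<n]))"
    if "\<And>j k j' k'. f j k = f j' k' \<longleftrightarrow> j = j' \<and> k = k'" for f :: "nat \<Rightarrow> nat \<Rightarrow> root"
    by (induction n) (auto simp: distinct_map inj_on_def that)
  from this[of Minus] this[of Plus] show ?thesis
    by (auto simp: root_list_def distinct_map inj_on_def)
qed

fun gen :: "root \<Rightarrow> fop" where
  "gen (Long j) \<psi> = creat j (annih j \<psi>)"
| "gen (Minus j k) \<psi> = (\<lambda>m. - \<i> / of_real (sqrt 2) *
      (creat j (annih k \<psi>) m - creat k (annih j \<psi>) m))"
| "gen (Plus j k) \<psi> = (\<lambda>m. 1 / of_real (sqrt 2) *
      (creat j (annih k \<psi>) m + creat k (annih j \<psi>) m))"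


definition expect :: "fvec \<Rightarrow> fop \<Rightarrow> complex" where
  "expect \<psi> A = (\<Sum>\<^sub>\<infinity>m. cnj (\<psi> m) * A \<psi> m)"

definition deviation :: "fvec \<Rightarrow> fop \<Rightarrow> fop" where
  "deviation \<psi> A \<phi> = (\<lambda>m. A \<phi> m - expect \<psi> A * \<phi> m)"

definition anticommutator :: "fop \<Rightarrow> fop \<Rightarrow> fop" where
  "anticommutator A B \<phi> = (\<lambda>m. A (B \<phi>) m + B (A \<phi>) m)"

definition fisher :: "fvec \<Rightarrow> root \<Rightarrow> root \<Rightarrow> complex" where
  "fisher \<psi> \<alpha> \<beta> = 2 * expect \<psi> (anticommutator (deviation \<psi> (gen \<alpha>)) (deviation \<psi> (gen \<beta>)))"

definition fisher_mat :: "nat \<Rightarrow> fvec \<Rightarrow> complex mat" where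
  "fisher_mat n \<psi> = mat (length (root_list n)) (length (root_list n))
     (\<lambda>(i, j). fisher \<psi> (root_list n ! i) (root_list n ! j))"

definition eigenvalue_mset :: "complex mat \<Rightarrow> complex multiset" where
  "eigenvalue_mset A = proots (char_poly A)"

definition min_weight :: "nat \<Rightarrow> fvec \<Rightarrow> real" where
  "min_weight n \<psi> = Min ((\<lambda>\<alpha>. Re (fisher \<psi> \<alpha> \<alpha>)) ` pos_roots n)"

(* Fisher matrices are real symmetric, so Re only changes the type. *)

definition min_eigenvalue :: "complex mat \<Rightarrow> real" where
  "min_eigenvalue A = Min (Re ` spectrum A)"


definition chamber :: "nat \<Rightarrow> real vec set" where
  "chamber n = {r \<in> carrier_vec n. (\<forall>j k. j \<le> k \<and> k < n \<longrightarrow> r $ k \<le> r $ j) \<and> (\<forall>j<n. 0 \<le> r $ j)}"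

definition photon_number :: "nat \<Rightarrow> real vec \<Rightarrow> real" where
  "photon_number n r = (\<Sum>j<n. (sinh (r $ j))\<^sup>2)"

definition maximizers :: "nat \<Rightarrow> real \<Rightarrow> (real vec \<Rightarrow> real) \<Rightarrow> real vec set" where
  "maximizers n N f = {r. is_arg_max f (\<lambda>r. r \<in> chamber n \<and> photon_number n r = N) r}"

(* With modes numbered from 0 the entries are (2n-1) a, (2n-3) a, ..., a. *)

definition dual_weyl :: "nat \<Rightarrow> real \<Rightarrow> real vec" where
  "dual_weyl n a = vec n (\<lambda>j. (2 * real n - 2 * real j - 1) * a)"

end

(* A squeezing generator or the generator of a passive unitary maps exponentially decaying
   coefficient families to such families and is skew on finite vectors, hence on the domain of its
   closure. So strong solutions conserve the norm, op_exp is single-valued, and it suffices to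
   exhibit a uniformly decaying solution of the coefficientwise differential equation.

   For squeezing this solution is a product of single-mode amplitudes, and it satisfies
   a_j psi = - tanh r_j a_j^* psi; with the commutation relations this determines all second and
   fourth moments, hence the Fisher matrix.

   A passive evolution acts on each sector of fixed particle number, where it is a finite linear
   system. If A' = [G, A] for coefficient matrices, then a^* A a u solves the same equation as u, so
   covariances are conserved when the generators are moved along this flow. The flow preserves the
   trace form, for which the generators are orthonormal, so the two Fisher matrices are conjugate by
   an orthogonal matrix.

   A smallest weight of at least 2 sinh^2 (2 a) forces all simple roots to be at least 2 a, so the
   spectrum dominates the dual-Weyl spectrum entrywise, with equality if the photon numbers agree. *)

theory Submission
  imports Defs "HOL-Analysis.Derivative"
begin

text \<open>Every vector on which operators are composed is kept in one class: families bounded by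
  \<open>C * q ^ deg n m\<close>. A ladder operator shifts the pattern and multiplies by the square
  root of an occupation number, and half of the geometric decay absorbs that factor. So the class is
  stable under products of generators, inner products converge, and no domain questions about the
  unbounded operators are left. Uniformity of the constants in time matters as well: a uniform bound
  on \<open>K (K (u t))\<close> turns a coefficientwise derivative into a derivative in norm. The
  obstacle in the definitions is \<open>op_exp\<close>, a definite description over limits of strong
  solutions. Two strong solutions keep their distance, and this pins down the limit. In the passive
  part the trace form is bilinear, without conjugation. The generators are then an orthonormal basis
  of all complex matrices, and the change of basis along the flow has its transpose as inverse,
  which is what similarity asks for.\<close>

subsection \<open>Square-summable families\<close>

definition l2 :: "('i \<Rightarrow> complex) \<Rightarrow> bool" where
  "l2 \<psi> \<longleftrightarrow> (\<lambda>m. (cmod (\<psi> m))\<^sup>2) summable_on UNIV"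

definition ip :: "('i \<Rightarrow> complex) \<Rightarrow> ('i \<Rightarrow> complex) \<Rightarrow> complex" where
  "ip \<phi> \<psi> = (\<Sum>\<^sub>\<infinity>m. cnj (\<phi> m) * \<psi> m)"

lemma fock_l2: "\<psi> \<in> fock n \<Longrightarrow> l2 \<psi>"
  by (simp add: fock_def l2_def)

lemma l2_cmult: "l2 \<psi> \<Longrightarrow> l2 (\<lambda>m. c * \<psi> m)"
  by (simp add: l2_def norm_mult power_mult_distrib summable_on_cmult_right)

lemma l2_add:
  assumes "l2 \<phi>" "l2 \<psi>"
  shows "l2 (\<lambda>m. \<phi> m + \<psi> m)"
  unfolding l2_def
proof (rule summable_on_comparison_test)
  show "(\<lambda>m. 2 * (cmod (\<phi> m))\<^sup>2 + 2 * (cmod (\<psi> m))\<^sup>2) summable_on UNIV"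
    using assms by (intro summable_on_add summable_on_cmult_right) (auto simp: l2_def)
  fix m
  have "(cmod (\<phi> m + \<psi> m))\<^sup>2 \<le> (cmod (\<phi> m) + cmod (\<psi> m))\<^sup>2"
    by (intro power_mono norm_triangle_ineq) auto
  also have "\<dots> \<le> 2 * (cmod (\<phi> m))\<^sup>2 + 2 * (cmod (\<psi> m))\<^sup>2"
    using zero_le_power2[of "cmod (\<phi> m) - cmod (\<psi> m)"] by (simp add: power2_eq_square algebra_simps)
  finally show "(cmod (\<phi> m + \<psi> m))\<^sup>2 \<le> 2 * (cmod (\<phi> m))\<^sup>2 + 2 * (cmod (\<psi> m))\<^sup>2" .
qed auto

lemma l2_diff: "l2 \<phi> \<Longrightarrow> l2 \<psi> \<Longrightarrow> l2 (\<lambda>m. \<phi> m - \<psi> m)"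
  using l2_add[of \<phi> "\<lambda>m. (-1) * \<psi> m"] l2_cmult[of \<psi> "-1"] by simp

lemma fnorm_nonneg [simp]: "0 \<le> fnorm \<psi>"
  by (simp add: fnorm_def infsum_nonneg)

lemma fnorm_sq: "(fnorm \<psi>)\<^sup>2 = (\<Sum>\<^sub>\<infinity>m. (cmod (\<psi> m))\<^sup>2)"
  by (simp add: fnorm_def infsum_nonneg)

lemma fnorm_cmult: "fnorm (\<lambda>m. c * \<psi> m) = cmod c * fnorm \<psi>"
  by (simp add: fnorm_def norm_mult power_mult_distrib infsum_cmult_right' real_sqrt_mult)

lemma fnorm_eq_0D:
  assumes "fnorm \<psi> = 0" "l2 \<psi>"
  shows "\<psi> m = 0"
proof -
  have "(\<Sum>\<^sub>\<infinity>m. (cmod (\<psi> m))\<^sup>2) \<le> 0"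
    using assms(1) by (metis fnorm_sq order_refl zero_power2)
  then show ?thesis
    using nonneg_infsum_le_0D[of "\<lambda>m. (cmod (\<psi> m))\<^sup>2" UNIV m] assms(2) by (simp add: l2_def)
qed

text \<open>Minkowski's inequality for finite partial sums, where \<open>L2_set\<close> provides it,
  followed by passage to the infinite sum.\<close>

lemma fnorm_triangle:
  assumes "l2 \<phi>" "l2 \<psi>"
  shows "fnorm (\<lambda>m. \<phi> m + \<psi> m) \<le> fnorm \<phi> + fnorm \<psi>"
proof -
  have part: "L2_set (\<lambda>m. cmod (\<xi> m)) F \<le> fnorm \<xi>" if "finite F" "l2 \<xi>" for \<xi> :: fvec and F
    unfolding L2_set_def fnorm_def using that
    by (intro real_sqrt_le_mono finite_sum_le_infsum) (auto simp: l2_def)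
  have "(fnorm (\<lambda>m. \<phi> m + \<psi> m))\<^sup>2 \<le> (fnorm \<phi> + fnorm \<psi>)\<^sup>2"
    unfolding fnorm_sq
  proof (rule infsum_le_finite_sums)
    show "(\<lambda>m. (cmod (\<phi> m + \<psi> m))\<^sup>2) summable_on UNIV"
      using l2_add[OF assms] by (simp add: l2_def)
    fix F :: "(nat \<Rightarrow> nat) set" assume F: "finite F"
    have "(\<Sum>m\<in>F. (cmod (\<phi> m + \<psi> m))\<^sup>2) = (L2_set (\<lambda>m. cmod (\<phi> m + \<psi> m)) F)\<^sup>2"
      by (simp add: L2_set_def sum_nonneg)
    also have "\<dots> \<le> (L2_set (\<lambda>m. cmod (\<phi> m) + cmod (\<psi> m)) F)\<^sup>2"
      by (intro power_mono L2_set_mono norm_triangle_ineq L2_set_nonneg) auto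
    also have "\<dots> \<le> (fnorm \<phi> + fnorm \<psi>)\<^sup>2"
      using L2_set_triangle_ineq[of "\<lambda>m. cmod (\<phi> m)" "\<lambda>m. cmod (\<psi> m)" F]
        part[OF F assms(1)] part[OF F assms(2)]
      by (intro power_mono L2_set_nonneg) auto
    finally show "(\<Sum>m\<in>F. (cmod (\<phi> m + \<psi> m))\<^sup>2) \<le> (fnorm \<phi> + fnorm \<psi>)\<^sup>2" .
  qed
  then show ?thesis
    by (rule power2_le_imp_le) simp
qed

lemma fdist_commute: "fdist \<phi> \<psi> = fdist \<psi> \<phi>"
  by (simp add: fdist_def fnorm_def norm_minus_commute)

lemma fdist_triangle:
  assumes "l2 \<phi>" "l2 \<psi>" "l2 \<xi>"
  shows "fdist \<phi> \<xi> \<le> fdist \<phi> \<psi> + fdist \<psi> \<xi>"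
  using fnorm_triangle[OF l2_diff[OF assms(1,2)] l2_diff[OF assms(2,3)]] by (simp add: fdist_def)

lemma fnorm_diff_le:
  assumes "l2 \<phi>" "l2 \<psi>"
  shows "\<bar>fnorm \<phi> - fnorm \<psi>\<bar> \<le> fdist \<phi> \<psi>"
proof -
  have "fnorm \<phi> \<le> fdist \<phi> \<psi> + fnorm \<psi>"
    using fnorm_triangle[OF l2_diff[OF assms] assms(2)] by (simp add: fdist_def)
  moreover have "fnorm \<psi> \<le> fdist \<phi> \<psi> + fnorm \<phi>"
    using fnorm_triangle[OF l2_diff[OF assms(2,1)] assms(1)] fdist_commute[of \<phi> \<psi>]
    by (simp add: fdist_def)
  ultimately show ?thesis by linarith
qed

lemma fnorm_mono:
  assumes "\<And>m. cmod (\<phi> m) \<le> g m" "(\<lambda>m. (g m)\<^sup>2) summable_on UNIV"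
  shows "l2 \<phi>" "fnorm \<phi> \<le> sqrt (\<Sum>\<^sub>\<infinity>m. (g m)\<^sup>2)"
proof -
  have le: "(cmod (\<phi> m))\<^sup>2 \<le> (g m)\<^sup>2" for m
    by (intro power_mono assms) simp
  show "l2 \<phi>"
    unfolding l2_def using assms(2) le by (rule summable_on_comparison_test) auto
  then show "fnorm \<phi> \<le> sqrt (\<Sum>\<^sub>\<infinity>m. (g m)\<^sup>2)"
    unfolding fnorm_def using le assms(2)
    by (intro real_sqrt_le_mono infsum_mono) (auto simp: l2_def)
qed

lemma summable_cnj_mult:
  assumes "l2 \<phi>" "l2 \<psi>"
  shows "(\<lambda>m. cnj (\<phi> m) * \<psi> m) summable_on UNIV"
proof (rule abs_summable_summable, rule summable_on_comparison_test)
  show "(\<lambda>m. (cmod (\<phi> m))\<^sup>2 + (cmod (\<psi> m))\<^sup>2) summable_on UNIV"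
    using assms by (intro summable_on_add) (auto simp: l2_def)
  fix m
  have "cmod (\<phi> m) * cmod (\<psi> m) \<le> (cmod (\<phi> m))\<^sup>2 + (cmod (\<psi> m))\<^sup>2"
  proof -
    have "2 * (cmod (\<phi> m) * cmod (\<psi> m)) \<le> (cmod (\<phi> m))\<^sup>2 + (cmod (\<psi> m))\<^sup>2"
      using zero_le_power2[of "cmod (\<phi> m) - cmod (\<psi> m)"] by (simp add: power2_diff)
    moreover have "0 \<le> cmod (\<phi> m) * cmod (\<psi> m)" by simp
    ultimately show ?thesis by linarith
  qed
  then show "norm (cnj (\<phi> m) * \<psi> m) \<le> (cmod (\<phi> m))\<^sup>2 + (cmod (\<psi> m))\<^sup>2"
    by (simp add: norm_mult)
qed auto

lemma ip_add:
  "l2 \<phi> \<Longrightarrow> l2 \<psi> \<Longrightarrow> l2 \<xi> \<Longrightarrow> ip \<phi> (\<lambda>m. \<psi> m + \<xi> m) = ip \<phi> \<psi> + ip \<phi> \<xi>"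
  by (simp add: ip_def ring_distribs infsum_add summable_cnj_mult)

lemma ip_cmult: "ip \<phi> (\<lambda>m. c * \<psi> m) = c * ip \<phi> \<psi>"
  by (simp add: ip_def mult.left_commute infsum_cmult_right')

lemma ip_diff:
  "l2 \<phi> \<Longrightarrow> l2 \<psi> \<Longrightarrow> l2 \<xi> \<Longrightarrow> ip \<phi> (\<lambda>m. \<psi> m - \<xi> m) = ip \<phi> \<psi> - ip \<phi> \<xi>"
  using ip_add[of \<phi> \<psi> "\<lambda>m. (-1) * \<xi> m"] ip_cmult[of \<phi> "-1" \<xi>] l2_cmult[of \<xi> "-1"]
  by simp

lemma l2_zero [simp]: "l2 (\<lambda>m. 0)"
  by (simp add: l2_def)

lemma l2_sum: "(\<And>i. i \<in> I \<Longrightarrow> l2 (f i)) \<Longrightarrow> l2 (\<lambda>m. \<Sum>i\<in>I. f i m)"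
  by (induction I rule: infinite_finite_induct) (auto intro: l2_add)

lemma ip_sum:
  "l2 \<phi> \<Longrightarrow> (\<And>i. i \<in> I \<Longrightarrow> l2 (f i)) \<Longrightarrow> ip \<phi> (\<lambda>m. \<Sum>i\<in>I. f i m) = (\<Sum>i\<in>I. ip \<phi> (f i))"
proof (induction I rule: infinite_finite_induct)
  case (insert x F)
  then show ?case by (simp add: ip_add l2_sum)
qed (auto simp: ip_def)

lemma cnj_ip: "cnj (ip \<phi> \<psi>) = ip \<psi> \<phi>"
  by (simp add: ip_def mult.commute flip: infsum_cnj)

lemma ip_self:
  assumes "l2 \<psi>"
  shows "ip \<psi> \<psi> = of_real ((fnorm \<psi>)\<^sup>2)"
proof -
  have "cnj (\<psi> m) * \<psi> m = of_real ((cmod (\<psi> m))\<^sup>2)" for m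
    using complex_norm_square[of "\<psi> m"] by (simp add: mult.commute)
  moreover have "((\<lambda>m. of_real ((cmod (\<psi> m))\<^sup>2)) has_sum complex_of_real ((fnorm \<psi>)\<^sup>2)) UNIV"
    using assms by (subst has_sum_of_real_iff) (simp add: fnorm_sq l2_def)
  ultimately show ?thesis
    by (simp add: ip_def infsumI)
qed

text \<open>Adding one quantum in mode \<open>j\<close> is an injective reindexing. It misses only
  patterns with \<open>m j = 0\<close>, where \<open>creat j\<close> vanishes. Reindexing of
  \<open>infsum\<close> is valid whether or not the sum converges, so the identity holds for
  arbitrary families.\<close>

lemma ip_annih: "ip \<phi> (annih j \<psi>) = ip (creat j \<phi>) \<psi>"
proof -
  define s where "s m = m(j := m j + 1)" for m :: "nat \<Rightarrow> nat"
  have inj: "inj s"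
    by (rule injI) (metis add_right_imp_eq fun_upd_idem_iff fun_upd_same fun_upd_upd s_def)
  have "ip (creat j \<phi>) \<psi> = (\<Sum>\<^sub>\<infinity>m\<in>range s. cnj (creat j \<phi> m) * \<psi> m)"
    unfolding ip_def
  proof (rule infsum_cong_neutral)
    fix m assume m: "m \<in> UNIV - range s"
    have "m j = 0"
    proof (rule ccontr)
      assume "m j \<noteq> 0"
      then have "m = s (m(j := m j - 1))" by (auto simp: s_def)
      with m show False by blast
    qed
    then show "cnj (creat j \<phi> m) * \<psi> m = 0" by (simp add: creat_def)
  qed auto
  also have "\<dots> = (\<Sum>\<^sub>\<infinity>m. cnj (creat j \<phi> (s m)) * \<psi> (s m))"
    by (subst infsum_reindex[OF inj]) (simp add: o_def)
  also have "\<dots> = ip \<phi> (annih j \<psi>)"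
    unfolding ip_def
    by (intro infsum_cong) (simp add: creat_def annih_def s_def ac_simps)
  finally show ?thesis ..
qed

lemma ip_creat: "ip \<phi> (creat j \<psi>) = ip (annih j \<phi>) \<psi>"
  using ip_annih[of \<psi> j \<phi>] cnj_ip[of \<psi> "annih j \<phi>"] cnj_ip[of "creat j \<psi>" \<phi>] by simp

subsection \<open>Exponentially decaying families\<close>

definition deg :: "nat \<Rightarrow> (nat \<Rightarrow> nat) \<Rightarrow> nat" where
  "deg n m = (\<Sum>j<n. m j)"

definition decays :: "nat \<Rightarrow> real \<Rightarrow> real \<Rightarrow> fvec \<Rightarrow> bool" where
  "decays n C q \<psi> \<longleftrightarrow> (\<forall>m. m \<notin> occupations n \<longrightarrow> \<psi> m = 0) \<and> (\<forall>m. cmod (\<psi> m) \<le> C * q ^ deg n m)"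

text \<open>One pair \<open>C\<close>, \<open>q\<close> serves the whole family. Index sets are time
  intervals, cutoffs, or a singleton \<open>{\<psi>}\<close> with the identity map, which expresses
  decay of a single vector.\<close>

definition decaying :: "nat \<Rightarrow> 'i set \<Rightarrow> ('i \<Rightarrow> fvec) \<Rightarrow> bool" where
  "decaying n I f \<longleftrightarrow> (\<exists>C q. 0 < q \<and> q < 1 \<and> (\<forall>i\<in>I. decays n C q (f i)))"

lemma decaying_image: "decaying n I (\<lambda>i. g (f i)) \<longleftrightarrow> decaying n (f ` I) g"
  by (simp add: decaying_def)

lemma decaying_subset: "decaying n I f \<Longrightarrow> J \<subseteq> I \<Longrightarrow> decaying n J f"
  by (auto simp: decaying_def)

lemma decays_nonneg: "decays n C q \<psi> \<Longrightarrow> 0 < q \<Longrightarrow> 0 \<le> C"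
  unfolding decays_def by (metis norm_ge_zero order_trans zero_le_mult_iff zero_less_power not_le)

lemma decays_mono:
  assumes "decays n C q \<psi>" "0 < q" "C \<le> C'" "q \<le> q'"
  shows "decays n C' q' \<psi>"
  unfolding decays_def
proof safe
  fix m
  have "cmod (\<psi> m) \<le> C * q ^ deg n m" using assms by (simp add: decays_def)
  also have "\<dots> \<le> C' * q' ^ deg n m"
    using assms decays_nonneg[OF assms(1,2)] by (intro mult_mono power_mono) auto
  finally show "cmod (\<psi> m) \<le> C' * q' ^ deg n m" .
qed (use assms in \<open>auto simp: decays_def\<close>)

lemma occupations_Suc:
  "bij_betw (\<lambda>(m, k). m(n := k)) (occupations n \<times> UNIV) (occupations (Suc n))"
  by (rule bij_betwI[where g = "\<lambda>m. (m(n := 0), m n)"])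
    (auto simp: occupations_def fun_eq_iff Suc_le_eq)

lemma deg_Suc_upd: "deg (Suc n) (m(n := k)) = deg n m + k"
  by (simp add: deg_def)

text \<open>The series is a product of \<open>n\<close> geometric series, one for each mode; the
  induction splits off the last mode.\<close>

lemma summable_geometric_deg:
  fixes q :: real
  assumes "0 \<le> q" "q < 1"
  shows "(\<lambda>m. q ^ deg n m) summable_on occupations n"
proof (induction n)
  case 0
  have "occupations 0 = {\<lambda>_. 0}" by (auto simp: occupations_def)
  then show ?case by simp
next
  case (Suc n)
  have geo: "((\<lambda>k. q ^ k) has_sum (1 / (1 - q))) UNIV"
    using assms geometric_sums[of q] by (intro norm_summable_imp_has_sum) (auto simp: summable_geometric)
  have "(\<lambda>(m, k). q ^ deg n m * q ^ k) summable_on (occupations n \<times> UNIV)"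
  proof (rule summable_on_SigmaI)
    show "((\<lambda>k. (case (m, k) of (m, k) \<Rightarrow> q ^ deg n m * q ^ k)) has_sum
        (q ^ deg n m * (1 / (1 - q)))) UNIV" for m
      using has_sum_cmult_right[OF geo] by simp
    show "(\<lambda>m. q ^ deg n m * (1 / (1 - q))) summable_on occupations n"
      by (rule summable_on_cmult_left[OF Suc])
  qed (use assms in auto)
  then have "(\<lambda>x. q ^ deg (Suc n) (case x of (m, k) \<Rightarrow> m(n := k))) summable_on (occupations n \<times> UNIV)"
    by (rule summable_on_cong[THEN iffD1, rotated]) (auto simp: deg_Suc_upd power_add)
  then show ?case
    using summable_on_reindex_bij_betw[OF occupations_Suc, of "\<lambda>m. q ^ deg (Suc n) m" n] by simp
qed

definition geo_norm :: "nat \<Rightarrow> real \<Rightarrow> real" where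
  "geo_norm n q = sqrt (\<Sum>\<^sub>\<infinity>m\<in>occupations n. (q ^ deg n m)\<^sup>2)"

text \<open>The norm bound is linear in \<open>C\<close>. A coefficientwise estimate whose constant
  tends to 0 with \<open>q\<close> fixed thus becomes convergence in norm.\<close>

lemma decays_fnorm:
  assumes "decays n C q \<psi>" "0 < q" "q < 1"
  shows "\<psi> \<in> fock n" "fnorm \<psi> \<le> C * geo_norm n q"
proof -
  have C: "0 \<le> C" using assms decays_nonneg by blast
  define g where "g m = (if m \<in> occupations n then C * q ^ deg n m else 0)" for m
  have "(\<lambda>m. (q\<^sup>2) ^ deg n m) summable_on occupations n"
    using assms by (intro summable_geometric_deg) (auto simp: power_less_one_iff abs_square_less_1)
  then have s0: "(\<lambda>m. (q ^ deg n m)\<^sup>2) summable_on occupations n"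
    by (simp add: power_mult [symmetric] mult.commute)
  have s: "(\<lambda>m. (C * q ^ deg n m)\<^sup>2) summable_on occupations n"
    using summable_on_cmult_right[OF s0] by (simp add: power_mult_distrib)
  have sg: "(\<lambda>m. (g m)\<^sup>2) summable_on UNIV"
    using s by (rule summable_on_cong_neutral[THEN iffD1, rotated -1]) (auto simp: g_def)
  have b: "cmod (\<psi> m) \<le> g m" for m using assms(1) by (auto simp: decays_def g_def)
  show "\<psi> \<in> fock n"
    using fnorm_mono(1)[OF b sg] assms(1) by (auto simp: fock_def l2_def decays_def)
  have "(\<Sum>\<^sub>\<infinity>m. (g m)\<^sup>2) = (\<Sum>\<^sub>\<infinity>m\<in>occupations n. (C * q ^ deg n m)\<^sup>2)"
    by (rule infsum_cong_neutral) (auto simp: g_def)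
  also have "\<dots> = C\<^sup>2 * (\<Sum>\<^sub>\<infinity>m\<in>occupations n. (q ^ deg n m)\<^sup>2)"
    by (simp add: power_mult_distrib infsum_cmult_right')
  finally show "fnorm \<psi> \<le> C * geo_norm n q"
    using fnorm_mono(2)[OF b sg] C by (simp add: geo_norm_def real_sqrt_mult)
qed

lemma decaying_fock: "decaying n I f \<Longrightarrow> i \<in> I \<Longrightarrow> f i \<in> fock n"
  unfolding decaying_def using decays_fnorm(1) by blast

lemma decaying_l2: "decaying n I f \<Longrightarrow> i \<in> I \<Longrightarrow> l2 (f i)"
  by (rule fock_l2[OF decaying_fock])

lemma decaying_add:
  assumes "decaying n I f" "decaying n I g"
  shows "decaying n I (\<lambda>i m. f i m + g i m)"
proof -
  obtain C p D q where *: "0 < p" "p < 1" "0 < q" "q < 1"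
    "\<And>i. i \<in> I \<Longrightarrow> decays n C p (f i)" "\<And>i. i \<in> I \<Longrightarrow> decays n D q (g i)"
    using assms unfolding decaying_def by blast
  have "decays n (C + D) (max p q) (\<lambda>m. f i m + g i m)" if i: "i \<in> I" for i
  proof -
    have "decays n C (max p q) (f i)" "decays n D (max p q) (g i)"
      using decays_mono[OF *(5)[OF i] *(1)] decays_mono[OF *(6)[OF i] *(3)] by auto
    then show ?thesis
      unfolding decays_def using norm_triangle_mono[of "f i _" _ "g i _"]
      by (simp add: distrib_right)
  qed
  with * show ?thesis
    unfolding decaying_def by (intro exI[of _ "C + D"] exI[of _ "max p q"]) auto
qed

lemma decaying_cmult:
  assumes "decaying n I f" "\<And>i. i \<in> I \<Longrightarrow> cmod (c i) \<le> B"
  shows "decaying n I (\<lambda>i m. c i * f i m)"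
proof -
  obtain C p where *: "0 < p" "p < 1" "\<And>i. i \<in> I \<Longrightarrow> decays n C p (f i)"
    using assms unfolding decaying_def by blast
  have "decays n (B * C) p (\<lambda>m. c i * f i m)" if i: "i \<in> I" for i
  proof -
    have "cmod (c i) * cmod (f i m) \<le> B * (C * p ^ deg n m)" for m
      using *(3)[OF i] assms(2)[OF i] order_trans[OF norm_ge_zero assms(2)[OF i]] unfolding decays_def
      by (intro mult_mono) auto
    then show ?thesis using *(3)[OF i] by (auto simp: decays_def norm_mult mult.assoc)
  qed
  with * show ?thesis unfolding decaying_def by blast
qed

lemma decaying_const_cmult: "decaying n I f \<Longrightarrow> decaying n I (\<lambda>i m. c * f i m)"
  by (rule decaying_cmult[where c = "\<lambda>_. c" and B = "cmod c"]) auto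

lemma decaying_diff:
  assumes "decaying n I f" "decaying n I g"
  shows "decaying n I (\<lambda>i m. f i m - g i m)"
  using decaying_add[OF assms(1) decaying_const_cmult[OF assms(2), of "-1"]] by simp

lemma decaying_zero: "decaying n I (\<lambda>i m. 0)"
  unfolding decaying_def by (intro exI[of _ 0] exI[of _ "1/2"]) (auto simp: decays_def)

lemma decaying_sum:
  "(\<And>j. j \<in> J \<Longrightarrow> decaying n I (f j)) \<Longrightarrow> decaying n I (\<lambda>i m. \<Sum>j\<in>J. f j i m)"
  by (induction J rule: infinite_finite_induct) (auto intro: decaying_add decaying_zero)

text \<open>Write \<open>q\<close> as \<open>sqrt q * sqrt q\<close>: one factor stays as decay, the
  other makes the linear term bounded. This is the price of one ladder operator.\<close>

lemma linear_le_geometric: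
  fixes q :: real
  assumes "0 < q" "q < 1"
  obtains A where "\<And>k. (real k + 1) * q ^ k \<le> A * sqrt q ^ k" "0 \<le> A"
proof -
  have s: "0 < sqrt q" "sqrt q < 1" using assms by (auto simp: real_sqrt_lt_1_iff)
  have "(\<lambda>k. real k * sqrt q ^ k + sqrt q ^ k) \<longlonglongrightarrow> 0 + 0"
    using s by (intro tendsto_add powser_times_n_limit_0 LIMSEQ_power_zero) auto
  then have "Bseq (\<lambda>k. real k * sqrt q ^ k + sqrt q ^ k)"
    by (intro convergent_imp_Bseq) (auto simp: convergent_def)
  then obtain A where A: "A > 0" "\<And>k. norm (real k * sqrt q ^ k + sqrt q ^ k) \<le> A"
    by (auto simp: Bseq_def)
  have "(real k + 1) * q ^ k \<le> A * sqrt q ^ k" for k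
  proof -
    have q: "q ^ k = sqrt q ^ k * sqrt q ^ k"
      using assms by (simp flip: power_mult_distrib)
    have "(real k * sqrt q ^ k + sqrt q ^ k) * sqrt q ^ k \<le> A * sqrt q ^ k"
      using A(2)[of k] s by (intro mult_right_mono) auto
    then show ?thesis by (simp add: q algebra_simps)
  qed
  with A(1) show ?thesis by (intro that[of A]) auto
qed

lemma deg_upd:
  assumes "j < n"
  shows "deg n (m(j := k)) + m j = deg n m + k"
proof -
  have "deg n m' = m' j + (\<Sum>i\<in>{..<n} - {j}. m' i)" for m'
    unfolding deg_def using assms by (subst sum.remove[of _ j]) auto
  from this[of m] this[of "m(j := k)"] show ?thesis
    by simp
qed

lemma le_deg: "j < n \<Longrightarrow> m j \<le> deg n m"
  unfolding deg_def by (rule member_le_sum) auto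

lemma upd_occupations: "j < n \<Longrightarrow> m(j := k) \<in> occupations n \<longleftrightarrow> m \<in> occupations n"
  by (auto simp: occupations_def)

lemma sqrt_le_self:
  fixes x :: real
  assumes "1 \<le> x"
  shows "sqrt x \<le> x"
  using assms mult_left_mono[of 1 x x] by (intro real_le_lsqrt) (auto simp: power2_eq_square)

lemma decaying_annih:
  assumes "decaying n I f" and j: "j < n"
  shows "decaying n I (\<lambda>i. annih j (f i))"
proof -
  obtain C p where *: "0 < p" "p < 1" "\<And>i. i \<in> I \<Longrightarrow> decays n C p (f i)"
    using assms unfolding decaying_def by blast
  obtain A where A: "\<And>k. (real k + 1) * p ^ k \<le> A * sqrt p ^ k" "0 \<le> A"
    using linear_le_geometric *(1,2) by blast
  have s: "0 < sqrt p" "sqrt p < 1" using * by (auto simp: real_sqrt_lt_1_iff)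
  have "decays n (C * A) (sqrt p) (annih j (f i))" if i: "i \<in> I" for i
    unfolding decays_def
  proof safe
    fix m assume "m \<notin> occupations n"
    then show "annih j (f i) m = 0"
      using *(3)[OF i] upd_occupations[OF j] by (simp add: annih_def decays_def)
  next
    fix m
    have C: "0 \<le> C" using *(3)[OF i] *(1) decays_nonneg by blast
    have d: "deg n (m(j := Suc (m j))) = Suc (deg n m)"
      using deg_upd[OF j, of m "Suc (m j)"] by simp
    have "cmod (annih j (f i) m) = sqrt (real (m j + 1)) * cmod (f i (m(j := Suc (m j))))"
      by (simp add: annih_def norm_mult)
    also have "\<dots> \<le> (real (deg n m) + 1) * (C * p ^ deg n m)"
    proof (intro mult_mono)
      show "sqrt (real (m j + 1)) \<le> real (deg n m) + 1"
        using sqrt_le_self[of "real (m j + 1)"] le_deg[OF j, of m] by linarith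
      have "cmod (f i (m(j := Suc (m j)))) \<le> C * p ^ Suc (deg n m)"
        using *(3)[OF i] d unfolding decays_def by metis
      also have "\<dots> \<le> C * p ^ deg n m"
        using C * by (intro mult_left_mono power_decreasing) auto
      finally show "cmod (f i (m(j := Suc (m j)))) \<le> C * p ^ deg n m" .
    qed auto
    also have "\<dots> = C * ((real (deg n m) + 1) * p ^ deg n m)" by simp
    also have "\<dots> \<le> C * (A * sqrt p ^ deg n m)" by (intro mult_left_mono A C)
    finally show "cmod (annih j (f i) m) \<le> C * A * sqrt p ^ deg n m" by simp
  qed
  with s show ?thesis unfolding decaying_def by blast
qed

text \<open>The coefficient that is read has degree one less, which costs the factor
  \<open>1 / p\<close>. At \<open>m j = 0\<close> the truncated difference does no harm, since the
  square root in front is 0.\<close>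

lemma decaying_creat:
  assumes "decaying n I f" and j: "j < n"
  shows "decaying n I (\<lambda>i. creat j (f i))"
proof -
  obtain C p where *: "0 < p" "p < 1" "\<And>i. i \<in> I \<Longrightarrow> decays n C p (f i)"
    using assms unfolding decaying_def by blast
  obtain A where A: "\<And>k. (real k + 1) * p ^ k \<le> A * sqrt p ^ k" "0 \<le> A"
    using linear_le_geometric *(1,2) by blast
  have s: "0 < sqrt p" "sqrt p < 1" using * by (auto simp: real_sqrt_lt_1_iff)
  have "decays n (C / p * A) (sqrt p) (creat j (f i))" if i: "i \<in> I" for i
    unfolding decays_def
  proof safe
    fix m assume "m \<notin> occupations n"
    then show "creat j (f i) m = 0"
      using *(3)[OF i] upd_occupations[OF j] by (simp add: creat_def decays_def)
  next
    fix m
    have C: "0 \<le> C" using *(3)[OF i] *(1) decays_nonneg by blast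
    show "cmod (creat j (f i) m) \<le> C / p * A * sqrt p ^ deg n m"
    proof (cases "m j")
      case 0
      then show ?thesis using C * A s by (simp add: creat_def)
    next
      case (Suc k)
      have d: "Suc (deg n (m(j := k))) = deg n m"
        using deg_upd[OF j, of m k] Suc by simp
      have "cmod (creat j (f i) m) = sqrt (real (m j)) * cmod (f i (m(j := k)))"
        using Suc by (simp add: creat_def norm_mult)
      also have "\<dots> \<le> (real (deg n m) + 1) * (C / p * p ^ deg n m)"
      proof (intro mult_mono)
        show "sqrt (real (m j)) \<le> real (deg n m) + 1"
          using sqrt_le_self[of "real (m j)"] Suc le_deg[OF j, of m] by linarith
        have "cmod (f i (m(j := k))) \<le> C * p ^ deg n (m(j := k))"
          using *(3)[OF i] unfolding decays_def by metis
        also have "\<dots> = C / p * p ^ deg n m" using * by (simp flip: d)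
        finally show "cmod (f i (m(j := k))) \<le> C / p * p ^ deg n m" .
      qed auto
      also have "\<dots> = C / p * ((real (deg n m) + 1) * p ^ deg n m)" by simp
      also have "\<dots> \<le> C / p * (A * sqrt p ^ deg n m)"
        using C * by (intro mult_left_mono A) auto
      finally show ?thesis by simp
    qed
  qed
  with s show ?thesis unfolding decaying_def by blast
qed

lemma finite_deg_le: "finite {m \<in> occupations n. deg n m \<le> M}"
proof -
  have "{m \<in> occupations n. deg n m \<le> M} \<subseteq> {m. \<forall>j. (j \<in> {..<n} \<longrightarrow> m j \<in> {..M}) \<and> (j \<notin> {..<n} \<longrightarrow> m j = 0)}"
    using order_trans[OF le_deg] by (auto simp: occupations_def)
  moreover have "finite {m. \<forall>j. (j \<in> {..<n} \<longrightarrow> m j \<in> {..M}) \<and> (j \<notin> {..<n} \<longrightarrow> m j = (0::nat))}"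
    by (rule finite_set_of_finite_funs) auto
  ultimately show ?thesis by (rule finite_subset)
qed

lemma finite_fock_decaying:
  assumes "\<psi> \<in> finite_fock n"
  shows "decaying n {\<psi>} (\<lambda>x. x)"
proof -
  define S where "S = {m. \<psi> m \<noteq> 0}"
  have fin: "finite S" using assms by (simp add: finite_fock_def S_def)
  \<comment> \<open>Any rate below 1 would do for a finite support; the weight
    \<open>2 ^ deg n m\<close> matches the choice \<open>q = 1/2\<close>.\<close>
  define C where "C = (\<Sum>m\<in>S. cmod (\<psi> m) * 2 ^ deg n m)"
  have "cmod (\<psi> m) \<le> C * (1 / 2) ^ deg n m" for m
  proof (cases "m \<in> S")
    case True
    have "cmod (\<psi> m) * 2 ^ deg n m \<le> C"
      unfolding C_def using fin True
      by (intro member_le_sum[where f = "\<lambda>m. cmod (\<psi> m) * 2 ^ deg n m"]) auto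
    then show ?thesis by (simp add: power_one_over field_simps)
  next
    case False
    then show ?thesis by (simp add: S_def C_def sum_nonneg)
  qed
  then have "decays n C (1 / 2) \<psi>"
    using assms by (auto simp: decays_def finite_fock_def fock_def)
  then show ?thesis unfolding decaying_def by (intro exI[of _ C] exI[of _ "1/2"]) auto
qed

lemma ip_add_left:
  "l2 \<phi> \<Longrightarrow> l2 \<psi> \<Longrightarrow> l2 \<xi> \<Longrightarrow> ip (\<lambda>m. \<phi> m + \<psi> m) \<xi> = ip \<phi> \<xi> + ip \<psi> \<xi>"
  using ip_add[of \<xi> \<phi> \<psi>] cnj_ip[of \<xi>] by (metis complex_cnj_add)

lemma decaying_bounded:
  assumes "decaying n I f"
  obtains B where "\<And>i. i \<in> I \<Longrightarrow> fnorm (f i) \<le> B"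
proof -
  obtain C q where *: "0 < q" "q < 1" "\<And>i. i \<in> I \<Longrightarrow> decays n C q (f i)"
    using assms unfolding decaying_def by blast
  show ?thesis by (rule that[of "C * geo_norm n q"]) (use decays_fnorm(2) * in blast)
qed

section \<open>Mean value and Taylor estimates for complex-valued curves\<close>

lemma vector_derivative_bound:
  fixes f :: "real \<Rightarrow> complex"
  assumes "convex S" "\<And>x. x \<in> S \<Longrightarrow> (f has_vector_derivative f' x) (at x within S)"
    "\<And>x. x \<in> S \<Longrightarrow> cmod (f' x) \<le> B" "x \<in> S" "y \<in> S"
  shows "cmod (f x - f y) \<le> B * \<bar>x - y\<bar>"
proof -
  have "onorm (\<lambda>h. h *\<^sub>R f' z) \<le> B" if "z \<in> S" for z
    using assms(3)[OF that] by (intro onorm_le) (simp add: mult.commute[of _ "cmod (f' z)"] mult_right_mono)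
  then show ?thesis
    using differentiable_bound[OF assms(1) _ _ assms(4,5), of f "\<lambda>x h. h *\<^sub>R f' x" B] assms(2)
    by (simp add: has_vector_derivative_def)
qed

text \<open>The mean value bound is used twice, which gives \<open>B\<close> in place of the sharp
  \<open>B / 2\<close>; only the quadratic order matters later. Derivatives within \<open>S\<close>
  cover the end points of the time interval.\<close>

lemma vector_taylor2:
  fixes f :: "real \<Rightarrow> complex"
  assumes S: "convex S"
    and f': "\<And>x. x \<in> S \<Longrightarrow> (f has_vector_derivative f' x) (at x within S)"
    and f'': "\<And>x. x \<in> S \<Longrightarrow> (f' has_vector_derivative f'' x) (at x within S)"
    and B: "\<And>x. x \<in> S \<Longrightarrow> cmod (f'' x) \<le> B" and st: "s \<in> S" "t \<in> S"
  shows "cmod (f s - f t - of_real (s - t) * f' t) \<le> B * (s - t)\<^sup>2"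
proof -
  \<comment> \<open>On the segment, unlike on all of \<open>S\<close>, every point is at most
    \<open>\<bar>s - t\<bar>\<close> away from \<open>t\<close>.\<close>
  define T where "T = closed_segment s t"
  have T: "T \<subseteq> S" unfolding T_def using S st by (rule closed_segment_subset[rotated 2])
  have le: "\<bar>x - t\<bar> \<le> \<bar>s - t\<bar>" if "x \<in> T" for x
    using that by (auto simp: T_def closed_segment_eq_real_ivl split: if_splits)
  have "cmod ((f s - of_real s * f' t) - (f t - of_real t * f' t)) \<le> (B * \<bar>s - t\<bar>) * \<bar>s - t\<bar>"
  proof (rule vector_derivative_bound[of T])
    fix x assume x: "x \<in> T"
    show "((\<lambda>x. f x - of_real x * f' t) has_vector_derivative (f' x - f' t)) (at x within T)"
      using x T by (auto intro!: derivative_eq_intros has_vector_derivative_within_subset[OF f'])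
    have "cmod (f' x - f' t) \<le> B * \<bar>x - t\<bar>"
      using S f'' B x T st by (intro vector_derivative_bound[of S f' f'']) auto
    also have "\<dots> \<le> B * \<bar>s - t\<bar>"
      using B[OF st(1)] le[OF x] by (intro mult_left_mono) (auto intro: order_trans[OF norm_ge_zero])
    finally show "cmod (f' x - f' t) \<le> B * \<bar>s - t\<bar>" .
  qed (auto simp: T_def)
  then show ?thesis
    by (simp add: algebra_simps power2_eq_square)
qed

lemma finite_fock_diff:
  assumes "\<phi> \<in> finite_fock n" "\<psi> \<in> finite_fock n"
  shows "(\<lambda>m. \<phi> m - \<psi> m) \<in> finite_fock n"
proof -
  have "{m. \<phi> m - \<psi> m \<noteq> 0} \<subseteq> {m. \<phi> m \<noteq> 0} \<union> {m. \<psi> m \<noteq> 0}" by auto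
  with assms l2_diff[of \<phi> \<psi>] show ?thesis
    by (auto simp: finite_fock_def fock_def l2_def intro: finite_subset)
qed

lemma tendsto_fnorm:
  assumes "\<And>k. l2 (f k)" "l2 \<psi>" "((\<lambda>k. fdist (f k) \<psi>) \<longlongrightarrow> 0) F"
  shows "((\<lambda>k. fnorm (f k)) \<longlongrightarrow> fnorm \<psi>) F"
proof -
  have "((\<lambda>k. fnorm (f k) - fnorm \<psi>) \<longlongrightarrow> 0) F"
    by (rule Lim_null_comparison[OF _ assms(3)]) (use fnorm_diff_le assms in auto)
  then show ?thesis by (simp add: LIM_zero_iff)
qed

lemma finite_fock_l2: "\<psi> \<in> finite_fock n \<Longrightarrow> l2 \<psi>"
  by (auto simp: finite_fock_def intro: fock_l2)

lemma closure_dom_l2: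
  assumes "\<psi> \<in> closure_dom n K"
  shows "l2 \<psi>" "l2 (K \<psi>)"
  using assms by (auto simp: closure_dom_def intro: fock_l2)

subsection \<open>Skew generators\<close>

text \<open>\<open>K_deriv\<close> encodes linearity together with locality: in the instances each
  coefficient of \<open>K \<psi>\<close> involves finitely many coefficients of
  \<open>\<psi>\<close>. Skewness is asked on finite vectors, where the inner product is a finite
  sum; the closure inherits its consequences.\<close>

locale skew_generator =
  fixes n :: nat and K :: fop
  assumes K_add: "K (\<lambda>m. \<phi> m + \<psi> m) = (\<lambda>m. K \<phi> m + K \<psi> m)"
    and K_cmult: "K (\<lambda>m. c * \<psi> m) = (\<lambda>m. c * K \<psi> m)"
    and K_decaying: "decaying n \<Psi> (\<lambda>\<psi>. \<psi>) \<Longrightarrow> decaying n \<Psi> K"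
    and K_deriv: "(\<And>m. ((\<lambda>s. u s m) has_vector_derivative v m) F) \<Longrightarrow>
      ((\<lambda>s. K (u s) m) has_vector_derivative K v m) F"
    and K_skew: "\<xi> \<in> finite_fock n \<Longrightarrow> Re (ip \<xi> (K \<xi>)) = 0"
begin

lemma K_diff: "K (\<lambda>m. \<phi> m - \<psi> m) = (\<lambda>m. K \<phi> m - K \<psi> m)"
  using K_add[of \<phi> "\<lambda>m. (-1) * \<psi> m"] K_cmult[of "-1" \<psi>] by simp

lemma K_decaying_family: "decaying n I f \<Longrightarrow> decaying n I (\<lambda>i. K (f i))"
  using K_decaying[of "f ` I"] decaying_image[of n I "\<lambda>\<psi>. \<psi>" f] decaying_image[of n I K f] by simp

lemma K_finite_l2: "\<xi> \<in> finite_fock n \<Longrightarrow> l2 (K \<xi>)"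
  using decaying_l2[OF K_decaying[OF finite_fock_decaying]] by simp

text \<open>Pythagoras: skewness makes the cross term \<open>2 * h * Re (ip \<xi> (K \<xi>))\<close>
  vanish.\<close>

lemma fnorm_Euler_step_finite:
  assumes "\<xi> \<in> finite_fock n"
  shows "(fnorm (\<lambda>m. \<xi> m + of_real h * K \<xi> m))\<^sup>2 = (fnorm \<xi>)\<^sup>2 + h\<^sup>2 * (fnorm (K \<xi>))\<^sup>2"
proof -
  define b where "b = (\<lambda>m. of_real h * K \<xi> m)"
  have l2: "l2 \<xi>" "l2 b"
    using assms K_finite_l2[OF assms] by (auto simp: finite_fock_def fock_l2 b_def l2_cmult)
  have "ip (\<lambda>m. \<xi> m + b m) (\<lambda>m. \<xi> m + b m) = ip \<xi> \<xi> + ip \<xi> b + (ip b \<xi> + ip b b)"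
    using l2 by (simp add: ip_add ip_add_left l2_add)
  also have "ip b \<xi> = cnj (ip \<xi> b)" by (simp add: cnj_ip)
  finally have "Re (ip (\<lambda>m. \<xi> m + b m) (\<lambda>m. \<xi> m + b m)) = Re (ip \<xi> \<xi>) + 2 * Re (ip \<xi> b) + Re (ip b b)"
    by simp
  moreover have "Re (ip \<xi> b) = 0"
    using K_skew[OF assms] by (simp add: b_def ip_cmult)
  ultimately have "(fnorm (\<lambda>m. \<xi> m + b m))\<^sup>2 = (fnorm \<xi>)\<^sup>2 + (fnorm b)\<^sup>2"
    using l2 by (simp add: ip_self l2_add del: of_real_power)
  then show ?thesis
    by (simp add: b_def fnorm_cmult power_mult_distrib)
qed

text \<open>Both sides are continuous under simultaneous convergence of a vector and its image under
  \<open>K\<close>, so the finite case extends to the closure. An Euler step therefore changes the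
  squared norm only to second order in \<open>h\<close>.\<close>

lemma fnorm_Euler_step:
  assumes "\<psi> \<in> closure_dom n K"
  shows "(fnorm (\<lambda>m. \<psi> m + of_real h * K \<psi> m))\<^sup>2 = (fnorm \<psi>)\<^sup>2 + h\<^sup>2 * (fnorm (K \<psi>))\<^sup>2"
proof -
  have "\<exists>\<xi>\<in>finite_fock n. fdist \<xi> \<psi> < 1 / (real k + 1) \<and> fdist (K \<xi>) (K \<psi>) < 1 / (real k + 1)" for k
    using assms by (auto simp: closure_dom_def)
  then obtain \<xi> where \<xi>: "\<And>k. \<xi> k \<in> finite_fock n" "\<And>k. fdist (\<xi> k) \<psi> < 1 / (real k + 1)"
    "\<And>k. fdist (K (\<xi> k)) (K \<psi>) < 1 / (real k + 1)"
    by metis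
  have l2: "l2 \<psi>" "l2 (K \<psi>)" "\<And>k. l2 (\<xi> k)" "\<And>k. l2 (K (\<xi> k))"
    using closure_dom_l2[OF assms] finite_fock_l2[OF \<xi>(1)] K_finite_l2[OF \<xi>(1)] by auto
  have inv: "(\<lambda>k. 1 / (real k + 1)) \<longlonglongrightarrow> 0"
    using LIMSEQ_inverse_real_of_nat by (simp add: inverse_eq_divide add.commute)
  have d1: "(\<lambda>k. fdist (\<xi> k) \<psi>) \<longlonglongrightarrow> 0"
    by (rule Lim_null_comparison[OF _ inv]) (use \<xi>(2) in \<open>auto simp: fdist_def less_imp_le\<close>)
  have d2: "(\<lambda>k. fdist (K (\<xi> k)) (K \<psi>)) \<longlonglongrightarrow> 0"
    by (rule Lim_null_comparison[OF _ inv]) (use \<xi>(3) in \<open>auto simp: fdist_def less_imp_le\<close>)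
  have d3: "(\<lambda>k. fdist (\<lambda>m. \<xi> k m + of_real h * K (\<xi> k) m) (\<lambda>m. \<psi> m + of_real h * K \<psi> m)) \<longlonglongrightarrow> 0"
  proof (rule Lim_null_comparison)
    show "(\<lambda>k. fdist (\<xi> k) \<psi> + \<bar>h\<bar> * fdist (K (\<xi> k)) (K \<psi>)) \<longlonglongrightarrow> 0"
      using tendsto_add[OF d1 tendsto_mult_left[OF d2, of "\<bar>h\<bar>"]] by simp
    have "fdist (\<lambda>m. \<xi> k m + of_real h * K (\<xi> k) m) (\<lambda>m. \<psi> m + of_real h * K \<psi> m)
        \<le> fdist (\<xi> k) \<psi> + \<bar>h\<bar> * fdist (K (\<xi> k)) (K \<psi>)" for k
    proof -
      have "(\<lambda>m. \<xi> k m + of_real h * K (\<xi> k) m - (\<psi> m + of_real h * K \<psi> m))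
          = (\<lambda>m. (\<xi> k m - \<psi> m) + of_real h * (K (\<xi> k) m - K \<psi> m))"
        by (simp add: fun_eq_iff algebra_simps)
      then show ?thesis
        using fnorm_triangle[OF l2_diff[OF l2(3)[of k] l2(1)]
            l2_cmult[OF l2_diff[OF l2(4)[of k] l2(2)], of "of_real h"]]
        by (simp only: fdist_def fnorm_cmult norm_of_real)
    qed
    then show "\<forall>\<^sub>F k in sequentially. norm (fdist (\<lambda>m. \<xi> k m + of_real h * K (\<xi> k) m)
        (\<lambda>m. \<psi> m + of_real h * K \<psi> m)) \<le> fdist (\<xi> k) \<psi> + \<bar>h\<bar> * fdist (K (\<xi> k)) (K \<psi>)"
      by (simp add: fdist_def)
  qed
  have "(\<lambda>k. (fnorm (\<lambda>m. \<xi> k m + of_real h * K (\<xi> k) m))\<^sup>2) \<longlonglongrightarrow> (fnorm (\<lambda>m. \<psi> m + of_real h * K \<psi> m))\<^sup>2"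
    by (intro tendsto_power tendsto_fnorm d3 l2_add l2_cmult l2)
  moreover have "(\<lambda>k. (fnorm (\<lambda>m. \<xi> k m + of_real h * K (\<xi> k) m))\<^sup>2)
      \<longlonglongrightarrow> (fnorm \<psi>)\<^sup>2 + h\<^sup>2 * (fnorm (K \<psi>))\<^sup>2"
    unfolding fnorm_Euler_step_finite[OF \<xi>(1)]
    using l2 d1 d2 by (intro tendsto_intros tendsto_fnorm) auto
  ultimately show ?thesis by (rule LIMSEQ_unique)
qed

text \<open>Near \<open>t\<close> the solution differs from the Euler step by \<open>o(h)\<close>,
  and the step changes the squared norm by \<open>O(h^2)\<close>; hence the squared norm has
  derivative 0 everywhere on the interval.\<close>

lemma strong_solution_fnorm:
  assumes u: "strong_solution n K u" and t: "t \<in> {0..1}"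
  shows "fnorm (u t) = fnorm (u 0)"
proof -
  have "((\<lambda>s. (fnorm (u s))\<^sup>2) has_real_derivative 0) (at t within {0..1})" if t: "t \<in> {0..1}" for t
  proof -
    define w k where "w = u t" and "k = K (u t)"
    define \<rho> where "\<rho> s = fdist (\<lambda>m. (u s m - w m) / of_real (s - t)) k" for s
    have \<rho>: "(\<rho> \<longlongrightarrow> 0) (at t within {0..1})" and w: "w \<in> closure_dom n K"
      using u t by (auto simp: strong_solution_def w_def k_def \<rho>_def[abs_def])
    have l2u: "l2 (u s)" if "s \<in> {0..1}" for s
      by (rule closure_dom_l2(1)[of _ n K]) (use u that in \<open>auto simp: strong_solution_def\<close>)
    have l2: "l2 w" "l2 k" using closure_dom_l2[OF w] by (auto simp: w_def k_def)
    have bound: "norm (((fnorm (u s))\<^sup>2 - (fnorm (u t))\<^sup>2) / (s - t))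
        \<le> \<bar>s - t\<bar> * (fnorm k)\<^sup>2 + \<rho> s * (2 * (fnorm w + \<bar>s - t\<bar> * fnorm k) + \<bar>s - t\<bar> * \<rho> s)"
      if s: "s \<in> {0..1}" "s \<noteq> t" for s
    proof -
      define h where "h = s - t"
      have h: "h \<noteq> 0" using s by (simp add: h_def)
      define A where "A = fnorm (\<lambda>m. w m + of_real h * k m)"
      \<comment> \<open>The distance to the Euler step is exactly \<open>\<bar>h\<bar>\<close> times
        the residual \<open>\<rho> s\<close> of the difference quotient, which tends to 0 by the
        definition of a strong solution.\<close>
      have "fdist (u s) (\<lambda>m. w m + of_real h * k m)
          = fnorm (\<lambda>m. of_real h * ((u s m - w m) / of_real h - k m))"
      proof -
        have "u s m - (w m + of_real h * k m) = of_real h * ((u s m - w m) / of_real h - k m)" for m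
          using h by (subst right_diff_distrib) simp
        then show ?thesis by (simp only: fdist_def)
      qed
      also have "\<dots> = \<bar>h\<bar> * \<rho> s"
        by (simp only: fnorm_cmult norm_of_real) (simp add: \<rho>_def h_def fdist_def)
      finally have d: "\<bar>fnorm (u s) - A\<bar> \<le> \<bar>h\<bar> * \<rho> s"
        using fnorm_diff_le[of "u s" "\<lambda>m. w m + of_real h * k m"] l2u[OF s(1)] l2
        by (simp add: A_def l2_add l2_cmult)
      have A: "A \<le> fnorm w + \<bar>h\<bar> * fnorm k"
        using fnorm_triangle[OF l2(1) l2_cmult[OF l2(2), of "of_real h"]]
        by (simp add: A_def fnorm_cmult)
      have A2: "A\<^sup>2 = (fnorm w)\<^sup>2 + h\<^sup>2 * (fnorm k)\<^sup>2"
        unfolding A_def k_def w_def[symmetric] by (rule fnorm_Euler_step[OF w])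
      have A0: "0 \<le> A" by (simp add: A_def)
      have "\<bar>(fnorm (u s))\<^sup>2 - A\<^sup>2\<bar> = \<bar>fnorm (u s) - A\<bar> * (fnorm (u s) + A)"
        using A0 by (simp add: square_diff_square_factored power2_eq_square abs_mult)
      also have "\<dots> \<le> (\<bar>h\<bar> * \<rho> s) * (2 * A + \<bar>h\<bar> * \<rho> s)"
        using d A0 by (intro mult_mono) auto
      also have "\<dots> \<le> (\<bar>h\<bar> * \<rho> s) * (2 * (fnorm w + \<bar>h\<bar> * fnorm k) + \<bar>h\<bar> * \<rho> s)"
        using A by (intro mult_left_mono) (auto simp: \<rho>_def fdist_def)
      finally have "\<bar>(fnorm (u s))\<^sup>2 - (fnorm w)\<^sup>2\<bar> \<le> h\<^sup>2 * (fnorm k)\<^sup>2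
          + (\<bar>h\<bar> * \<rho> s) * (2 * (fnorm w + \<bar>h\<bar> * fnorm k) + \<bar>h\<bar> * \<rho> s)"
        using A2 abs_triangle_ineq[of "(fnorm (u s))\<^sup>2 - A\<^sup>2" "h\<^sup>2 * (fnorm k)\<^sup>2"]
        by (simp add: abs_mult)
      also have "\<dots> = \<bar>h\<bar> * (\<bar>h\<bar> * (fnorm k)\<^sup>2
          + \<rho> s * (2 * (fnorm w + \<bar>h\<bar> * fnorm k) + \<bar>h\<bar> * \<rho> s))"
      proof -
        have "h\<^sup>2 = \<bar>h\<bar> * \<bar>h\<bar>" by (simp add: power2_eq_square)
        then show ?thesis by (simp only: distrib_left mult.assoc)
      qed
      finally show ?thesis
        using h by (simp add: w_def h_def[symmetric] divide_le_eq mult.commute)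
    qed
    have "((\<lambda>s. \<bar>s - t\<bar> * (fnorm k)\<^sup>2 + \<rho> s * (2 * (fnorm w + \<bar>s - t\<bar> * fnorm k) + \<bar>s - t\<bar> * \<rho> s)) \<longlongrightarrow>
        \<bar>t - t\<bar> * (fnorm k)\<^sup>2 + 0 * (2 * (fnorm w + \<bar>t - t\<bar> * fnorm k) + \<bar>t - t\<bar> * 0))
        (at t within {0..1})"
      by (intro tendsto_intros \<rho>)
    then have "((\<lambda>s. \<bar>s - t\<bar> * (fnorm k)\<^sup>2 + \<rho> s * (2 * (fnorm w + \<bar>s - t\<bar> * fnorm k) + \<bar>s - t\<bar> * \<rho> s)) \<longlongrightarrow> 0)
        (at t within {0..1})"
      by simp
    then have "((\<lambda>s. ((fnorm (u s))\<^sup>2 - (fnorm (u t))\<^sup>2) / (s - t)) \<longlongrightarrow> 0) (at t within {0..1})"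
      by (rule Lim_null_comparison[rotated]) (use bound in \<open>auto simp: eventually_at_filter\<close>)
    then show ?thesis by (simp add: has_field_derivative_iff)
  qed
  then obtain c where "\<And>s. s \<in> {0..1} \<Longrightarrow> (fnorm (u s))\<^sup>2 = c"
    using has_field_derivative_zero_constant[of "{0..1::real}" "\<lambda>s. (fnorm (u s))\<^sup>2"] by auto
  from this[OF t] this[of 0] show ?thesis
    by (simp flip: power2_eq_iff_nonneg)
qed

lemma strong_solution_diff:
  assumes u: "strong_solution n K u" and v: "strong_solution n K v"
  shows "strong_solution n K (\<lambda>t m. u t m - v t m)"
  unfolding strong_solution_def
proof safe
  fix t :: real assume t: "t \<in> {0..1}"
  have mem: "u s \<in> closure_dom n K" "v s \<in> closure_dom n K" if "s \<in> {0..1}" for s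
    using assms that by (auto simp: strong_solution_def)
  have l2: "l2 (u s)" "l2 (v s)" "l2 (K (u s))" "l2 (K (v s))" if "s \<in> {0..1}" for s
    using closure_dom_l2[OF mem(1)[OF that]] closure_dom_l2[OF mem(2)[OF that]] by auto
  have "\<exists>\<xi>\<in>finite_fock n. fdist \<xi> (\<lambda>m. u t m - v t m) < \<epsilon>
      \<and> fdist (K \<xi>) (\<lambda>m. K (u t) m - K (v t) m) < \<epsilon>" if "\<epsilon> > 0" for \<epsilon>
  proof -
    have approx: "\<exists>\<xi>\<in>finite_fock n. fdist \<xi> \<psi> < \<epsilon> / 2 \<and> fdist (K \<xi>) (K \<psi>) < \<epsilon> / 2"
      if "\<psi> \<in> closure_dom n K" for \<psi>
      using that half_gt_zero[OF \<open>\<epsilon> > 0\<close>] unfolding closure_dom_def by blast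
    obtain \<phi> \<psi> where *: "\<phi> \<in> finite_fock n" "\<psi> \<in> finite_fock n"
      "fdist \<phi> (u t) < \<epsilon> / 2" "fdist (K \<phi>) (K (u t)) < \<epsilon> / 2"
      "fdist \<psi> (v t) < \<epsilon> / 2" "fdist (K \<psi>) (K (v t)) < \<epsilon> / 2"
      using approx[OF mem(1)[OF t]] approx[OF mem(2)[OF t]] by blast
    have sub: "fdist (\<lambda>m. a m - b m) (\<lambda>m. a' m - b' m) \<le> fdist a a' + fdist b b'"
      if "l2 a" "l2 b" "l2 a'" "l2 b'" for a b a' b'
      using fnorm_triangle[OF l2_diff[OF that(1,3)] l2_diff[OF that(4,2)]] fdist_commute[of b b']
      by (simp add: fdist_def algebra_simps)
    have "l2 \<phi>" "l2 \<psi>" "l2 (K \<phi>)" "l2 (K \<psi>)"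
      using * K_finite_l2 finite_fock_l2 by auto
    then show ?thesis
      using * finite_fock_diff[OF *(1,2)] sub[of \<phi> \<psi> "u t" "v t"]
        sub[of "K \<phi>" "K \<psi>" "K (u t)" "K (v t)"] l2[OF t]
      by (intro bexI[of _ "\<lambda>m. \<phi> m - \<psi> m"]) (auto simp: K_diff)
  qed
  then show "(\<lambda>m. u t m - v t m) \<in> closure_dom n K"
    using mem[OF t] l2_diff[OF l2(1)[OF t] l2(2)[OF t]] l2_diff[OF l2(3)[OF t] l2(4)[OF t]]
    by (auto simp: closure_dom_def fock_def l2_def K_diff)
  define a where "a s = (\<lambda>m. (u s m - u t m) / of_real (s - t))" for s
  define b where "b s = (\<lambda>m. (v s m - v t m) / of_real (s - t))" for s
  have lim: "((\<lambda>s. fdist (a s) (K (u t)) + fdist (b s) (K (v t))) \<longlongrightarrow> 0) (at t within {0..1})"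
    using u v t by (auto simp: strong_solution_def a_def b_def intro!: tendsto_add_zero)
  have "fdist (\<lambda>m. a s m - b s m) (\<lambda>m. K (u t) m - K (v t) m)
      \<le> fdist (a s) (K (u t)) + fdist (b s) (K (v t))" if s: "s \<in> {0..1}" for s
  proof -
    have "l2 (a s)" "l2 (b s)"
      using l2_cmult[OF l2_diff[OF l2(1)[OF s] l2(1)[OF t]], of "1 / of_real (s - t)"]
        l2_cmult[OF l2_diff[OF l2(2)[OF s] l2(2)[OF t]], of "1 / of_real (s - t)"]
      by (simp_all add: a_def b_def)
    then show ?thesis
      using fnorm_triangle[OF l2_diff[of "a s" "K (u t)"] l2_diff[of "K (v t)" "b s"]] l2[OF t]
        fdist_commute[of "b s" "K (v t)"]
      by (simp add: fdist_def algebra_simps)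
  qed
  then have "((\<lambda>s. fdist (\<lambda>m. a s m - b s m) (\<lambda>m. K (u t) m - K (v t) m)) \<longlongrightarrow> 0) (at t within {0..1})"
    by (intro Lim_null_comparison[OF _ lim]) (auto simp: eventually_at_filter fdist_def)
  then show "((\<lambda>s. fdist (\<lambda>m. (u s m - v s m - (u t m - v t m)) / of_real (s - t))
      (K (\<lambda>m. u t m - v t m))) \<longlongrightarrow> 0) (at t within {0..1})"
    by (simp add: a_def b_def K_diff algebra_simps diff_divide_distrib add_divide_distrib)
qed

text \<open>The difference of two solutions is a solution, and its norm is conserved. For equal
  initial values this is uniqueness.\<close>

lemma evolves_isometric:
  assumes "evolves n K \<psi> \<phi>" "evolves n K \<psi>' \<phi>'"
  shows "fdist \<phi> \<phi>' = fdist \<psi> \<psi>'"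
proof -
  obtain u v where uv: "strong_solution n K u" "strong_solution n K v"
    "u 0 = \<psi>" "u 1 = \<phi>" "v 0 = \<psi>'" "v 1 = \<phi>'"
    using assms by (auto simp: evolves_def)
  show ?thesis
    using strong_solution_fnorm[OF strong_solution_diff[OF uv(1,2)], of 1] uv
    by (simp add: fdist_def)
qed

lemma evolves_fock:
  assumes "evolves n K \<psi> \<phi>"
  shows "\<psi> \<in> fock n" "\<phi> \<in> fock n"
  using assms by (auto simp: evolves_def strong_solution_def closure_dom_def)

lemma evolves_fnorm: "evolves n K \<psi> \<phi> \<Longrightarrow> fnorm \<phi> = fnorm \<psi>"
  unfolding evolves_def using strong_solution_fnorm[of _ 1] by fastforce

text \<open>The given pair approximates itself. Conversely, if \<open>\<eta>\<close> is another
  limit, the isometry makes the images \<open>\<phi>'\<close> of vectors close to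
  \<open>\<psi>\<close> close to \<open>\<phi>\<close>, so \<open>\<eta>\<close> and
  \<open>\<phi>\<close> are arbitrarily close.\<close>

lemma op_exp_eqI:
  assumes ev: "evolves n K \<psi> \<phi>"
  shows "op_exp n K \<psi> = \<phi>"
  unfolding op_exp_def
proof (rule the_equality)
  have self: "fdist \<xi> \<xi> = 0" for \<xi> by (simp add: fdist_def fnorm_def)
  show "\<phi> \<in> fock n \<and> (\<forall>\<epsilon>>0. \<exists>\<psi>' \<phi>'. evolves n K \<psi>' \<phi>' \<and> fdist \<psi>' \<psi> < \<epsilon> \<and> fdist \<phi>' \<phi> < \<epsilon>)"
    using evolves_fock[OF ev] by (intro conjI allI impI exI[of _ \<psi>] exI[of _ \<phi>]) (simp_all add: ev self)
next
  fix \<eta> assume *: "\<eta> \<in> fock n \<and> (\<forall>\<epsilon>>0. \<exists>\<psi>' \<phi>'. evolves n K \<psi>' \<phi>' \<and> fdist \<psi>' \<psi> < \<epsilon> \<and> fdist \<phi>' \<eta> < \<epsilon>)"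
  have l2: "l2 \<eta>" "l2 \<phi>" using * evolves_fock[OF ev] by (auto simp: fock_l2)
  have "fdist \<eta> \<phi> \<le> 0 + \<epsilon>" if "\<epsilon> > 0" for \<epsilon>
  proof -
    obtain \<psi>' \<phi>' where ev': "evolves n K \<psi>' \<phi>'" "fdist \<psi>' \<psi> < \<epsilon> / 2" "fdist \<phi>' \<eta> < \<epsilon> / 2"
      using * \<open>\<epsilon> > 0\<close> by (metis half_gt_zero)
    have "fdist \<eta> \<phi> \<le> fdist \<eta> \<phi>' + fdist \<phi>' \<phi>"
      using l2 evolves_fock[OF ev'(1)] by (intro fdist_triangle) (auto simp: fock_l2)
    then show ?thesis
      using ev' evolves_isometric[OF ev'(1) ev] by (simp add: fdist_commute[of \<eta>])
  qed
  then have "fdist \<eta> \<phi> \<le> 0"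
    by (rule field_le_epsilon)
  then have "fnorm (\<lambda>m. \<eta> m - \<phi> m) = 0"
    using fnorm_nonneg[of "\<lambda>m. \<eta> m - \<phi> m"] by (simp add: fdist_def)
  then show "\<eta> = \<phi>"
    using fnorm_eq_0D[OF _ l2_diff[OF l2]] by fastforce
qed

text \<open>Cut off at degree \<open>M\<close>. The tail is \<open>p ^ M\<close> times a family that
  decays uniformly in \<open>M\<close>; as \<open>K\<close> preserves uniform decay, the tail and
  its image under \<open>K\<close> are both of order \<open>p ^ M\<close>.\<close>

lemma decaying_closure_dom:
  assumes "decaying n {\<psi>} (\<lambda>\<psi>. \<psi>)"
  shows "\<psi> \<in> closure_dom n K"
proof -
  obtain C q where q: "0 < q" "q < 1" and dec: "decays n C q \<psi>"
    using assms by (auto simp: decaying_def)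
  have C: "0 \<le> C" using decays_nonneg[OF dec q(1)] .
  define p where "p = sqrt q"
  have p: "0 < p" "p < 1" "p * p = q" using q by (auto simp: p_def)
  define \<xi> where "\<xi> M m = (if deg n m \<le> M then \<psi> m else 0)" for M m
  \<comment> \<open>Since \<open>q = p * p\<close>, beyond degree \<open>M\<close> one factor
    \<open>p ^ deg n m\<close> is at most \<open>p ^ M\<close> and cancels the rescaling, while the
    other remains as decay.\<close>
  define v where "v M m = of_real (1 / p ^ M) * (\<psi> m - \<xi> M m)" for M m
  have \<psi>\<xi>: "\<psi> m - \<xi> M m = of_real (p ^ M) * v M m" for M m
    using p by (simp add: v_def)
  have "decays n C p (v M)" for M
    unfolding decays_def
  proof safe
    fix m assume "m \<notin> occupations n"
    then show "v M m = 0" using dec by (simp add: v_def \<xi>_def decays_def)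
  next
    fix m
    show "cmod (v M m) \<le> C * p ^ deg n m"
    proof (cases "deg n m \<le> M")
      case False
      then have "p ^ deg n m \<le> p ^ M" using p by (intro power_decreasing) auto
      then have "C * p ^ deg n m * p ^ deg n m \<le> C * p ^ deg n m * p ^ M"
        using p C by (intro mult_left_mono) auto
      moreover have "cmod (\<psi> m) \<le> C * p ^ deg n m * p ^ deg n m"
        using dec by (simp add: decays_def p(3)[symmetric] power_mult_distrib mult.assoc)
      ultimately show ?thesis
        using False p by (simp add: v_def \<xi>_def norm_mult norm_power norm_divide divide_le_eq)
    qed (use C p in \<open>simp add: v_def \<xi>_def\<close>)
  qed
  then have v: "decaying n UNIV v" unfolding decaying_def using p by blast
  obtain B where B: "\<And>M. fnorm (v M) \<le> B" using decaying_bounded[OF v] by auto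
  obtain B' where B': "\<And>M. fnorm (K (v M)) \<le> B'"
    using decaying_bounded[OF K_decaying_family[OF v]] by auto
  have \<xi>: "\<xi> M \<in> finite_fock n" for M
  proof -
    have "{m. \<xi> M m \<noteq> 0} \<subseteq> {m \<in> occupations n. deg n m \<le> M}"
      using dec by (auto simp: \<xi>_def decays_def)
    then have "finite {m. \<xi> M m \<noteq> 0}" by (rule finite_subset[OF _ finite_deg_le])
    moreover have "decays n C q (\<xi> M)"
      using dec C q by (auto simp: \<xi>_def decays_def)
    ultimately show ?thesis using decays_fnorm(1) q by (auto simp: finite_fock_def)
  qed
  have "\<exists>M. fdist (\<xi> M) \<psi> < \<epsilon> \<and> fdist (K (\<xi> M)) (K \<psi>) < \<epsilon>" if "\<epsilon> > 0" for \<epsilon>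
  proof -
    have "(\<lambda>M. p ^ M * (\<bar>B\<bar> + \<bar>B'\<bar>)) \<longlonglongrightarrow> 0 * (\<bar>B\<bar> + \<bar>B'\<bar>)"
      using p by (intro tendsto_mult tendsto_const LIMSEQ_power_zero) auto
    then have "\<forall>\<^sub>F M in sequentially. p ^ M * (\<bar>B\<bar> + \<bar>B'\<bar>) < \<epsilon>"
      using \<open>\<epsilon> > 0\<close> by (intro order_tendstoD) auto
    then obtain M where M: "p ^ M * (\<bar>B\<bar> + \<bar>B'\<bar>) < \<epsilon>"
      by (auto simp: eventually_sequentially)
    have le: "p ^ M * x < \<epsilon>" if "x \<le> \<bar>B\<bar> + \<bar>B'\<bar>" for x
      using p by (intro le_less_trans[OF mult_left_mono[OF that] M]) simp
    have "fdist (\<xi> M) \<psi> = p ^ M * fnorm (v M)"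
      unfolding fdist_commute[of "\<xi> M"]
      using p by (simp add: fdist_def \<psi>\<xi> fnorm_cmult norm_power)
    moreover have "fdist (K (\<xi> M)) (K \<psi>) = p ^ M * fnorm (K (v M))"
      unfolding fdist_commute[of "K (\<xi> M)"]
      using p by (simp add: fdist_def fnorm_cmult norm_power K_cmult \<psi>\<xi> flip: K_diff)
    ultimately show ?thesis
      using le[of "fnorm (v M)"] le[of "fnorm (K (v M))"] B[of M] B'[of M] by (intro exI[of _ M]) auto
  qed
  then show ?thesis
    using \<xi> decaying_fock[OF assms] decaying_fock[OF K_decaying[OF assms]]
    by (auto simp: closure_dom_def)
qed

text \<open>The second derivative of each coefficient is \<open>K (K (u t)) m\<close>, bounded by
  \<open>C * q ^ deg n m\<close> uniformly in time. Taylor's formula makes the error of the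
  difference quotient at most \<open>\<bar>s - t\<bar>\<close> times this envelope, whose norm is
  finite.\<close>

lemma strong_solutionI:
  assumes dec: "decaying n {0..1} u"
    and der: "\<And>t m. t \<in> {0..1} \<Longrightarrow>
      ((\<lambda>s. u s m) has_vector_derivative K (u t) m) (at t within {0..1})"
  shows "strong_solution n K u"
  unfolding strong_solution_def
proof safe
  fix t :: real assume t: "t \<in> {0..1}"
  have "decaying n {u t} (\<lambda>\<psi>. \<psi>)"
    using decaying_subset[OF dec, of "{t}"] t decaying_image[of n "{t}" "\<lambda>\<psi>. \<psi>" u] by simp
  then show "u t \<in> closure_dom n K" by (rule decaying_closure_dom)
  obtain C q where q: "0 < q" "q < 1" and KK: "\<And>s. s \<in> {0..1} \<Longrightarrow> decays n C q (K (K (u s)))"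
    using K_decaying_family[OF K_decaying_family[OF dec]] unfolding decaying_def by blast
  have der2: "((\<lambda>s. K (u s) m) has_vector_derivative K (K (u t)) m) (at t within {0..1})"
    if "t \<in> {0..1}" for t m
    by (rule K_deriv) (rule der[OF that])
  have occ: "m \<notin> occupations n \<Longrightarrow> u s m = 0" "m \<notin> occupations n \<Longrightarrow> K (u s) m = 0" 
    if "s \<in> {0..1}" for s m
    using decaying_fock[OF dec that] decaying_fock[OF K_decaying_family[OF dec] that]
    by (auto simp: fock_def)
  define d where "d s = (\<lambda>m. (u s m - u t m) / of_real (s - t) - K (u t) m)" for s
  have "fnorm (d s) \<le> \<bar>s - t\<bar> * (C * geo_norm n q)" if s: "s \<in> {0..1}" "s \<noteq> t" for s
  proof -
    have "decays n (\<bar>s - t\<bar> * C) q (d s)"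
      unfolding decays_def
    proof safe
      fix m assume "m \<notin> occupations n"
      then show "d s m = 0" using occ s t by (simp add: d_def)
    next
      fix m
      have "cmod (u s m - u t m - of_real (s - t) * K (u t) m) \<le> (C * q ^ deg n m) * (s - t)\<^sup>2"
        by (rule vector_taylor2[of "{0..1}" "\<lambda>s. u s m" "\<lambda>s. K (u s) m" "\<lambda>s. K (K (u s)) m"])
          (use der der2 s t KK in \<open>auto simp: decays_def\<close>)
      moreover have "of_real (s - t) * d s m = u s m - u t m - of_real (s - t) * K (u t) m"
      proof -
        have "of_real (s - t) * (x / of_real (s - t) - k) = x - of_real (s - t) * k" for x k :: complex
          using s by (simp add: right_diff_distrib)
        then show ?thesis unfolding d_def .
      qed
      ultimately have "cmod (of_real (s - t) * d s m) \<le> (C * q ^ deg n m) * (s - t)\<^sup>2"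
        by simp
      then have "\<bar>s - t\<bar> * cmod (d s m) \<le> \<bar>s - t\<bar> * (\<bar>s - t\<bar> * C * q ^ deg n m)"
        by (simp add: norm_mult power2_eq_square ac_simps flip: of_real_diff)
      then show "cmod (d s m) \<le> \<bar>s - t\<bar> * C * q ^ deg n m"
        using s by (subst (asm) mult_le_cancel_left_pos) auto
    qed
    from decays_fnorm(2)[OF this q] show ?thesis by simp
  qed
  note bound = this
  have "((\<lambda>s. \<bar>s - t\<bar> * (C * geo_norm n q)) \<longlongrightarrow> \<bar>t - t\<bar> * (C * geo_norm n q)) (at t within {0..1})"
    by (intro tendsto_intros)
  then have "((\<lambda>s. \<bar>s - t\<bar> * (C * geo_norm n q)) \<longlongrightarrow> 0) (at t within {0..1})"
    by simp
  then have "((\<lambda>s. fnorm (d s)) \<longlongrightarrow> 0) (at t within {0..1})"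
    by (rule Lim_null_comparison[rotated]) (use bound in \<open>auto simp: eventually_at_filter\<close>)
  then show "((\<lambda>s. fdist (\<lambda>m. (u s m - u t m) / of_real (s - t)) (K (u t))) \<longlongrightarrow> 0) (at t within {0..1})"
    by (simp add: fdist_def d_def)
qed

end

subsection \<open>Squeezing of the vacuum\<close>

lemma annih_deriv:
  assumes "\<And>m. ((\<lambda>s. u s m) has_vector_derivative v m) F"
  shows "((\<lambda>s. annih j (u s) m) has_vector_derivative annih j v m) F"
  unfolding annih_def by (intro has_vector_derivative_mult_right assms)

lemma creat_deriv:
  assumes "\<And>m. ((\<lambda>s. u s m) has_vector_derivative v m) F"
  shows "((\<lambda>s. creat j (u s) m) has_vector_derivative creat j v m) F"
  unfolding creat_def by (intro has_vector_derivative_mult_right assms)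

lemma annih_add: "annih j (\<lambda>m. \<phi> m + \<psi> m) = (\<lambda>m. annih j \<phi> m + annih j \<psi> m)"
  and annih_cmult: "annih j (\<lambda>m. c * \<psi> m) = (\<lambda>m. c * annih j \<psi> m)"
  and annih_sum: "annih j (\<lambda>m. \<Sum>i\<in>I. f i m) = (\<lambda>m. \<Sum>i\<in>I. annih j (f i) m)"
  by (auto simp: annih_def algebra_simps sum_distrib_left)

lemma creat_add: "creat j (\<lambda>m. \<phi> m + \<psi> m) = (\<lambda>m. creat j \<phi> m + creat j \<psi> m)"
  and creat_cmult: "creat j (\<lambda>m. c * \<psi> m) = (\<lambda>m. c * creat j \<psi> m)"
  and creat_sum: "creat j (\<lambda>m. \<Sum>i\<in>I. f i m) = (\<lambda>m. \<Sum>i\<in>I. creat j (f i) m)"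
  by (auto simp: creat_def algebra_simps sum_distrib_left)

text \<open>The two terms of the generator are adjoint to each other and the prefactor is real, so
  the expectation is a real multiple of a number minus its conjugate.\<close>

lemma skew_generator_squeeze:
  assumes j: "j < n"
  shows "skew_generator n (squeeze_gen j x)"
proof
  show "squeeze_gen j x (\<lambda>m. \<phi> m + \<psi> m) = (\<lambda>m. squeeze_gen j x \<phi> m + squeeze_gen j x \<psi> m)" for \<phi> \<psi>
    by (simp add: squeeze_gen_def annih_add creat_add algebra_simps)
  show "squeeze_gen j x (\<lambda>m. c * \<psi> m) = (\<lambda>m. c * squeeze_gen j x \<psi> m)" for c \<psi>
    by (simp add: squeeze_gen_def annih_cmult creat_cmult algebra_simps)
  show "decaying n \<Psi> (squeeze_gen j x)" if "decaying n \<Psi> (\<lambda>\<psi>. \<psi>)" for \<Psi>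
    unfolding squeeze_gen_def[abs_def]
    by (intro decaying_const_cmult decaying_diff decaying_annih decaying_creat that j)
  show "((\<lambda>s. squeeze_gen j x (u s) m) has_vector_derivative squeeze_gen j x v m) F"
    if "\<And>m. ((\<lambda>s. u s m) has_vector_derivative v m) F" for u v F m
    unfolding squeeze_gen_def
    by (intro has_vector_derivative_mult_right has_vector_derivative_diff annih_deriv creat_deriv that)
  show "Re (ip \<xi> (squeeze_gen j x \<xi>)) = 0" if "\<xi> \<in> finite_fock n" for \<xi>
  proof -
    have dec: "decaying n {\<xi>} (\<lambda>\<psi>. \<psi>)" using that by (rule finite_fock_decaying)
    have l2: "l2 \<xi>" "l2 (annih j (annih j \<xi>))" "l2 (creat j (creat j \<xi>))"
      using decaying_l2[OF decaying_annih[OF decaying_annih[OF dec j] j]]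
        decaying_l2[OF decaying_creat[OF decaying_creat[OF dec j] j]] finite_fock_l2[OF that] by auto
    have "ip \<xi> (annih j (annih j \<xi>)) = cnj (ip \<xi> (creat j (creat j \<xi>)))"
      by (simp add: ip_annih cnj_ip)
    moreover have "ip \<xi> (squeeze_gen j x \<xi>) =
        of_real (x / 2) * (ip \<xi> (annih j (annih j \<xi>)) - ip \<xi> (creat j (creat j \<xi>)))"
      unfolding squeeze_gen_def by (simp only: ip_cmult ip_diff l2)
    ultimately show ?thesis
      by (simp only: Re_complex_of_real Im_complex_of_real times_complex.simps minus_complex.simps cnj.simps) simp
  qed
qed

section \<open>Amplitudes of the single-mode squeezed vacuum\<close>

definition sq_coeff :: "nat \<Rightarrow> real" where
  "sq_coeff k = sqrt (fact (2 * k)) / (2 ^ k * fact k)"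

text \<open>The classical number expansion of the squeezed vacuum: quanta come in pairs, each pair
  with a factor \<open>- tanh y\<close>. The square of \<open>sq_coeff k\<close> is the central
  binomial coefficient over \<open>4 ^ k\<close>.\<close>

definition sq_amp :: "nat \<Rightarrow> real \<Rightarrow> real" where
  "sq_amp m y = (if even m then sq_coeff (m div 2) * (- tanh y) ^ (m div 2) / sqrt (cosh y) else 0)"

lemma sq_coeff_Suc:
  "sq_coeff (Suc k) = sq_coeff k * (sqrt (2 * real k + 1) * sqrt (2 * real k + 2)) / (2 * real k + 2)"
proof -
  have "fact (2 * Suc k) = (2 * real k + 2) * ((2 * real k + 1) * fact (2 * k))"
    by (simp add: algebra_simps)
  then have "sqrt (fact (2 * Suc k)) = sqrt (2 * real k + 2) * (sqrt (2 * real k + 1) * sqrt (fact (2 * k)))"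
    by (simp only: real_sqrt_mult)
  then show ?thesis
    by (simp add: sq_coeff_def field_simps)
qed

lemma sq_coeff_bounds: "0 < sq_coeff k \<and> sq_coeff k \<le> 1"
proof (induction k)
  case 0
  then show ?case by (simp add: sq_coeff_def)
next
  case (Suc k)
  have "sqrt (2 * real k + 1) * sqrt (2 * real k + 2) \<le> sqrt (2 * real k + 2) * sqrt (2 * real k + 2)"
    by (intro mult_right_mono) auto
  then have "sqrt (2 * real k + 1) * sqrt (2 * real k + 2) / (2 * real k + 2) \<le> 1"
    by (simp add: divide_le_eq)
  then have "sq_coeff k * (sqrt (2 * real k + 1) * sqrt (2 * real k + 2) / (2 * real k + 2)) \<le> 1 * 1"
    using Suc by (intro mult_mono) auto
  then show ?case
    using Suc by (simp add: sq_coeff_Suc)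
qed

lemma sq_amp_double: "sq_amp (2 * k) y = sq_coeff k * (- tanh y) ^ k / sqrt (cosh y)"
  by (simp add: sq_amp_def)

text \<open>This is the equation a psi = - tanh y times the creation operator on psi, read off on
  coefficients. For \<open>m = 0\<close> the truncated index \<open>m - 1\<close> meets the factor
  \<open>sqrt 0\<close>.\<close>

lemma sq_amp_annih:
  "sqrt (real (m + 1)) * sq_amp (m + 1) y = - tanh y * (sqrt (real m) * sq_amp (m - 1) y)"
proof (cases "odd m")
  case True
  then obtain k where m: "m = 2 * k + 1" by (rule oddE)
  define s1 s2 where "s1 = sqrt (2 * real k + 1)" and "s2 = sqrt (2 * real k + 2)"
  have e: "m + 1 = 2 * Suc k" "m - 1 = 2 * k" "sqrt (real (m + 1)) = s2" "sqrt (real m) = s1"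
    using m by (auto simp: s1_def s2_def)
  have "sqrt (real (m + 1)) * sq_amp (m + 1) y
      = (s2 * s2) / (2 * real k + 2) * (s1 * sq_coeff k * (- tanh y) ^ Suc k / sqrt (cosh y))"
    unfolding e(3) unfolding e(1) sq_amp_double sq_coeff_Suc s1_def[symmetric] s2_def[symmetric] by (simp add: ac_simps)
  also have "s2 * s2 = 2 * real k + 2" by (simp add: s2_def)
  finally show ?thesis
    unfolding e(4) unfolding e(2) sq_amp_double by simp
next
  case False
  then show ?thesis by (auto simp: sq_amp_def)
qed

text \<open>The evolution equation of one mode: the right-hand side is half the squared annihilator
  minus half the squared creator, on coefficients. For \<open>m < 2\<close> the truncated index
  \<open>m - 2\<close> stands behind a vanishing square root.\<close>

lemma sq_amp_deriv:
  "((\<lambda>y. sq_amp m y) has_real_derivative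
     (sqrt (real (m + 1)) * sqrt (real (m + 2)) * sq_amp (m + 2) y
      - sqrt (real m) * sqrt (real (m - 1)) * sq_amp (m - 2) y) / 2) (at y)"
proof (cases "even m")
  case True
  then obtain k where m: "m = 2 * k" by (rule evenE)
  define D where "D = sq_coeff k"
  have c: "cosh y > 0" "\<not> cosh y < 0" "cosh y \<noteq> 0" by (simp_all add: not_less)
  have "((\<lambda>y. D * (- tanh y) ^ k / sqrt (cosh y)) has_real_derivative
      (D * (real k * (- tanh y) ^ (k - 1) * (- (1 - (tanh y)\<^sup>2))) * sqrt (cosh y)
        - D * (- tanh y) ^ k * (sinh y / (2 * sqrt (cosh y)))) / (sqrt (cosh y) * sqrt (cosh y))) (at y)"
    using c by (auto intro!: derivative_eq_intros simp: field_simps)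
  also have "(D * (real k * (- tanh y) ^ (k - 1) * (- (1 - (tanh y)\<^sup>2))) * sqrt (cosh y)
        - D * (- tanh y) ^ k * (sinh y / (2 * sqrt (cosh y)))) / (sqrt (cosh y) * sqrt (cosh y))
      = D * ((2 * real k + 1) * (- tanh y) ^ Suc k - 2 * real k * (- tanh y) ^ (k - 1)) / 2 / sqrt (cosh y)"
  proof -
    \<comment> \<open>With \<open>sinh\<close> eliminated, both sides become rational in
      \<open>t = - tanh y\<close> and \<open>s = sqrt (cosh y)\<close>. The case split on
      \<open>k\<close> that follows deals with the truncated exponent \<open>k - 1\<close>.\<close>
    have sh: "sinh y = - (- tanh y) * (sqrt (cosh y) * sqrt (cosh y))"
      using c by (simp add: tanh_def)
    have "k = 0 \<or> (\<exists>i. k = Suc i)" by (cases k) auto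
    moreover have "sqrt (cosh y) \<noteq> 0" using c by simp
    moreover define t s where "t = - tanh y" and "s = sqrt (cosh y)"
    ultimately show ?thesis
      unfolding sh t_def[symmetric] s_def[symmetric] power2_minus[of "tanh y", symmetric]
      by (auto simp: field_simps power2_eq_square)
  qed
  also have "\<dots> = (sqrt (real (m + 1)) * sqrt (real (m + 2)) * sq_amp (m + 2) y
      - sqrt (real m) * sqrt (real (m - 1)) * sq_amp (m - 2) y) / 2"
  proof -
    have e: "m + 2 = 2 * Suc k" using m by simp
    define s1 s2 where "s1 = sqrt (2 * real k + 1)" and "s2 = sqrt (2 * real k + 2)"
    have s12: "s1 * s1 = 2 * real k + 1" "s2 * s2 = 2 * real k + 2" by (simp_all add: s1_def s2_def)
    have "sqrt (real (m + 1)) * sqrt (real (m + 2)) * sq_amp (m + 2) y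
        = (s1 * s1) * (s2 * s2) / (2 * real k + 2) * (D * (- tanh y) ^ Suc k) / sqrt (cosh y)"
      unfolding e sq_amp_double sq_coeff_Suc s1_def[symmetric] s2_def[symmetric] D_def
      by (simp add: m s1_def s2_def ac_simps)
    also have "\<dots> = (2 * real k + 1) * (D * (- tanh y) ^ Suc k) / sqrt (cosh y)"
      unfolding s12 by simp
    finally have 1: "sqrt (real (m + 1)) * sqrt (real (m + 2)) * sq_amp (m + 2) y
      = (2 * real k + 1) * (D * (- tanh y) ^ Suc k) / sqrt (cosh y)" .
    have 2: "sqrt (real m) * sqrt (real (m - 1)) * sq_amp (m - 2) y
      = 2 * real k * (D * (- tanh y) ^ (k - 1)) / sqrt (cosh y)"
    proof (cases k)
      case 0
      then show ?thesis using m by simp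
    next
      case (Suc i)
      have e: "m - 2 = 2 * i" "real m = 2 * real i + 2" "real (m - 1) = 2 * real i + 1"
        "2 * real k = 2 * real i + 2"
        using m Suc by auto
      show ?thesis
        unfolding e sq_amp_double D_def Suc sq_coeff_Suc
        by (simp add: ac_simps)
    qed
    show ?thesis unfolding 1 2 by (simp add: right_diff_distrib diff_divide_distrib mult.left_commute mult.assoc)
  qed
  finally show ?thesis
    by (simp add: sq_amp_def[abs_def] m D_def)
next
  case False
  \<comment> \<open>For \<open>m = 1\<close> the truncated \<open>m - 2\<close> is 0, hence even;
    there the factor \<open>sqrt (real (m - 1))\<close> vanishes instead.\<close>
  moreover from this have "m = 1 \<or> odd (m - 2)" by presburger
  ultimately have "sq_amp m = (\<lambda>y. 0)" "sq_amp (m + 2) y = 0" "m = 1 \<or> sq_amp (m - 2) y = 0"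
    by (auto simp: sq_amp_def fun_eq_iff)
  then show ?thesis by auto
qed

text \<open>Each factor \<open>tanh y\<close> accounts for two quanta, so a bound
  \<open>q\<^sup>2\<close> on it yields a factor \<open>q\<close> for each quantum.\<close>

lemma sq_amp_bound:
  assumes "\<bar>tanh y\<bar> \<le> q\<^sup>2" "0 \<le> q"
  shows "\<bar>sq_amp m y\<bar> \<le> q ^ m"
proof (cases "even m")
  case True
  then obtain k where m: "m = 2 * k" by (rule evenE)
  have c: "1 \<le> sqrt (cosh y)" using cosh_real_ge_1 by simp
  have "\<bar>sq_amp m y\<bar> = sq_coeff k * \<bar>tanh y\<bar> ^ k / sqrt (cosh y)"
    using sq_coeff_bounds[of k] by (simp add: m sq_amp_double abs_mult power_abs)
  also have "\<dots> \<le> (sq_coeff k * \<bar>tanh y\<bar> ^ k) / 1"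
    using sq_coeff_bounds[of k] c by (intro divide_left_mono) auto
  also have "\<dots> \<le> 1 * (q\<^sup>2) ^ k"
    using sq_coeff_bounds[of k] assms by (subst div_by_1, intro mult_mono power_mono) auto
  finally show ?thesis by (simp add: m power_mult)
qed (use assms in \<open>simp add: sq_amp_def\<close>)

text \<open>A mode with parameter 0 is in its vacuum, so all intermediate stages of the product of
  squeezers have this form.\<close>

definition prod_state :: "nat \<Rightarrow> (nat \<Rightarrow> real) \<Rightarrow> fvec" where
  "prod_state n R m = (if m \<in> occupations n then of_real (\<Prod>i<n. sq_amp (m i) (R i)) else 0)"

lemma prod_state_upd:
  assumes "j < n"
  shows "prod_state n (R(j := y)) (m(j := k)) =
    (if m \<in> occupations n then of_real (sq_amp k y * (\<Prod>i\<in>{..<n} - {j}. sq_amp (m i) (R i))) else 0)"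
proof -
  have "(\<Prod>i<n. sq_amp ((m(j := k)) i) ((R(j := y)) i))
      = sq_amp k y * (\<Prod>i\<in>{..<n} - {j}. sq_amp ((m(j := k)) i) ((R(j := y)) i))"
    using assms by (subst prod.remove[of _ j]) auto
  also have "(\<Prod>i\<in>{..<n} - {j}. sq_amp ((m(j := k)) i) ((R(j := y)) i)) = (\<Prod>i\<in>{..<n} - {j}. sq_amp (m i) (R i))"
    by (intro prod.cong) auto
  finally show ?thesis
    using upd_occupations[OF assms] by (simp add: prod_state_def)
qed

lemma prod_state_annih:
  assumes "j < n"
  shows "annih j (prod_state n R) = (\<lambda>m. - of_real (tanh (R j)) * creat j (prod_state n R) m)"
proof
  fix m
  define P where "P = (\<Prod>i\<in>{..<n} - {j}. sq_amp (m i) (R i))"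
  have *: "prod_state n R (m(j := k)) =
    (if m \<in> occupations n then of_real (sq_amp k (R j) * P) else 0)" for k
    using prod_state_upd[OF assms, of R "R j"] by (simp add: P_def)
  have "of_real (sqrt (real (m j + 1)) * sq_amp (m j + 1) (R j) * P) =
    complex_of_real (- tanh (R j) * (sqrt (real (m j)) * sq_amp (m j - 1) (R j)) * P)"
    by (simp only: sq_amp_annih)
  then show "annih j (prod_state n R) m = - of_real (tanh (R j)) * creat j (prod_state n R) m"
    unfolding annih_def creat_def * by (simp add: ac_simps)
qed

lemma prod_state_deriv:
  assumes j: "j < n"
  shows "((\<lambda>t. prod_state n (R(j := t * x)) m) has_vector_derivative
    squeeze_gen j x (prod_state n (R(j := t * x))) m) (at t within S)"
proof -
  define P where "P = (\<Prod>i\<in>{..<n} - {j}. sq_amp (m i) (R i))"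
  have *: "prod_state n (R(j := y)) (m(j := k)) =
    (if m \<in> occupations n then of_real (sq_amp k y * P) else 0)" for k y
    using prod_state_upd[OF j, of R y] by (simp add: P_def)
  from *[of _ "m j"] have **: "prod_state n (R(j := y)) m =
    (if m \<in> occupations n then of_real (sq_amp (m j) y * P) else 0)" for y
    by simp
  define d where "d y = (sqrt (real (m j + 1)) * sqrt (real (m j + 2)) * sq_amp (m j + 2) y
      - sqrt (real (m j)) * sqrt (real (m j - 1)) * sq_amp (m j - 2) y) / 2" for y
  have "((\<lambda>t. sq_amp (m j) (t * x) * P) has_real_derivative d (t * x) * x * P) (at t within S)"
    using sq_amp_deriv[of "m j", folded d_def]
    by (auto intro!: derivative_eq_intros DERIV_chain2[of "sq_amp (m j)"])
  then have "((\<lambda>t. complex_of_real (sq_amp (m j) (t * x) * P)) has_vector_derivative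
      of_real (d (t * x) * x * P)) (at t within S)"
    by (intro has_vector_derivative_of_real) (simp add: has_real_derivative_iff_has_vector_derivative)
  moreover have "squeeze_gen j x (prod_state n (R(j := y))) m =
      (if m \<in> occupations n then of_real (d y * x * P) else 0)" for y
    unfolding squeeze_gen_def annih_def creat_def fun_upd_upd fun_upd_same * d_def
    by (simp add: algebra_simps diff_divide_distrib numeral_2_eq_2)
  ultimately show ?thesis
    unfolding ** by simp
qed

lemma prod_state_decaying:
  assumes "\<And>t i. t \<in> I \<Longrightarrow> i < n \<Longrightarrow> \<bar>tanh (R t i)\<bar> \<le> T" "T < 1"
  shows "decaying n I (\<lambda>t. prod_state n (R t))"
proof -
  \<comment> \<open>The square root matches the two quanta per factor \<open>tanh\<close>; the
    maximum with \<open>1 / 2\<close> keeps \<open>q\<close> positive when no mode is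
    squeezed.\<close>
  define q where "q = sqrt (max T (1 / 2))"
  have q: "0 < q" "q < 1" "T \<le> q\<^sup>2" using assms(2) by (auto simp: q_def real_sqrt_lt_1_iff)
  have "decays n 1 q (prod_state n (R t))" if t: "t \<in> I" for t
    unfolding decays_def
  proof safe
    fix m
    have "\<bar>\<Prod>i<n. sq_amp (m i) (R t i)\<bar> = (\<Prod>i<n. \<bar>sq_amp (m i) (R t i)\<bar>)"
      by (rule abs_prod)
    also have "\<dots> \<le> (\<Prod>i<n. q ^ m i)"
      using assms(1)[OF t] q by (intro prod_mono conjI sq_amp_bound) (auto intro: order_trans)
    also have "\<dots> = q ^ deg n m" by (simp add: deg_def power_sum)
    finally show "cmod (prod_state n (R t) m) \<le> 1 * q ^ deg n m"
      using q by (simp add: prod_state_def flip: of_real_prod)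
  qed (simp add: prod_state_def)
  with q show ?thesis unfolding decaying_def by blast
qed

lemma tanh_bound:
  obtains T where "T < 1" "\<And>i. i < (n::nat) \<Longrightarrow> \<bar>tanh (R i :: real)\<bar> \<le> T"
proof
  define S where "S = insert 0 ((\<lambda>i. \<bar>tanh (R i)\<bar>) ` {..<n})"
  have "\<bar>tanh y\<bar> < 1" for y :: real
    using tanh_real_bounds[of y] by auto
  then show "Max S < 1" by (subst Max_less_iff) (auto simp: S_def)
  show "\<bar>tanh (R i)\<bar> \<le> Max S" if "i < n" for i
    using that by (intro Max_ge) (auto simp: S_def)
qed

text \<open>The solution lets the parameter of mode \<open>j\<close> grow linearly from 0 to
  \<open>x\<close>. Monotonicity of \<open>tanh\<close> bounds the whole path by its end point,
  which gives the decay uniform in time.\<close>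

lemma squeeze_evolves:
  assumes j: "j < n"
  shows "evolves n (squeeze_gen j x) (prod_state n (R(j := 0))) (prod_state n (R(j := x)))"
proof -
  interpret skew_generator n "squeeze_gen j x" by (rule skew_generator_squeeze[OF j])
  obtain T where T: "T < 1" "\<And>i. i < n \<Longrightarrow> \<bar>tanh ((R(j := x)) i)\<bar> \<le> T" using tanh_bound by blast
  have "\<bar>tanh ((R(j := t * x)) i)\<bar> \<le> T" if t: "t \<in> {0..1}" and i: "i < n" for t i
  proof (cases "i = j")
    case True
    have "\<bar>t * x\<bar> \<le> \<bar>x\<bar>" using t by (simp add: abs_mult mult_left_le_one_le)
    then have "tanh \<bar>t * x\<bar> \<le> tanh \<bar>x\<bar>" by (simp only: tanh_real_le_iff)
    then have "\<bar>tanh (t * x)\<bar> \<le> \<bar>tanh x\<bar>" by (simp only: tanh_real_abs)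
    then show ?thesis using T(2)[OF i] True by simp
  qed (use T(2)[OF i] in simp)
  then have "decaying n {0..1} (\<lambda>t. prod_state n (R(j := t * x)))"
    using T(1) by (rule prod_state_decaying)
  then have "strong_solution n (squeeze_gen j x) (\<lambda>t. prod_state n (R(j := t * x)))"
    using prod_state_deriv[OF j] by (rule strong_solutionI)
  then show ?thesis
    unfolding evolves_def by (intro exI[of _ "\<lambda>t. prod_state n (R(j := t * x))"]) simp
qed

lemma prod_state_zero: "prod_state n (\<lambda>_. 0) = vacuum"
proof
  fix m
  have z: "sq_amp k 0 = (if k = 0 then 1 else 0)" for k
    by (auto simp: sq_amp_def sq_coeff_def zero_power elim!: evenE)
  show "prod_state n (\<lambda>_. 0) m = vacuum m"
  proof (cases "m = (\<lambda>_. 0)")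
    case True
    then show ?thesis by (simp add: prod_state_def vacuum_def z occupations_def)
  next
    case False
    then obtain i where i: "m i \<noteq> 0" by auto
    then have "(\<Prod>i<n. sq_amp (m i) 0) = 0" if "m \<in> occupations n"
      using that by (intro prod_zero) (auto simp: z occupations_def not_le intro!: bexI[of _ i] leI)
    then show ?thesis using False by (simp add: prod_state_def vacuum_def)
  qed
qed

lemma fnorm_vacuum: "fnorm vacuum = 1"
proof -
  have "(\<Sum>\<^sub>\<infinity>m. (cmod (vacuum m))\<^sup>2) = (\<Sum>\<^sub>\<infinity>m\<in>{\<lambda>_. 0}. (cmod (vacuum m))\<^sup>2)"
    by (rule infsum_cong_neutral) (auto simp: vacuum_def)
  then show ?thesis by (simp add: fnorm_def vacuum_def)
qed

text \<open>The composition applies the highest mode first, so the induction lowers \<open>i\<close>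
  from \<open>n\<close>, and modes below \<open>i\<close> are still unsqueezed. The norm is carried
  along because the same evolution conserves it.\<close>

lemma squeeze_upt_vacuum:
  assumes "i \<le> n"
  shows "foldr (\<circ>) (map (\<lambda>j. op_exp n (squeeze_gen j (R j))) [i..<n]) id vacuum
      = prod_state n (\<lambda>k. if i \<le> k \<and> k < n then R k else 0)
    \<and> fnorm (prod_state n (\<lambda>k. if i \<le> k \<and> k < n then R k else 0)) = 1"
  using assms
proof (induction rule: inc_induct)
  case base
  have "(\<lambda>k. if n \<le> k \<and> k < n then R k else 0) = (\<lambda>k. 0)" by auto
  then show ?case by (simp add: prod_state_zero fnorm_vacuum del: upt_Suc)
next
  case (step i)
  interpret skew_generator n "squeeze_gen i (R i)" by (rule skew_generator_squeeze[OF step(2)])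
  define R' where "R' k = (if i \<le> k \<and> k < n then R k else 0)" for k
  have eq: "(\<lambda>k. if Suc i \<le> k \<and> k < n then R k else 0) = R'(i := 0)" "R'(i := R i) = R'"
    using step(2) by (auto simp: R'_def fun_eq_iff)
  have "evolves n (squeeze_gen i (R i)) (prod_state n (R'(i := 0))) (prod_state n R')"
    using squeeze_evolves[OF step(2), of "R i" R'] eq by simp
  then have "op_exp n (squeeze_gen i (R i)) (prod_state n (R'(i := 0))) = prod_state n R'"
    "fnorm (prod_state n R') = fnorm (prod_state n (R'(i := 0)))"
    by (rule op_exp_eqI, rule evolves_fnorm)
  then show ?case
    using step unfolding eq R'_def[abs_def, symmetric] by (simp add: upt_conv_Cons)
qed

lemma probe_eq:
  "probe n r = prod_state n (\<lambda>k. if k < n then r $ k else 0)"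
  "fnorm (probe n r) = 1"
  using squeeze_upt_vacuum[of 0 n "\<lambda>j. r $ j"] by (auto simp: probe_def squeeze_def)

lemma probe_decaying: "decaying n {probe n r} (\<lambda>\<psi>. \<psi>)"
proof -
  define R where "R k = (if k < n then r $ k else 0)" for k
  obtain T where "T < 1" "\<And>i. i < n \<Longrightarrow> \<bar>tanh (R i)\<bar> \<le> T" using tanh_bound by blast
  then have "decaying n UNIV (\<lambda>t::unit. prod_state n R)" by (intro prod_state_decaying) auto
  then show ?thesis by (simp add: decaying_def probe_eq R_def[abs_def])
qed

lemma probe_annih:
  assumes "j < n"
  shows "annih j (probe n r) = (\<lambda>m. - of_real (tanh (r $ j)) * creat j (probe n r) m)"
  unfolding probe_eq using prod_state_annih[OF assms, of "\<lambda>k. if k < n then r $ k else 0"] assms by simp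

subsection \<open>Quadratic moments\<close>

definition hop :: "nat \<times> nat \<Rightarrow> fop" where
  "hop p \<psi> = creat (fst p) (annih (snd p) \<psi>)"

abbreviation idx :: "nat \<Rightarrow> (nat \<times> nat) set" where
  "idx n \<equiv> {..<n} \<times> {..<n}"

definition bilin :: "nat \<Rightarrow> (nat \<times> nat \<Rightarrow> complex) \<Rightarrow> fop" where
  "bilin n A \<psi> = (\<lambda>m. \<Sum>p\<in>idx n. A p * hop p \<psi> m)"

text \<open>Ordered and complex bilinear in the two matrices; symmetrization is left to
  \<open>fisher_mcov\<close>, so that linear changes of generators act on it directly.\<close>

definition mcov :: "nat \<Rightarrow> fvec \<Rightarrow> (nat \<times> nat \<Rightarrow> complex) \<Rightarrow> (nat \<times> nat \<Rightarrow> complex) \<Rightarrow> complex" where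
  "mcov n \<psi> A B = ip \<psi> (bilin n A (bilin n B \<psi>)) - ip \<psi> (bilin n A \<psi>) * ip \<psi> (bilin n B \<psi>)"

definition cov :: "fvec \<Rightarrow> nat \<times> nat \<Rightarrow> nat \<times> nat \<Rightarrow> complex" where
  "cov \<psi> p q = ip \<psi> (hop p (hop q \<psi>)) - ip \<psi> (hop p \<psi>) * ip \<psi> (hop q \<psi>)"

text \<open>The coefficients of \<open>gen\<close> as a functional of an arbitrary \<open>X\<close>,
  to be applied alike to hopping terms, covariances and matrix entries. \<open>root_mat\<close>
  recovers the coefficient matrix by evaluating it on unit functions.\<close>

fun root_comb :: "root \<Rightarrow> (nat \<times> nat \<Rightarrow> complex) \<Rightarrow> complex" where
  "root_comb (Long j) X = X (j, j)"
| "root_comb (Minus j k) X = - \<i> / of_real (sqrt 2) * (X (j, k) - X (k, j))"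
| "root_comb (Plus j k) X = 1 / of_real (sqrt 2) * (X (j, k) + X (k, j))"

definition root_mat :: "root \<Rightarrow> nat \<times> nat \<Rightarrow> complex" where
  "root_mat \<alpha> p = root_comb \<alpha> (\<lambda>q. if p = q then 1 else 0)"

lemma hop_add: "hop p (\<lambda>m. \<phi> m + \<psi> m) = (\<lambda>m. hop p \<phi> m + hop p \<psi> m)"
  and hop_cmult: "hop p (\<lambda>m. c * \<psi> m) = (\<lambda>m. c * hop p \<psi> m)"
  and hop_sum: "hop p (\<lambda>m. \<Sum>i\<in>I. f i m) = (\<lambda>m. \<Sum>i\<in>I. hop p (f i) m)"
  by (auto simp: hop_def annih_add creat_add annih_cmult creat_cmult annih_sum creat_sum)

lemma bilin_add: "bilin n A (\<lambda>m. \<phi> m + \<psi> m) = (\<lambda>m. bilin n A \<phi> m + bilin n A \<psi> m)"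
  by (simp add: bilin_def hop_add ring_distribs sum.distrib)

lemma bilin_cmult: "bilin n A (\<lambda>m. c * \<psi> m) = (\<lambda>m. c * bilin n A \<psi> m)"
  by (simp add: bilin_def hop_cmult sum_distrib_left mult.left_commute)

lemma bilin_diff: "bilin n A (\<lambda>m. \<phi> m - \<psi> m) = (\<lambda>m. bilin n A \<phi> m - bilin n A \<psi> m)"
  using bilin_add[of n A \<phi> "\<lambda>m. (-1) * \<psi> m"] bilin_cmult[of n A "-1" \<psi>] by simp

lemma bilin_bilin:
  "bilin n A (bilin n B \<psi>) = (\<lambda>m. \<Sum>p\<in>idx n. \<Sum>q\<in>idx n. A p * (B q * hop p (hop q \<psi>) m))"
  by (simp add: bilin_def hop_sum hop_cmult sum_distrib_left)

lemma decaying_hop: "decaying n I f \<Longrightarrow> p \<in> idx n \<Longrightarrow> decaying n I (\<lambda>i. hop p (f i))"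
  unfolding hop_def by (intro decaying_creat decaying_annih) auto

lemma decaying_bilin: "decaying n I f \<Longrightarrow> decaying n I (\<lambda>i. bilin n A (f i))"
  unfolding bilin_def by (intro decaying_sum decaying_const_cmult decaying_hop) auto

lemma root_comb_sum:
  assumes "\<alpha> \<in> pos_roots n"
  shows "root_comb \<alpha> X = (\<Sum>p\<in>idx n. root_mat \<alpha> p * X p)"
proof -
  have s: "(\<Sum>p\<in>idx n. (if p = q then 1 else 0) * X p) = X q" if "q \<in> idx n" for q
    using that by (simp add: if_distrib[of "\<lambda>x. x * _"] cong: if_cong)
  have *: "(\<Sum>p\<in>idx n. (c * (a p - b p)) * X p) = c * ((\<Sum>p\<in>idx n. a p * X p) - (\<Sum>p\<in>idx n. b p * X p))"
    "(\<Sum>p\<in>idx n. (c * (a p + b p)) * X p) = c * ((\<Sum>p\<in>idx n. a p * X p) + (\<Sum>p\<in>idx n. b p * X p))"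
    for c a b
    by (simp_all add: sum_subtractf sum.distrib sum_distrib_left algebra_simps)
  from assms consider (1) j where "\<alpha> = Long j" "j < n" | (2) j k where "\<alpha> = Minus j k" "j < n" "k < n"
    | (3) j k where "\<alpha> = Plus j k" "j < n" "k < n"
    by (auto simp: pos_roots_def)
  then show ?thesis
    by cases (simp_all only: root_mat_def root_comb.simps * s mem_Times_iff fst_conv snd_conv lessThan_iff simp_thms)
qed

lemma gen_bilin:
  assumes "\<alpha> \<in> pos_roots n"
  shows "gen \<alpha> \<psi> = bilin n (root_mat \<alpha>) \<psi>"
proof
  fix m
  have "gen \<alpha> \<psi> m = root_comb \<alpha> (\<lambda>p. hop p \<psi> m)"
    by (cases \<alpha>) (simp_all add: hop_def)
  then show "gen \<alpha> \<psi> m = bilin n (root_mat \<alpha>) \<psi> m"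
    by (simp add: root_comb_sum[OF assms] bilin_def)
qed

lemma expect_ip: "expect \<psi> A = ip \<psi> (A \<psi>)"
  by (simp add: expect_def ip_def)

text \<open>Expanding both deviations, the unit norm lets the mean terms collect to minus twice the
  product of the means, one share for each order of the factors. Decay makes all vectors involved
  square summable, so \<open>ip\<close> may be split.\<close>

lemma fisher_mcov:
  assumes \<psi>: "decaying n {\<psi>} (\<lambda>\<psi>. \<psi>)" "fnorm \<psi> = 1"
    and ab: "\<alpha> \<in> pos_roots n" "\<beta> \<in> pos_roots n"
  shows "fisher \<psi> \<alpha> \<beta> = 2 * (mcov n \<psi> (root_mat \<alpha>) (root_mat \<beta>) + mcov n \<psi> (root_mat \<beta>) (root_mat \<alpha>))"
proof -
  define A B where "A = bilin n (root_mat \<alpha>)" and "B = bilin n (root_mat \<beta>)"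
  have gen: "gen \<alpha> = A" "gen \<beta> = B"
    using gen_bilin ab by (auto simp: A_def B_def fun_eq_iff)
  define a b where "a = ip \<psi> (A \<psi>)" and "b = ip \<psi> (B \<psi>)"
  have l2: "l2 \<psi>" "l2 (A \<psi>)" "l2 (B \<psi>)" "l2 (A (B \<psi>))" "l2 (B (A \<psi>))"
    unfolding A_def B_def using decaying_l2[of n "{\<psi>}" _ \<psi>] \<psi>(1) by (blast intro: decaying_bilin)+
  have one: "ip \<psi> \<psi> = 1" using \<psi>(2) l2(1) by (simp add: ip_self)
  have l2': "l2 (\<lambda>m. c * A \<psi> m)" "l2 (\<lambda>m. c * B \<psi> m)" "l2 (\<lambda>m. c * \<psi> m)" for c
    using l2 by (auto intro: l2_cmult)
  have "anticommutator (deviation \<psi> A) (deviation \<psi> B) \<psi> =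
     (\<lambda>m. ((A (B \<psi>) m + B (A \<psi>) m) - (2 * b) * A \<psi> m - (2 * a) * B \<psi> m) + (2 * a * b) * \<psi> m)"
    by (simp add: anticommutator_def deviation_def expect_ip A_def B_def bilin_diff bilin_cmult a_def b_def)
      (simp add: fun_eq_iff algebra_simps)
  then have "expect \<psi> (anticommutator (deviation \<psi> A) (deviation \<psi> B))
      = (ip \<psi> (A (B \<psi>)) + ip \<psi> (B (A \<psi>))) - 2 * b * a - 2 * a * b + 2 * a * b * 1"
    unfolding expect_ip
    by (simp only: ip_add ip_diff ip_cmult l2 l2' l2_add l2_diff one) (simp only: a_def b_def)
  note E = this
  show ?thesis
    unfolding fisher_def gen E mcov_def A_def[symmetric] B_def[symmetric] a_def[symmetric] b_def[symmetric]
    by (simp add: algebra_simps)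
qed

lemma mcov_cov:
  assumes \<psi>: "decaying n {\<psi>} (\<lambda>\<psi>. \<psi>)"
  shows "mcov n \<psi> A B = (\<Sum>p\<in>idx n. A p * (\<Sum>q\<in>idx n. B q * cov \<psi> p q))"
proof -
  have l2: "l2 \<psi>" using decaying_l2[OF \<psi>] by simp
  have l2h: "l2 (hop p \<psi>)" if "p \<in> idx n" for p
    using decaying_l2[OF decaying_hop[OF \<psi> that]] by simp
  have l2hh: "l2 (hop p (hop q \<psi>))" if "p \<in> idx n" "q \<in> idx n" for p q
    using decaying_l2[OF decaying_hop[OF decaying_hop[OF \<psi> that(2)] that(1)]] by simp
  have 1: "ip \<psi> (bilin n A \<psi>) = (\<Sum>p\<in>idx n. A p * ip \<psi> (hop p \<psi>))" for A
    unfolding bilin_def ip_cmult[symmetric] by (rule ip_sum[OF l2]) (intro l2_cmult l2h)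
  have 2: "ip \<psi> (bilin n A (bilin n B \<psi>)) = (\<Sum>p\<in>idx n. A p * (\<Sum>q\<in>idx n. B q * ip \<psi> (hop p (hop q \<psi>))))"
  proof -
    have "ip \<psi> (bilin n A (bilin n B \<psi>)) =
        (\<Sum>p\<in>idx n. ip \<psi> (\<lambda>m. \<Sum>q\<in>idx n. A p * (B q * hop p (hop q \<psi>) m)))"
      unfolding bilin_bilin by (rule ip_sum[OF l2]) (intro l2_sum l2_cmult l2hh)
    also have "\<dots> = (\<Sum>p\<in>idx n. \<Sum>q\<in>idx n. ip \<psi> (\<lambda>m. A p * (B q * hop p (hop q \<psi>) m)))"
      by (intro sum.cong refl ip_sum l2 l2_cmult l2hh)
    finally show ?thesis by (simp only: ip_cmult sum_distrib_left)
  qed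
  have 3: "(\<Sum>p\<in>idx n. A p * x p) * (\<Sum>q\<in>idx n. B q * x q)
      = (\<Sum>p\<in>idx n. A p * (\<Sum>q\<in>idx n. B q * (x p * x q)))" for x
    by (subst sum_product) (simp add: sum_distrib_left ac_simps)
  show ?thesis
    unfolding mcov_def 1 2 3 cov_def by (simp only: right_diff_distrib sum_subtractf)
qed

lemma fisher_cov:
  assumes \<psi>: "decaying n {\<psi>} (\<lambda>\<psi>. \<psi>)" "fnorm \<psi> = 1"
    and ab: "\<alpha> \<in> pos_roots n" "\<beta> \<in> pos_roots n"
  shows "fisher \<psi> \<alpha> \<beta> = 2 * (root_comb \<alpha> (\<lambda>p. root_comb \<beta> (\<lambda>q. cov \<psi> p q))
    + root_comb \<beta> (\<lambda>p. root_comb \<alpha> (\<lambda>q. cov \<psi> p q)))"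
  unfolding fisher_mcov[OF assms] mcov_cov[OF \<psi>(1)] root_comb_sum[OF ab(1)] root_comb_sum[OF ab(2)] ..

section \<open>Wick contractions and the Fisher matrix of the probe\<close>

lemma annih_commute: "annih j (annih k \<psi>) = annih k (annih j \<psi>)"
  by (cases "j = k") (auto simp: annih_def fun_upd_twist)

lemma creat_commute: "creat j (creat k \<psi>) = creat k (creat j \<psi>)"
  by (cases "j = k") (auto simp: creat_def fun_upd_twist)

lemma annih_creat:
  "annih j (creat k \<psi>) = (\<lambda>m. creat k (annih j \<psi>) m + (if j = k then 1 else 0) * \<psi> m)"
  using canonical_commutation[of j k \<psi>] by (auto simp: fun_eq_iff algebra_simps)

lemma ip_cmult_left: "ip (\<lambda>m. c * \<phi> m) \<psi> = cnj c * ip \<phi> \<psi>"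
  using cnj_ip[of \<psi> "\<lambda>m. c * \<phi> m"] cnj_ip[of \<psi> \<phi>] by (simp add: ip_cmult)

text \<open>If \<open>a\<^sub>j \<psi> = \<tau>\<^sub>j a\<^sub>j\<^sup>\<dagger> \<psi>\<close>, moving annihilators to the right turns a moment of creation operators
  into lower moments plus a contraction factor times a moment of the same order. This linear
  system has only one solution, which is the one Wick's theorem gives.\<close>

lemma squeezed_cov:
  fixes \<tau> :: "nat \<Rightarrow> real"
  assumes \<psi>: "decaying n {\<psi>} (\<lambda>\<psi>. \<psi>)" "fnorm \<psi> = 1"
    and an: "\<And>j. j < n \<Longrightarrow> annih j \<psi> = (\<lambda>m. of_real (\<tau> j) * creat j \<psi> m)"
    and C: "\<And>j. j < n \<Longrightarrow> C j = 1 + (\<tau> j)\<^sup>2 * C j" and \<tau>: "\<And>j. j < n \<Longrightarrow> \<bar>\<tau> j\<bar> < 1"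
    and ind: "j < n" "k < n" "l < n" "m < n"
  shows "cov \<psi> (j, k) (l, m) = of_real (C j * C k *
    (if j = m \<and> k = l then (\<tau> j)\<^sup>2 else 0) + C j * C k * (if j = l \<and> k = m then \<tau> j * \<tau> k else 0))"
proof -
  have D1: "decaying n {\<psi>} (\<lambda>\<psi>. creat j \<psi>)" if "j < n" for j
    by (rule decaying_creat[OF \<psi>(1) that])
  have D2: "decaying n {\<psi>} (\<lambda>\<psi>. creat k (creat j \<psi>))" if "j < n" "k < n" for j k
    by (rule decaying_creat[OF D1 that(2)]) (rule that(1))
  have D3: "decaying n {\<psi>} (\<lambda>\<psi>. creat l (creat k (creat j \<psi>)))" if "j < n" "k < n" "l < n" for j k l
    by (rule decaying_creat[OF D2 that(3)]) (fact that)+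
  have l2: "l2 \<psi>" "\<And>j. j < n \<Longrightarrow> l2 (creat j \<psi>)" "\<And>j k. j < n \<Longrightarrow> k < n \<Longrightarrow> l2 (creat k (creat j \<psi>))"
    "\<And>j k l. j < n \<Longrightarrow> k < n \<Longrightarrow> l < n \<Longrightarrow> l2 (creat l (creat k (creat j \<psi>)))"
    using decaying_l2[OF \<psi>(1)] decaying_l2[OF D1] decaying_l2[OF D2] decaying_l2[OF D3] by auto
  have one: "ip \<psi> \<psi> = 1" using \<psi>(2) l2(1) by (simp add: ip_self)
  define t where "t j = complex_of_real (\<tau> j)" for j
  define c where "c j = complex_of_real (C j)" for j
  define d where "d i j = (if i = j then 1 else 0 :: complex)" for i j :: nat
  have an': "annih j \<psi> = (\<lambda>m. t j * creat j \<psi> m)" if "j < n" for j using an[OF that] by (simp add: t_def)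
  have cnj: "cnj (t j) = t j" "cnj (d i j) = d i j" for i j by (auto simp: t_def d_def)
  \<comment> \<open>So \<open>c j\<close> is \<open>1 / (1 - (t j)\<^sup>2)\<close>; it turns out to
    be the contraction of the annihilator with the creator of mode \<open>j\<close>.\<close>
  have c: "c j = 1 + t j * t j * c j" if "j < n" for j
    using arg_cong[OF C[OF that], of complex_of_real] by (simp add: t_def c_def power2_eq_square)
  have contr: "1 - (t i * t j) * (t i * t j) \<noteq> 0" if "i < n" "j < n" for i j
  proof -
    have "\<bar>\<tau> i * \<tau> j\<bar> < 1"
      using \<tau>[OF that(1)] \<tau>[OF that(2)] mult_left_mono[of "\<bar>\<tau> j\<bar>" 1 "\<bar>\<tau> i\<bar>"] by (simp add: abs_mult)
    then have "(\<tau> i * \<tau> j)\<^sup>2 \<noteq> 1" by (simp add: power2_eq_1_iff) auto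
    then show ?thesis
      unfolding t_def by (metis eq_iff_diff_eq_0 of_real_1 of_real_eq_iff of_real_mult power2_eq_square)
  qed
  define P where "P i j = ip (creat i \<psi>) (creat j \<psi>)" for i j
  have ac: "annih i (creat j \<psi>) = (\<lambda>m. t i * creat j (creat i \<psi>) m + d i j * \<psi> m)" if "i < n" for i j
    unfolding annih_creat an'[OF that] creat_cmult d_def ..
  have P1: "P i j = d i j + t i * t j * P j i" if ij: "i < n" "j < n" for i j
  proof -
    have "P i j = ip \<psi> (annih i (creat j \<psi>))" by (simp add: P_def ip_annih)
    also have "\<dots> = t i * ip \<psi> (creat j (creat i \<psi>)) + d i j"
      unfolding ac[OF ij(1)] using ij by (simp only: ip_add ip_cmult l2 l2_cmult one mult_1_right)
    also have "ip \<psi> (creat j (creat i \<psi>)) = t j * P j i"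
      unfolding ip_creat an'[OF ij(2)] ip_cmult_left cnj P_def ..
    finally show ?thesis by simp
  qed
  \<comment> \<open>\<open>P1\<close> leads to the transposed moment; a second application returns
    to \<open>P i j\<close> with the factor \<open>(t i * t j)\<^sup>2\<close>, which differs from 1
    by \<open>contr\<close>.\<close>
  have P: "P i j = d i j * c i" if ij: "i < n" "j < n" for i j
  proof -
    have "P i j = d i j + t i * t j * (d j i + t j * t i * P i j)"
      using P1[OF ij] P1[OF ij(2,1)] by simp
    then have "(1 - (t i * t j) * (t i * t j)) * P i j = d i j * (1 + t i * t i)"
      by (auto simp: d_def algebra_simps)
    also have "\<dots> = (1 - (t i * t j) * (t i * t j)) * (d i j * c i)"
    proof -
      have "(1 - (t i * t i) * (t i * t i)) * c i = (1 + t i * t i) * (c i - t i * t i * c i)"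
        by (simp add: algebra_simps)
      also have "c i - t i * t i * c i = 1" using c[OF ij(1)] by (simp add: algebra_simps)
      finally show ?thesis by (auto simp: d_def algebra_simps)
    qed
    finally show ?thesis using contr[OF ij] by simp
  qed
  define X where "X k j l m = ip (creat k (creat j \<psi>)) (creat l (creat m \<psi>))" for k j l m
  \<comment> \<open>Moving the annihilator of mode \<open>k\<close> to the right end and then
    \<open>creat l\<close> across the inner product exchanges \<open>k\<close> and \<open>l\<close>,
    up to second moments. Applied twice, this gives a solvable equation for
    \<open>X k j l m\<close>.\<close>
  have X1: "X k j l m = d k l * P j m + d k m * P j l + t k * d l j * t m * P m k + t k * t l * X l j k m"
    if ind: "j < n" "k < n" "l < n" "m < n" for j k l m
  proof -
    have e1: "annih k (creat l (creat m \<psi>)) =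
        (\<lambda>x. t k * creat l (creat m (creat k \<psi>)) x + d k m * creat l \<psi> x + d k l * creat m \<psi> x)"
      unfolding annih_creat[of k l] ac[OF ind(2)] creat_add creat_cmult d_def ..
    have "X k j l m = ip (creat j \<psi>) (annih k (creat l (creat m \<psi>)))" by (simp add: X_def ip_annih)
    also have "\<dots> = t k * ip (creat j \<psi>) (creat l (creat m (creat k \<psi>))) + d k m * P j l + d k l * P j m"
      unfolding e1 P_def by (simp only: ip_add ip_cmult l2_add l2_cmult l2 ind)
    also have "ip (creat j \<psi>) (creat l (creat m (creat k \<psi>))) = ip (annih l (creat j \<psi>)) (creat m (creat k \<psi>))"
      by (rule ip_creat)
    also have "\<dots> = t l * X j l m k + d l j * ip \<psi> (creat m (creat k \<psi>))"
      unfolding ac[OF ind(3)] X_def by (simp only: ip_add_left ip_cmult_left cnj l2_add l2_cmult l2 ind)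
    also have "ip \<psi> (creat m (creat k \<psi>)) = t m * P m k"
      unfolding ip_creat an'[OF ind(4)] ip_cmult_left cnj P_def ..
    also have "X j l m k = X l j k m"
      by (simp add: X_def creat_commute[of j l] creat_commute[of m k])
    finally show ?thesis by (simp add: algebra_simps)
  qed
  \<comment> \<open>The sum over the three Wick pairings: two pair annihilators with creators, the
    last pairs the annihilators and the creators among themselves.\<close>
  define Y where "Y k j l m = c j * c k * (d j m * d k l + d j l * d k m) + d k j * d l m * t k * c k * t l * c l"
    for k j l m
  have XY: "X k j l m = Y k j l m"
  proof -
    have "X k j l m = d k l * P j m + d k m * P j l + t k * d l j * t m * P m k
        + t k * t l * (d l k * P j m + d l m * P j k + t l * d k j * t m * P m l + t l * t k * X k j l m)"
      using X1[OF ind] X1[OF ind(1,3,2,4)] by simp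
    then have "(1 - (t k * t l) * (t k * t l)) * X k j l m
        = d k l * P j m + d k m * P j l + t k * d l j * t m * P m k
        + t k * t l * (d l k * P j m + d l m * P j k + t l * d k j * t m * P m l)"
      by (simp add: algebra_simps)
    also have "\<dots> = (1 - (t k * t l) * (t k * t l)) * Y k j l m"
    proof -
      have 1: "(1 - (t k * t k) * (t k * t k)) * (c k * z) = (1 + t k * t k) * z" for z
      proof -
        have "(1 - (t k * t k) * (t k * t k)) * (c k * z) = (1 + t k * t k) * (c k - t k * t k * c k) * z"
          by (simp add: algebra_simps)
        also have "c k - t k * t k * c k = 1" using c[OF ind(2)] by (simp add: algebra_simps)
        finally show ?thesis by simp
      qed
      have 2: "(1 - (t k * t l) * (t k * t l)) * (c k * c l) = c l + t k * t k * c k"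
      proof -
        have "(1 - (t k * t l) * (t k * t l)) * (c k * c l)
            = (c k - t k * t k * c k) * c l + t k * t k * c k * (c l - t l * t l * c l)"
          by (simp add: algebra_simps)
        also have "c k - t k * t k * c k = 1" using c[OF ind(2)] by (simp add: algebra_simps)
        also have "c l - t l * t l * c l = 1" using c[OF ind(3)] by (simp add: algebra_simps)
        finally show ?thesis by simp
      qed
      have 3: "(1 - (t k * t l) * (t k * t l)) * (c k * c l) = c k + t l * t l * c l"
      proof -
        have "(1 - (t k * t l) * (t k * t l)) * (c k * c l)
            = (c l - t l * t l * c l) * c k + t l * t l * c l * (c k - t k * t k * c k)"
          by (simp add: algebra_simps)
        also have "c k - t k * t k * c k = 1" using c[OF ind(2)] by (simp add: algebra_simps)
        also have "c l - t l * t l * c l = 1" using c[OF ind(3)] by (simp add: algebra_simps)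
        finally show ?thesis by simp
      qed
      define z where "z = 1 - (t k * t l) * (t k * t l)"
      have "z * Y k j l m = d j m * (d k l * (z * (c k * c j))) + d j l * d k m * (z * (c k * c l))
         + d k j * d l m * (t k * t l) * (z * (c k * c l))"
        by (auto simp: Y_def d_def algebra_simps)
      also have "d k l * (z * (c k * c j)) = d k l * ((1 + t k * t k) * c j)"
        using 1[of "c j"] by (auto simp: d_def z_def)
      also have "d j l * d k m * (z * (c k * c l)) = d j l * d k m * (c l + t k * t k * c k)"
        using 2 by (simp add: z_def)
      also have "d k j * d l m * (t k * t l) * (z * (c k * c l)) = d k j * d l m * (t k * t l) * (c k + t l * t l * c l)"
        using 3 by (simp add: z_def)
      finally show ?thesis
        unfolding z_def[symmetric] using ind by (simp only: P) (auto simp: d_def algebra_simps)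
    qed
    finally show ?thesis using contr[OF ind(2,3)] by simp
  qed
  \<comment> \<open>The annihilators of modes \<open>j\<close> and \<open>m\<close> act directly on
    \<open>\<psi>\<close> on the two sides of the inner product and become creators with factors
    \<open>t j\<close> and \<open>t m\<close>.\<close>
  have h2: "ip \<psi> (hop (j, k) (hop (l, m) \<psi>)) = t j * t m * X k j l m"
  proof -
    have "ip \<psi> (hop (j, k) (hop (l, m) \<psi>)) = ip (creat k (annih j \<psi>)) (creat l (annih m \<psi>))"
      by (simp add: hop_def ip_creat ip_annih)
    then show ?thesis
      unfolding an'[OF ind(1)] an'[OF ind(4)] creat_cmult ip_cmult ip_cmult_left cnj X_def
      by (simp add: ac_simps)
  qed
  have h1: "ip \<psi> (hop (i, j) \<psi>) = t i * t j * P i j" if "i < n" "j < n" for i j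
    unfolding hop_def fst_conv snd_conv ip_creat an'[OF that(1)] an'[OF that(2)] ip_cmult ip_cmult_left cnj P_def
    by (simp add: ac_simps)
  \<comment> \<open>The product of the means is exactly the third pairing in \<open>Y\<close>, so
    the covariance retains the other two.\<close>
  have "cov \<psi> (j, k) (l, m) = t j * t m * Y k j l m - t j * t k * (d j k * c j) * (t l * t m * (d l m * c l))"
    unfolding cov_def h2 XY h1[OF ind(1,2)] h1[OF ind(3,4)] P[OF ind(1,2)] P[OF ind(3,4)] ..
  also have "\<dots> = c j * c k * (d j m * d k l * (t j * t j)) + c j * c k * (d j l * d k m * (t j * t k))"
    unfolding Y_def by (simp add: d_def algebra_simps)
  also have "\<dots> = of_real (C j * C k * (if j = m \<and> k = l then (\<tau> j)\<^sup>2 else 0)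
      + C j * C k * (if j = l \<and> k = m then \<tau> j * \<tau> k else 0))"
    unfolding d_def c_def t_def power2_eq_square
    by (cases "j = m"; cases "k = l"; cases "j = l"; cases "k = m"; simp)
  finally show ?thesis .
qed

fun root_pair :: "root \<Rightarrow> nat \<times> nat" where
  "root_pair (Long j) = (j, j)"
| "root_pair (Minus j k) = (j, k)"
| "root_pair (Plus j k) = (j, k)"

lemma root_comb_eq_0:
  assumes "X (root_pair \<alpha>) = 0" "X (prod.swap (root_pair \<alpha>)) = 0"
  shows "root_comb \<alpha> X = 0"
  using assms by (cases \<alpha>) auto

text \<open>Covariances of hops live on equal or transposed index pairs, so different pairs of modes
  decouple. On one pair the diagonal entries are \<open>C j * C k\<close> times
  \<open>(\<tau> j - \<tau> k)\<^sup>2\<close> or \<open>(\<tau> j + \<tau> k)\<^sup>2\<close>, and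
  the addition theorems for \<open>sinh\<close> apply, with \<open>C\<close> the squared
  \<open>cosh\<close> and \<open>\<tau>\<close> the negative \<open>tanh\<close>.\<close>

lemma fisher_probe:
  assumes ab: "\<alpha> \<in> pos_roots n" "\<beta> \<in> pos_roots n"
  shows "fisher (probe n r) \<alpha> \<beta> =
    (if \<alpha> = \<beta> then complex_of_real (2 * (sinh (root_val \<alpha> r))\<^sup>2) else 0)"
proof -
  define \<tau> where "\<tau> j = - tanh (r $ j)" for j
  define C where "C j = (cosh (r $ j))\<^sup>2" for j
  define W where "W = cov (probe n r)"
  have W: "W (j, k) (l, m) = of_real (C j * C k *
    (if j = m \<and> k = l then (\<tau> j)\<^sup>2 else 0) + C j * C k * (if j = l \<and> k = m then \<tau> j * \<tau> k else 0))"
    if "j < n" "k < n" "l < n" "m < n" for j k l m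
    unfolding W_def
  proof (rule squeezed_cov[OF probe_decaying probe_eq(2) _ _ _ that])
    show "annih j (probe n r) = (\<lambda>m. of_real (\<tau> j) * creat j (probe n r) m)" if "j < n" for j
      using probe_annih[OF that] by (simp add: \<tau>_def)
    show "C j = 1 + (\<tau> j)\<^sup>2 * C j" for j
    proof -
      have "tanh (r $ j) * cosh (r $ j) = sinh (r $ j)" by (simp add: tanh_def)
      then have "(\<tau> j)\<^sup>2 * C j = (sinh (r $ j))\<^sup>2"
        by (metis C_def \<tau>_def power2_minus power_mult_distrib)
      then show ?thesis
        using cosh_square_eq[of "r $ j"] by (simp add: C_def)
    qed
    show "\<bar>\<tau> j\<bar> < 1" for j
      using tanh_real_bounds[of "r $ j"] by (auto simp: \<tau>_def)
  qed
  have sq: "C j * C k * (\<tau> j - \<tau> k)\<^sup>2 = (sinh (r $ j - r $ k))\<^sup>2"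
    "C j * C k * (\<tau> j + \<tau> k)\<^sup>2 = (sinh (r $ j + r $ k))\<^sup>2" for j k
  proof -
    have "cosh (r $ j) * cosh (r $ k) * (\<tau> j - \<tau> k) = - sinh (r $ j - r $ k)"
      "cosh (r $ j) * cosh (r $ k) * (\<tau> j + \<tau> k) = - sinh (r $ j + r $ k)"
      by (simp_all add: \<tau>_def sinh_diff sinh_add tanh_def field_simps)
    from this[THEN arg_cong[of _ _ "\<lambda>x. x\<^sup>2"]]
    show "C j * C k * (\<tau> j - \<tau> k)\<^sup>2 = (sinh (r $ j - r $ k))\<^sup>2"
      "C j * C k * (\<tau> j + \<tau> k)\<^sup>2 = (sinh (r $ j + r $ k))\<^sup>2"
      by (simp_all add: power_mult_distrib C_def)
  qed
  have sqrt2: "complex_of_real (sqrt 2) * complex_of_real (sqrt 2) = 2"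
    by (simp flip: of_real_mult)
  have "fisher (probe n r) \<alpha> \<beta> = 2 * (root_comb \<alpha> (\<lambda>p. root_comb \<beta> (\<lambda>q. W p q))
    + root_comb \<beta> (\<lambda>p. root_comb \<alpha> (\<lambda>q. W p q)))"
    unfolding W_def by (rule fisher_cov[OF probe_decaying probe_eq(2) ab])
  also have "\<dots> = (if \<alpha> = \<beta> then complex_of_real (2 * (sinh (root_val \<alpha> r))\<^sup>2) else 0)"
  proof -
    have half: "1 / complex_of_real (sqrt 2) * (1 / complex_of_real (sqrt 2)) = 1 / 2"
      using sqrt2 by (simp add: divide_simps)
    define s where "s = 1 / complex_of_real (sqrt 2)"
    have s: "s * (s * x) = x / 2" "- \<i> / complex_of_real (sqrt 2) = - \<i> * s" for x
      using half by (auto simp: s_def simp flip: mult.assoc)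
    have root: "root_comb (Minus j k) X = - \<i> * (s * (X (j, k) - X (k, j)))"
      "root_comb (Plus j k) X = s * (X (j, k) + X (k, j))" for j k X
      by (simp_all add: s_def)
    show ?thesis
    proof (cases "\<alpha> = \<beta>")
      case True
      from ab(1) consider (1) j where "\<alpha> = Long j" "j < n" | (2) j k where "\<alpha> = Minus j k" "j < k" "k < n"
        | (3) j k where "\<alpha> = Plus j k" "j < k" "k < n"
        by (auto simp: pos_roots_def)
      then show ?thesis
      proof cases
        case 1
        have "(sinh (2 * r $ j))\<^sup>2 = C j * C j * (\<tau> j + \<tau> j)\<^sup>2"
          using sq(2)[of j j] by simp
        then show ?thesis using 1 True by (simp add: W power2_eq_square)
      next
        case 2
        then show ?thesis using True sq(1)[of j k, symmetric]
          by (simp add: W root del: root_comb.simps(2,3)) (simp add: s power2_eq_square algebra_simps)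
      next
        case 3
        then show ?thesis using True sq(2)[of j k, symmetric]
          by (simp add: W root del: root_comb.simps(2,3)) (simp add: s power2_eq_square algebra_simps)
      qed
    next
      case False
      obtain a b where a: "root_pair \<alpha> = (a, b)" "a \<le> b" "b < n"
        using ab(1) by (auto simp: pos_roots_def)
      obtain c d where c: "root_pair \<beta> = (c, d)" "c \<le> d" "d < n"
        using ab(2) by (auto simp: pos_roots_def)
      show ?thesis
      proof (cases "(a, b) = (c, d)")
        case True
        \<comment> \<open>Here the two ordered covariances are opposite multiples of
          \<open>(\<tau> j)\<^sup>2 - (\<tau> k)\<^sup>2\<close>; they cancel only in the
          symmetrized sum.\<close>
        then obtain j k where "j < k" "k < n" "\<alpha> = Minus j k \<and> \<beta> = Plus j k \<or> \<alpha> = Plus j k \<and> \<beta> = Minus j k"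
          using a c False ab by (auto simp: pos_roots_def)
        then show ?thesis
          by (elim disjE conjE) (simp_all add: W root algebra_simps del: root_comb.simps(2,3))
      next
        case ne: False
        have z: "W p q = 0 \<and> W q p = 0" if "p = (a, b) \<or> p = (b, a)" "q = (c, d) \<or> q = (d, c)" for p q
        proof -
          have W0: "W (i, j) (l, m) = 0"
            if "i < n" "j < n" "l < n" "m < n" "\<not> (i = m \<and> j = l)" "\<not> (i = l \<and> j = m)" for i j l m
            by (subst W[OF that(1-4)]) (simp only: that(5,6) if_False mult_zero_right add_0_right of_real_0)
          have bnd: "a < n" "b < n" "c < n" "d < n" using a c by auto
          have "\<not> (a = d \<and> b = c)" "\<not> (a = c \<and> b = d)" "\<not> (b = d \<and> a = c)" "\<not> (b = c \<and> a = d)"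
            "\<not> (d = a \<and> c = b)" "\<not> (c = a \<and> d = b)" "\<not> (d = b \<and> c = a)" "\<not> (c = b \<and> d = a)"
            using ne a(2) c(2) by auto
          note W0s = W0[OF bnd(1,2,3,4) this(1,2)] W0[OF bnd(1,2,4,3) this(2,1)]
            W0[OF bnd(2,1,3,4) this(3,4)] W0[OF bnd(2,1,4,3) this(4,3)]
            W0[OF bnd(3,4,1,2) this(8,6)] W0[OF bnd(3,4,2,1) this(6,8)]
            W0[OF bnd(4,3,1,2) this(7,5)] W0[OF bnd(4,3,2,1) this(5,7)]
          show ?thesis using that by (elim disjE) (simp_all only: W0s simp_thms)
        qed
        have "root_comb \<alpha> (\<lambda>p. root_comb \<beta> (\<lambda>q. W p q)) = 0"
          "root_comb \<beta> (\<lambda>p. root_comb \<alpha> (\<lambda>q. W p q)) = 0"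
          by (intro root_comb_eq_0; simp add: a(1) c(1) z)+
        then show ?thesis using False by simp
      qed
    qed
  qed
  finally show ?thesis .
qed

subsection \<open>Linear differential equations with constant coefficients\<close>

text \<open>The exponential series of the matrix \<open>a\<close>: \<open>it k\<close> is its
  \<open>k\<close>-th power applied to \<open>f\<close>, and \<open>L\<close> bounds every row sum,
  so the series is dominated by that of \<open>B * exp (L * cmod z)\<close>. The complex variable
  gives access to termwise differentiation of power series.\<close>

lemma linear_ode:
  fixes a :: "'i \<Rightarrow> 'i \<Rightarrow> complex" and f :: "'i \<Rightarrow> complex"
  assumes "finite S"
  obtains u :: "real \<Rightarrow> 'i \<Rightarrow> complex" where "\<And>i. i \<in> S \<Longrightarrow> u 0 i = f i"
    "\<And>t i. i \<in> S \<Longrightarrow> ((\<lambda>s. u s i) has_vector_derivative (\<Sum>j\<in>S. a i j * u t j)) (at t)"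
proof -
  define it where "it = rec_nat f (\<lambda>k g i. \<Sum>j\<in>S. a i j * g j)"
  have it: "it 0 = f" "\<And>k i. it (Suc k) i = (\<Sum>j\<in>S. a i j * it k j)"
    unfolding it_def nat.rec by (rule refl)+
  define L where "L = (\<Sum>i\<in>S. \<Sum>j\<in>S. cmod (a i j))"
  define B where "B = (\<Sum>i\<in>S. cmod (f i))"
  have L: "(\<Sum>j\<in>S. cmod (a i j)) \<le> L" if "i \<in> S" for i
    unfolding L_def using assms that
    by (intro member_le_sum[where f = "\<lambda>i. \<Sum>j\<in>S. cmod (a i j)"]) (auto intro: sum_nonneg)
  have L0: "0 \<le> L" unfolding L_def by (intro sum_nonneg) auto
  have B0: "0 \<le> B" unfolding B_def by (intro sum_nonneg) auto
  have bound: "cmod (it k i) \<le> L ^ k * B" if "i \<in> S" for k i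
    using that
  proof (induction k arbitrary: i)
    case 0
    then show ?case
      using assms member_le_sum[of i S "\<lambda>i. cmod (f i)"] by (simp add: it B_def)
  next
    case (Suc k)
    have "cmod (it (Suc k) i) \<le> (\<Sum>j\<in>S. cmod (a i j) * (L ^ k * B))"
      unfolding it using Suc.IH by (intro sum_norm_le) (simp add: norm_mult mult_left_mono)
    also have "\<dots> \<le> L * (L ^ k * B)"
      unfolding sum_distrib_right[symmetric] using L[OF Suc.prems] L0 B0 by (intro mult_right_mono) auto
    finally show ?case by (simp add: mult.assoc)
  qed
  define c where "c i k = it k i / fact k" for i k
  define v where "v z i = (\<Sum>k. c i k * z ^ k)" for z :: complex and i
  have summ: "summable (\<lambda>k. c i k * z ^ k)" if "i \<in> S" for i z
  proof (rule summable_comparison_test')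
    show "summable (\<lambda>k. B * ((L * cmod z) ^ k /\<^sub>R fact k))"
      by (intro summable_mult summable_exp_generic)
    fix k :: nat
    have "cmod (c i k * z ^ k) = cmod (it k i) * cmod z ^ k / fact k"
      by (simp add: c_def norm_mult norm_divide norm_power)
    also have "\<dots> \<le> (L ^ k * B) * cmod z ^ k / fact k"
      using bound[OF that] by (intro divide_right_mono mult_right_mono) auto
    finally show "norm (c i k * z ^ k) \<le> B * ((L * cmod z) ^ k /\<^sub>R fact k)"
      by (simp add: power_mult_distrib divide_simps ac_simps)
  qed
  have der: "((\<lambda>z. v z i) has_field_derivative (\<Sum>j\<in>S. a i j * v z j)) (at z)" if i: "i \<in> S" for i z
  proof -
    have "((\<lambda>z. v z i) has_field_derivative (\<Sum>k. diffs (c i) k * z ^ k)) (at z)"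
      unfolding v_def by (rule termdiffs_strong_converges_everywhere) (rule summ[OF i])
    also have "diffs (c i) k = (\<Sum>j\<in>S. a i j * c j k)" for k
    proof -
      have "diffs (c i) k = it (Suc k) i / fact k"
        by (simp add: diffs_def c_def field_simps del: of_nat_Suc)
      then show ?thesis by (simp add: it c_def sum_divide_distrib)
    qed
    then have "(\<Sum>k. diffs (c i) k * z ^ k) = (\<Sum>k. \<Sum>j\<in>S. a i j * (c j k * z ^ k))"
      by (simp add: sum_distrib_right mult.assoc)
    also have "\<dots> = (\<Sum>j\<in>S. a i j * v z j)"
      unfolding v_def using summ by (subst suminf_sum) (auto simp: suminf_mult intro: summable_mult)
    finally show ?thesis .
  qed
  show ?thesis
  proof (rule that[of "\<lambda>t. v (of_real t)"])
    show "v (of_real 0) i = f i" for i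
    proof -
      have "v 0 i = c i 0" unfolding v_def by (rule powser_zero)
      then show ?thesis by (simp add: c_def it)
    qed
    show "((\<lambda>s. v (of_real s) i) has_vector_derivative (\<Sum>j\<in>S. a i j * v (of_real t) j)) (at t)"
      if "i \<in> S" for t i
      using der[OF that, of "of_real t"] by (rule has_vector_derivative_real_field)
  qed
qed

subsection \<open>Passive evolutions\<close>

definition sector :: "nat \<Rightarrow> nat \<Rightarrow> (nat \<Rightarrow> nat) set" where
  "sector n M = {m \<in> occupations n. deg n m = M}"

lemma finite_sector: "finite (sector n M)"
  by (rule finite_subset[OF _ finite_deg_le[of n M]]) (auto simp: sector_def)

text \<open>A hop removes one quantum and adds one, so its value at \<open>m\<close> reads a single
  coefficient \<open>m2\<close> of the same total degree.\<close>

lemma hop_cong_sector: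
  assumes "p \<in> idx n" "m \<in> sector n M" "\<And>m. m \<in> sector n M \<Longrightarrow> \<phi> m = \<psi> m"
  shows "hop p \<phi> m = hop p \<psi> m"
proof -
  obtain j k where p: "p = (j, k)" "j < n" "k < n" using assms(1) by auto
  show ?thesis
  proof (cases "m j")
    case 0
    then show ?thesis by (simp add: p hop_def creat_def)
  next
    case (Suc x)
    define m1 where "m1 = m(j := x)"
    define m2 where "m2 = m1(k := Suc (m1 k))"
    have "deg n m2 = M" "m2 \<in> occupations n"
      using deg_upd[OF p(2), of m x] deg_upd[OF p(3), of m1 "Suc (m1 k)"] Suc assms(2) p
      by (auto simp: m1_def m2_def sector_def upd_occupations)
    then have "\<phi> m2 = \<psi> m2" using assms(3) by (simp add: sector_def)
    moreover have "hop p \<xi> m = of_real (sqrt (real (m j))) * (of_real (sqrt (real (m1 k + 1))) * \<xi> m2)" for \<xi>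
      unfolding p hop_def creat_def annih_def fst_conv snd_conv using Suc by (simp add: m1_def m2_def)
    ultimately show ?thesis by simp
  qed
qed

lemma bilin_cong_sector:
  assumes "m \<in> sector n M" "\<And>m. m \<in> sector n M \<Longrightarrow> \<phi> m = \<psi> m"
  shows "bilin n A \<phi> m = bilin n A \<psi> m"
  unfolding bilin_def using hop_cong_sector[OF _ assms] by (intro sum.cong) auto

text \<open>On a sector the operator is a finite matrix with its values on unit vectors as entries;
  this is the form that \<open>linear_ode\<close> expects.\<close>

lemma bilin_kernel:
  assumes "m \<in> sector n M"
  shows "bilin n A \<psi> m = (\<Sum>m'\<in>sector n M. bilin n A (\<lambda>x. if x = m' then 1 else 0) m * \<psi> m')"
proof -
  have "bilin n A \<psi> m = bilin n A (\<lambda>x. \<Sum>m'\<in>sector n M. \<psi> m' * (if x = m' then 1 else 0)) m"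
  proof (rule bilin_cong_sector[OF assms])
    fix x assume "x \<in> sector n M"
    then show "\<psi> x = (\<Sum>m'\<in>sector n M. \<psi> m' * (if x = m' then 1 else 0))"
      by (simp add: finite_sector if_distrib[of "\<lambda>x. _ * x"] cong: if_cong)
  qed
  also have "\<dots> = (\<Sum>m'\<in>sector n M. \<psi> m' * bilin n A (\<lambda>x. if x = m' then 1 else 0) m)"
    unfolding bilin_def hop_sum hop_cmult sum_distrib_left
    by (subst sum.swap) (simp add: ac_simps)
  finally show ?thesis by (simp add: mult.commute)
qed

lemma ip_sectors:
  assumes "l2 \<phi>" "l2 \<psi>" "\<And>m. m \<notin> occupations n \<Longrightarrow> \<phi> m = 0"
  shows "ip \<phi> \<psi> = (\<Sum>\<^sub>\<infinity>M. \<Sum>m\<in>sector n M. cnj (\<phi> m) * \<psi> m)"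
proof -
  define g where "g m = cnj (\<phi> m) * \<psi> m" for m
  have bij: "bij_betw snd (Sigma UNIV (sector n)) (occupations n)"
    by (rule bij_betwI[where g = "\<lambda>m. (deg n m, m)"]) (auto simp: sector_def)
  have "g summable_on occupations n"
    using summable_on_subset_banach[OF summable_cnj_mult[OF assms(1,2)], of "occupations n"]
    by (simp add: g_def[abs_def])
  then have s: "(\<lambda>x. g (snd x)) summable_on Sigma UNIV (sector n)"
    using summable_on_reindex_bij_betw[OF bij, of g] by simp
  have "ip \<phi> \<psi> = infsum g (occupations n)"
    unfolding ip_def by (rule infsum_cong_neutral) (auto simp: g_def assms(3))
  also have "\<dots> = (\<Sum>\<^sub>\<infinity>x\<in>Sigma UNIV (sector n). g (snd x))"
    using infsum_reindex_bij_betw[OF bij, of g] by simp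
  also have "\<dots> = (\<Sum>\<^sub>\<infinity>M. \<Sum>\<^sub>\<infinity>m\<in>sector n M. g m)"
    using infsum_Sigma_banach[OF s] by simp
  finally show ?thesis by (simp add: finite_sector g_def)
qed

lemma ip_hop: "ip \<phi> (hop p \<psi>) = ip (hop (prod.swap p) \<phi>) \<psi>"
  by (simp add: hop_def ip_creat ip_annih)

lemma hop_deriv:
  assumes "\<And>m. ((\<lambda>s. u s m) has_vector_derivative v m) F"
  shows "((\<lambda>s. hop p (u s) m) has_vector_derivative hop p v m) F"
  unfolding hop_def by (intro creat_deriv annih_deriv assms)

text \<open>\<open>prod.swap\<close> transposes, so \<open>G\<close> is anti-Hermitian; it stands
  for \<open>- \<i>\<close> times a Hermitian matrix.\<close>

locale passive_generator =
  fixes n :: nat and G :: "nat \<times> nat \<Rightarrow> complex"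
  assumes anti: "p \<in> idx n \<Longrightarrow> cnj (G (prod.swap p)) = - G p"
begin

lemma bilin_adjoint:
  assumes "decaying n {\<phi>} (\<lambda>\<psi>. \<psi>)" "decaying n {\<psi>} (\<lambda>\<psi>. \<psi>)"
  shows "ip \<phi> (bilin n G \<psi>) = - ip (bilin n G \<phi>) \<psi>"
proof -
  have l2: "l2 \<phi>" "l2 \<psi>" using decaying_l2[OF assms(1)] decaying_l2[OF assms(2)] by auto
  have l2h: "l2 (hop p \<psi>)" "l2 (hop p \<phi>)" if "p \<in> idx n" for p
    using decaying_l2[OF decaying_hop[OF assms(1) that]] decaying_l2[OF decaying_hop[OF assms(2) that]] by auto
  have "ip \<phi> (bilin n G \<psi>) = (\<Sum>p\<in>idx n. G p * ip \<phi> (hop p \<psi>))"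
    unfolding bilin_def ip_cmult[symmetric] by (rule ip_sum[OF l2(1)]) (intro l2_cmult l2h)
  also have "\<dots> = (\<Sum>p\<in>idx n. - cnj (G (prod.swap p)) * ip (hop (prod.swap p) \<phi>) \<psi>)"
    using anti by (intro sum.cong) (auto simp: ip_hop)
  also have "\<dots> = (\<Sum>p\<in>idx n. - cnj (G p) * ip (hop p \<phi>) \<psi>)"
    by (rule sum.reindex_bij_witness[of _ prod.swap prod.swap]) auto
  also have "\<dots> = - cnj (\<Sum>p\<in>idx n. G p * ip \<psi> (hop p \<phi>))"
    by (simp add: cnj_ip sum_negf)
  also have "(\<Sum>p\<in>idx n. G p * ip \<psi> (hop p \<phi>)) = ip \<psi> (bilin n G \<phi>)"
    unfolding bilin_def ip_cmult[symmetric] by (rule ip_sum[OF l2(2), symmetric]) (intro l2_cmult l2h)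
  finally show ?thesis by (simp add: cnj_ip)
qed

sublocale skew_generator n "bilin n G"
proof
  show "decaying n \<Psi> (bilin n G)" if "decaying n \<Psi> (\<lambda>\<psi>. \<psi>)" for \<Psi>
    using decaying_bilin[OF that] by simp
  show "((\<lambda>s. bilin n G (u s) m) has_vector_derivative bilin n G v m) F"
    if "\<And>m. ((\<lambda>s. u s m) has_vector_derivative v m) F" for u v F m
    unfolding bilin_def
    by (intro has_vector_derivative_sum has_vector_derivative_mult_right hop_deriv that)
  show "Re (ip \<xi> (bilin n G \<xi>)) = 0" if "\<xi> \<in> finite_fock n" for \<xi>
  proof -
    have "ip \<xi> (bilin n G \<xi>) = - cnj (ip \<xi> (bilin n G \<xi>))"
      using bilin_adjoint[OF finite_fock_decaying finite_fock_decaying, OF that that] by (simp add: cnj_ip)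
    then have "Re (ip \<xi> (bilin n G \<xi>)) = Re (- cnj (ip \<xi> (bilin n G \<xi>)))" by (rule arg_cong)
    then show ?thesis by simp
  qed
qed (simp_all add: bilin_add bilin_cmult)

text \<open>A purely coefficientwise equation without norm control, so that vectors transported by
  unbounded operators satisfy it too, with no growth estimates in time.\<close>

definition solves :: "(real \<Rightarrow> fvec) \<Rightarrow> bool" where
  "solves u \<longleftrightarrow> (\<forall>t m. ((\<lambda>s. u s m) has_vector_derivative bilin n G (u t) m) (at t))"

text \<open>Cutting to a sector yields finite vectors, on which \<open>bilin n G\<close> is skew,
  and inside the sector the cut does not change the action of \<open>bilin n G\<close>. The
  derivative of the finite sum therefore vanishes.\<close>

lemma sector_ip_conserved:
  assumes u: "solves u" and w: "solves w"
  shows "(\<Sum>m\<in>sector n M. cnj (u t m) * w t m) = (\<Sum>m\<in>sector n M. cnj (u 0 m) * w 0 m)"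
proof -
  define S where "S = sector n M"
  define P where "P \<psi> m = (if m \<in> S then \<psi> m else 0 :: complex)" for \<psi> m
  have fin: "finite S" by (simp add: S_def finite_sector)
  have P: "P \<psi> \<in> finite_fock n" for \<psi>
  proof -
    have "{m. P \<psi> m \<noteq> 0} \<subseteq> S" by (auto simp: P_def)
    moreover have "(\<lambda>m. (cmod (P \<psi> m))\<^sup>2) summable_on UNIV"
      using summable_on_finite[OF fin, of "\<lambda>m. (cmod (P \<psi> m))\<^sup>2"]
      by (rule summable_on_cong_neutral[THEN iffD1, rotated -1]) (auto simp: P_def)
    ultimately show ?thesis
      using fin by (auto simp: finite_fock_def fock_def P_def S_def sector_def intro: finite_subset)
  qed
  have ip: "ip (P \<phi>) \<psi> = (\<Sum>m\<in>S. cnj (\<phi> m) * \<psi> m)" for \<phi> \<psi>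
  proof -
    have "ip (P \<phi>) \<psi> = (\<Sum>\<^sub>\<infinity>m\<in>S. cnj (\<phi> m) * \<psi> m)"
      unfolding ip_def by (rule infsum_cong_neutral) (auto simp: P_def)
    then show ?thesis using fin by simp
  qed
  have loc: "bilin n G (P \<psi>) m = bilin n G \<psi> m" if "m \<in> S" for \<psi> m
    using that by (intro bilin_cong_sector[of m n M]) (auto simp: S_def P_def)
  have "((\<lambda>s. \<Sum>m\<in>S. cnj (u s m) * w s m) has_vector_derivative 0) (at t)" for t
  proof -
    have "((\<lambda>s. \<Sum>m\<in>S. cnj (u s m) * w s m) has_vector_derivative
        (\<Sum>m\<in>S. cnj (u t m) * bilin n G (w t) m + cnj (bilin n G (u t) m) * w t m)) (at t)"
      using u w unfolding solves_def
      by (intro has_vector_derivative_sum has_vector_derivative_mult has_vector_derivative_cnj) auto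
    also have "(\<Sum>m\<in>S. cnj (u t m) * bilin n G (w t) m + cnj (bilin n G (u t) m) * w t m)
      = (\<Sum>m\<in>S. cnj (u t m) * bilin n G (P (w t)) m) + cnj (\<Sum>m\<in>S. cnj (w t m) * bilin n G (P (u t)) m)"
      by (simp add: sum.distrib loc mult.commute)
    also have "\<dots> = ip (P (u t)) (bilin n G (P (w t))) + cnj (ip (P (w t)) (bilin n G (P (u t))))"
      by (simp only: ip)
    also have "\<dots> = 0"
      using bilin_adjoint[OF finite_fock_decaying finite_fock_decaying, OF P P, of "u t" "w t"] by (simp add: cnj_ip)
    finally show ?thesis .
  qed
  then show ?thesis
    using vector_derivative_bound[of UNIV "\<lambda>s. \<Sum>m\<in>S. cnj (u s m) * w s m" "\<lambda>_. 0" 0 t 0]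
    by (simp add: S_def)
qed

lemma ip_conserved:
  assumes "solves u" "solves w" "u 0 \<in> fock n" "u 1 \<in> fock n" "l2 (w 0)" "l2 (w 1)"
  shows "ip (u 1) (w 1) = ip (u 0) (w 0)"
proof -
  have "ip (u t) (w t) = (\<Sum>\<^sub>\<infinity>M. \<Sum>m\<in>sector n M. cnj (u 0 m) * w 0 m)"
    if "u t \<in> fock n" "l2 (w t)" for t
    unfolding sector_ip_conserved[OF assms(1,2), symmetric, of _ t]
    by (rule ip_sectors[OF fock_l2[OF that(1)] that(2)]) (use that(1) in \<open>simp add: fock_def\<close>)
  from this[OF assms(3,5)] this[OF assms(4,6)] show ?thesis by simp
qed

text \<open>The sectorwise solutions are glued along the degree. Their decay follows from
  conservation of the sector norm: a coefficient of degree \<open>M\<close> never exceeds the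
  initial norm of its sector, and this is of order \<open>sqrt q ^ M\<close>, uniformly in
  time.\<close>

lemma solution_exists:
  assumes "decaying n {\<psi>} (\<lambda>\<psi>. \<psi>)"
  obtains u where "solves u" "u 0 = \<psi>" "decaying n {0..1} u"
proof -
  have "\<exists>v. (\<forall>m\<in>sector n M. v 0 m = \<psi> m) \<and> (\<forall>t. \<forall>m\<in>sector n M.
      ((\<lambda>s. v s m) has_vector_derivative bilin n G (v t) m) (at t))" for M
  proof -
    obtain v where "\<And>m. m \<in> sector n M \<Longrightarrow> v 0 m = \<psi> m"
      "\<And>t m. m \<in> sector n M \<Longrightarrow> ((\<lambda>s. v s m) has_vector_derivative
        (\<Sum>m'\<in>sector n M. bilin n G (\<lambda>x. if x = m' then 1 else 0) m * v t m')) (at t)"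
      using linear_ode[OF finite_sector[of n M], of \<psi>
          "\<lambda>m m'. bilin n G (\<lambda>x. if x = m' then 1 else 0) m"]
      by blast
    then show ?thesis by (intro exI[of _ v]) (simp add: bilin_kernel[symmetric])
  qed
  then obtain v where v0: "\<And>M m. m \<in> sector n M \<Longrightarrow> v M 0 m = \<psi> m"
    and v: "\<And>M t m. m \<in> sector n M \<Longrightarrow>
      ((\<lambda>s. v M s m) has_vector_derivative bilin n G (v M t) m) (at t)"
    by metis
  define u where "u t m = (if m \<in> occupations n then v (deg n m) t m else 0)" for t m
  have u0: "u 0 = \<psi>"
  proof
    fix m show "u 0 m = \<psi> m"
      using v0[of m "deg n m"] decaying_fock[OF assms, of \<psi>] by (auto simp: u_def sector_def fock_def)
  qed
  have zero: "bilin n G \<phi> m = 0" if "m \<notin> occupations n" "\<And>m. m \<notin> occupations n \<Longrightarrow> \<phi> m = 0" for \<phi> m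
    unfolding bilin_def
  proof (rule sum.neutral, rule ballI)
    fix p assume "p \<in> idx n"
    then show "G p * hop p \<phi> m = 0"
      using that by (auto simp: hop_def creat_def annih_def upd_occupations)
  qed
  have sol: "solves u"
    unfolding solves_def
  proof safe
    fix t m
    show "((\<lambda>s. u s m) has_vector_derivative bilin n G (u t) m) (at t)"
    proof (cases "m \<in> occupations n")
      case True
      then have m: "m \<in> sector n (deg n m)" by (simp add: sector_def)
      have "bilin n G (u t) m = bilin n G (v (deg n m) t) m"
        by (rule bilin_cong_sector[OF m]) (auto simp: u_def sector_def)
      then show ?thesis using v[OF m] True by (simp add: u_def)
    next
      case False
      then have "bilin n G (u t) m = 0" by (rule zero) (simp add: u_def)
      then show ?thesis using False by (simp add: u_def)
    qed
  qed
  obtain C q where q: "0 < q" "q < 1" and dec: "decays n C q \<psi>"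
    using assms by (auto simp: decaying_def)
  have C: "0 \<le> C" using decays_nonneg[OF dec q(1)] .
  define Z where "Z = (\<Sum>\<^sub>\<infinity>m\<in>occupations n. q ^ deg n m)"
  have "decays n (C * sqrt Z) (sqrt q) (u t)" for t
    unfolding decays_def
  proof safe
    fix m
    show "cmod (u t m) \<le> C * sqrt Z * sqrt q ^ deg n m"
    proof (cases "m \<in> occupations n")
      case True
      define M where "M = deg n m"
      have m: "m \<in> sector n M" using True by (simp add: sector_def M_def)
      have sq: "cnj z * z = of_real ((cmod z)\<^sup>2)" for z
        using complex_norm_square[of z] by (simp add: mult.commute)
      have "complex_of_real (\<Sum>m\<in>sector n M. (cmod (u t m))\<^sup>2) = of_real (\<Sum>m\<in>sector n M. (cmod (\<psi> m))\<^sup>2)"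
        using sector_ip_conserved[OF sol sol, where t = t and M = M] by (simp only: sq u0 of_real_sum)
      then have cons: "(\<Sum>m\<in>sector n M. (cmod (u t m))\<^sup>2) = (\<Sum>m\<in>sector n M. (cmod (\<psi> m))\<^sup>2)"
        by (simp only: of_real_eq_iff)
      have "(cmod (u t m))\<^sup>2 \<le> (\<Sum>m\<in>sector n M. (cmod (u t m))\<^sup>2)"
        using m finite_sector by (intro member_le_sum[where f = "\<lambda>m. (cmod (u t m))\<^sup>2"]) auto
      \<comment> \<open>Of the two factors \<open>q ^ M\<close> in the squared bound one is kept as
        decay; the other is summed to at most \<open>Z\<close>, which accounts for the number of
        patterns in the sector.\<close>
      also have "\<dots> \<le> (\<Sum>m\<in>sector n M. C\<^sup>2 * q ^ M * q ^ deg n m)"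
        unfolding cons
      proof (rule sum_mono)
        fix m assume "m \<in> sector n M"
        moreover have "(cmod (\<psi> m))\<^sup>2 \<le> (C * q ^ deg n m)\<^sup>2"
          using dec by (intro power_mono) (auto simp: decays_def)
        ultimately show "(cmod (\<psi> m))\<^sup>2 \<le> C\<^sup>2 * q ^ M * q ^ deg n m"
          by (simp add: sector_def power2_eq_square ac_simps)
      qed
      also have "\<dots> = C\<^sup>2 * q ^ M * (\<Sum>m\<in>sector n M. q ^ deg n m)"
        by (simp add: sum_distrib_left)
      also have "\<dots> \<le> C\<^sup>2 * q ^ M * Z"
        unfolding Z_def using q summable_geometric_deg[of q n]
        by (intro mult_left_mono finite_sum_le_infsum finite_sector) (auto simp: sector_def)
      also have "\<dots> = (C * sqrt Z * sqrt q ^ M)\<^sup>2"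
      proof -
        have "0 \<le> Z" unfolding Z_def using q by (intro infsum_nonneg) auto
        moreover have "(sqrt q ^ M)\<^sup>2 = q ^ M"
          using q by (metis less_eq_real_def power_commutes power_even_eq power_mult real_sqrt_pow2)
        ultimately show ?thesis by (simp add: power_mult_distrib ac_simps)
      qed
      finally show ?thesis
        unfolding M_def[symmetric] using C q
        by (rule_tac power2_le_imp_le) (auto simp: Z_def intro!: mult_nonneg_nonneg infsum_nonneg)
    next
      case False
      then show ?thesis using C q by (auto simp: u_def Z_def intro!: mult_nonneg_nonneg infsum_nonneg)
    qed
  qed (simp add: u_def)
  moreover have "0 < sqrt q" "sqrt q < 1" using q by (auto simp: real_sqrt_lt_1_iff)
  ultimately have "decaying n {0..1} u" unfolding decaying_def by blast
  with sol u0 show ?thesis by (rule that)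
qed

end

subsection \<open>Heisenberg picture\<close>

text \<open>Matrices are functions on index pairs here, so that entrywise derivatives and
  \<open>linear_ode\<close> apply to them directly.\<close>

definition mmul :: "nat \<Rightarrow> (nat \<times> nat \<Rightarrow> complex) \<Rightarrow> (nat \<times> nat \<Rightarrow> complex) \<Rightarrow> nat \<times> nat \<Rightarrow> complex" where
  "mmul n A B p = (\<Sum>l<n. A (fst p, l) * B (l, snd p))"

definition comm :: "nat \<Rightarrow> (nat \<times> nat \<Rightarrow> complex) \<Rightarrow> (nat \<times> nat \<Rightarrow> complex) \<Rightarrow> nat \<times> nat \<Rightarrow> complex" where
  "comm n A B p = mmul n A B p - mmul n B A p"

text \<open>The trace of the product \<open>A B\<close>, bilinear over the complex numbers; on
  Hermitian matrices it is the invariant inner product.\<close>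

definition tr2 :: "nat \<Rightarrow> (nat \<times> nat \<Rightarrow> complex) \<Rightarrow> (nat \<times> nat \<Rightarrow> complex) \<Rightarrow> complex" where
  "tr2 n A B = (\<Sum>p\<in>idx n. A p * B (prod.swap p))"

lemma sum_idx: "(\<Sum>p\<in>idx n. f p) = (\<Sum>j<n. \<Sum>k<n. f (j, k))"
  by (simp add: sum.cartesian_product)

text \<open>Normal ordering: one commutation in the middle leaves a normally ordered quartic term
  and a single contraction, which is the matrix product.\<close>

lemma bilin_comp:
  "bilin n A (bilin n B \<psi>) m =
    (\<Sum>p\<in>idx n. \<Sum>q\<in>idx n. A p * B q * creat (fst p) (creat (fst q) (annih (snd p) (annih (snd q) \<psi>))) m)
    + bilin n (mmul n A B) \<psi> m"
proof -
  have hh: "hop p (hop q \<psi>) m = creat (fst p) (creat (fst q) (annih (snd p) (annih (snd q) \<psi>))) m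
      + (if snd p = fst q then 1 else 0) * hop (fst p, snd q) \<psi> m" for p q
    unfolding hop_def annih_creat[of "snd p"] creat_add creat_cmult by simp
  have "(\<Sum>p\<in>idx n. \<Sum>q\<in>idx n. A p * B q * ((if snd p = fst q then 1 else 0) * hop (fst p, snd q) \<psi> m))
      = (\<Sum>j<n. \<Sum>l<n. \<Sum>l'<n. \<Sum>k<n. if l = l' then A (j, l) * B (l', k) * hop (j, k) \<psi> m else 0)"
    unfolding sum_idx by (intro sum.cong refl) simp
  also have "\<dots> = (\<Sum>j<n. \<Sum>l<n. \<Sum>k<n. A (j, l) * B (l, k) * hop (j, k) \<psi> m)"
    by (rule sum.cong[OF refl], rule sum.cong[OF refl], subst sum.swap) simp
  also have "\<dots> = (\<Sum>j<n. \<Sum>k<n. \<Sum>l<n. A (j, l) * B (l, k) * hop (j, k) \<psi> m)"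
    by (intro sum.cong refl sum.swap)
  also have "\<dots> = bilin n (mmul n A B) \<psi> m"
    by (simp add: bilin_def mmul_def sum_idx sum_distrib_right)
  finally show ?thesis
    by (simp add: bilin_bilin hh distrib_left sum.distrib mult.assoc)
qed

text \<open>The normally ordered quartic terms agree for both orders, so only the difference of the
  contractions survives.\<close>

lemma bilin_comm: "bilin n G (bilin n A \<psi>) m = bilin n A (bilin n G \<psi>) m + bilin n (comm n G A) \<psi> m"
proof -
  have "(\<Sum>p\<in>idx n. \<Sum>q\<in>idx n. G p * A q * creat (fst p) (creat (fst q) (annih (snd p) (annih (snd q) \<psi>))) m)
      = (\<Sum>p\<in>idx n. \<Sum>q\<in>idx n. A p * G q * creat (fst p) (creat (fst q) (annih (snd p) (annih (snd q) \<psi>))) m)"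
  proof (subst sum.swap, intro sum.cong refl)
    fix p q
    have "creat (fst q) (creat (fst p) (annih (snd q) (annih (snd p) \<psi>)))
        = creat (fst p) (creat (fst q) (annih (snd p) (annih (snd q) \<psi>)))"
      by (subst creat_commute, subst annih_commute) (rule refl)
    then show "G q * A p * creat (fst q) (creat (fst p) (annih (snd q) (annih (snd p) \<psi>))) m
        = A p * G q * creat (fst p) (creat (fst q) (annih (snd p) (annih (snd q) \<psi>))) m"
      by simp
  qed
  moreover have "bilin n (comm n G A) \<psi> m = bilin n (mmul n G A) \<psi> m - bilin n (mmul n A G) \<psi> m"
    by (simp add: bilin_def comm_def left_diff_distrib sum_subtractf)
  ultimately show ?thesis by (simp add: bilin_comp)
qed

text \<open>Invariance of the trace form under commutation with \<open>G\<close>: the middle terms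
  cancel and the outer ones agree by cyclicity.\<close>

lemma tr2_comm: "tr2 n (comm n G A) B + tr2 n A (comm n G B) = 0"
proof -
  define t where "t X Y Z = (\<Sum>j<n. \<Sum>k<n. \<Sum>l<n. X (j, k) * Y (k, l) * Z (l, j))"
    for X Y Z :: "nat \<times> nat \<Rightarrow> complex"
  have cyc: "t X Y Z = t Y Z X" for X Y Z
  proof -
    have "t X Y Z = (\<Sum>k<n. \<Sum>j<n. \<Sum>l<n. X (j, k) * Y (k, l) * Z (l, j))"
      unfolding t_def by (rule sum.swap)
    also have "\<dots> = (\<Sum>k<n. \<Sum>l<n. \<Sum>j<n. X (j, k) * Y (k, l) * Z (l, j))"
      by (intro sum.cong refl sum.swap)
    finally show ?thesis by (simp add: t_def ac_simps)
  qed
  have r: "tr2 n A (mmul n B C) = t A B C" for A B C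
    by (simp add: tr2_def mmul_def t_def sum_idx sum_distrib_left mult.assoc)
  have l: "tr2 n (mmul n A B) C = t A B C" for A B C
  proof -
    have "tr2 n (mmul n A B) C = (\<Sum>j<n. \<Sum>k<n. \<Sum>l<n. A (j, l) * B (l, k) * C (k, j))"
      by (simp add: tr2_def mmul_def sum_idx sum_distrib_right)
    also have "\<dots> = t A B C" unfolding t_def by (intro sum.cong refl sum.swap)
    finally show ?thesis .
  qed
  have "tr2 n (comm n G A) B = tr2 n (mmul n G A) B - tr2 n (mmul n A G) B"
    "tr2 n A (comm n G B) = tr2 n A (mmul n G B) - tr2 n A (mmul n B G)"
    by (simp_all add: tr2_def comm_def left_diff_distrib right_diff_distrib sum_subtractf)
  then have "tr2 n (comm n G A) B = t G A B - t A G B" "tr2 n A (comm n G B) = t A G B - t A B G"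
    by (simp_all only: l r)
  then show ?thesis using cyc[of G A B] by simp
qed

context passive_generator
begin

definition flow :: "(real \<Rightarrow> nat \<times> nat \<Rightarrow> complex) \<Rightarrow> bool" where
  "flow A \<longleftrightarrow> (\<forall>t. \<forall>p\<in>idx n. ((\<lambda>s. A s p) has_vector_derivative comm n G (A t) p) (at t))"

lemma flow_exists:
  obtains A where "flow A" "\<And>p. p \<in> idx n \<Longrightarrow> A 0 p = A0 p"
proof -
  \<comment> \<open>The matrix of the linear map taking \<open>B\<close> to
    \<open>comm n G B\<close>: multiplication from the left keeps the column, from the right it
    keeps the row.\<close>
  define a where "a p q = (if snd q = snd p then G (fst p, fst q) else 0)
    - (if fst q = fst p then G (snd q, snd p) else 0)" for p q :: "nat \<times> nat"
  have a: "(\<Sum>q\<in>idx n. a p q * B q) = comm n G B p" if p: "p \<in> idx n" for p B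
  proof -
    obtain j k where jk: "p = (j, k)" "j < n" "k < n" using p by auto
    have "(\<Sum>q\<in>idx n. a p q * B q) = (\<Sum>l<n. \<Sum>m<n. (if m = k then G (j, l) else 0) * B (l, m))
        - (\<Sum>l<n. \<Sum>m<n. (if l = j then G (m, k) else 0) * B (l, m))"
      by (simp add: sum_idx a_def jk sum_subtractf left_diff_distrib cong: if_cong)
    also have "(\<Sum>l<n. \<Sum>m<n. (if m = k then G (j, l) else 0) * B (l, m)) = mmul n G B p"
      using jk by (simp add: mmul_def if_distrib[of "\<lambda>x. x * _"] cong: if_cong)
    also have "(\<Sum>l<n. \<Sum>m<n. (if l = j then G (m, k) else 0) * B (l, m)) = mmul n B G p"
      using jk by (subst sum.swap, simp add: mmul_def if_distrib[of "\<lambda>x. x * _"] cong: if_cong)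
        (simp add: mult.commute)
    finally show ?thesis by (simp add: comm_def)
  qed
  have "finite (idx n)" by simp
  then obtain A where "\<And>p. p \<in> idx n \<Longrightarrow> A 0 p = A0 p"
    "\<And>t p. p \<in> idx n \<Longrightarrow> ((\<lambda>s. A s p) has_vector_derivative (\<Sum>q\<in>idx n. a p q * A t q)) (at t)"
    using linear_ode[of "idx n" A0 a] by blast
  then show ?thesis
    by (intro that[of A]) (simp_all only: flow_def a, blast)
qed

lemma flow_solves:
  assumes A: "flow A" and u: "solves u"
  shows "solves (\<lambda>t. bilin n (A t) (u t))"
  unfolding solves_def
proof safe
  fix t m
  have "((\<lambda>s. bilin n (A s) (u s) m) has_vector_derivative
      (\<Sum>p\<in>idx n. A t p * hop p (bilin n G (u t)) m + comm n G (A t) p * hop p (u t) m)) (at t)"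
    using A u unfolding flow_def solves_def bilin_def[of n "A _"]
    by (intro has_vector_derivative_sum has_vector_derivative_mult hop_deriv) auto
  also have "(\<Sum>p\<in>idx n. A t p * hop p (bilin n G (u t)) m + comm n G (A t) p * hop p (u t) m)
      = bilin n G (bilin n (A t) (u t)) m"
    by (subst bilin_comm) (simp add: bilin_def[of n "A t"] bilin_def[of n "comm n G (A t)"] sum.distrib)
  finally show "((\<lambda>s. bilin n (A s) (u s) m) has_vector_derivative bilin n G (bilin n (A t) (u t)) m) (at t)" .
qed

lemma tr2_conserved:
  assumes A: "flow A" and B: "flow B"
  shows "tr2 n (A t) (B t) = tr2 n (A 0) (B 0)"
proof -
  have "((\<lambda>s. tr2 n (A s) (B s)) has_vector_derivative 0) (at t)" for t
  proof -
    have "((\<lambda>s. tr2 n (A s) (B s)) has_vector_derivative (\<Sum>p\<in>idx n.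
        A t p * comm n G (B t) (prod.swap p) + comm n G (A t) p * B t (prod.swap p))) (at t)"
      using A B unfolding flow_def tr2_def
      by (intro has_vector_derivative_sum has_vector_derivative_mult) auto
    also have "(\<Sum>p\<in>idx n. A t p * comm n G (B t) (prod.swap p) + comm n G (A t) p * B t (prod.swap p)) = 0"
      using tr2_comm[of n G "A t" "B t"] by (simp add: tr2_def sum.distrib add.commute)
    finally show ?thesis .
  qed
  then show ?thesis
    using vector_derivative_bound[of UNIV "\<lambda>s. tr2 n (A s) (B s)" "\<lambda>_. 0" 0 t 0] by simp
qed

text \<open>\<open>flow_solves\<close> can be iterated, so the vector with both transported
  operators applied solves the same equation as \<open>u\<close>. Each of the three inner products
  in \<open>mcov\<close> is thus one of two solutions, square summable at both end times.\<close>

lemma mcov_conserved: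
  assumes u: "solves u" "decaying n {0..1} u" and A: "flow A" and B: "flow B"
  shows "mcov n (u 1) (A 1) (B 1) = mcov n (u 0) (A 0) (B 0)"
proof -
  have dec: "decaying n {t} u" if "t = 0 \<or> t = 1" for t
    using decaying_subset[OF u(2), of "{t}"] that by auto
  have fock: "u t \<in> fock n" if "t = 0 \<or> t = 1" for t
    using decaying_fock[OF dec[OF that]] by simp
  have l2: "l2 (bilin n (A t) (u t))" "l2 (bilin n (B t) (u t))" "l2 (bilin n (A t) (bilin n (B t) (u t)))"
    if "t = 0 \<or> t = 1" for t
    using decaying_l2[OF decaying_bilin[OF dec[OF that]], of t "A t"]
      decaying_l2[OF decaying_bilin[OF dec[OF that]], of t "B t"]
      decaying_l2[OF decaying_bilin[OF decaying_bilin[OF dec[OF that]]], of t "A t" "B t"] by auto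
  have "ip (u 1) (w 1) = ip (u 0) (w 0)" if "solves w" "l2 (w 0)" "l2 (w 1)" for w
    using ip_conserved[OF u(1) that(1) fock fock that(2,3)] by simp
  note c = this
  have "ip (u 1) (bilin n (A 1) (u 1)) = ip (u 0) (bilin n (A 0) (u 0))"
    using l2 by (intro c[of "\<lambda>t. bilin n (A t) (u t)"] flow_solves A u) auto
  moreover have "ip (u 1) (bilin n (B 1) (u 1)) = ip (u 0) (bilin n (B 0) (u 0))"
    using l2 by (intro c[of "\<lambda>t. bilin n (B t) (u t)"] flow_solves B u) auto
  moreover have "ip (u 1) (bilin n (A 1) (bilin n (B 1) (u 1))) = ip (u 0) (bilin n (A 0) (bilin n (B 0) (u 0)))"
    using l2 by (intro c[of "\<lambda>t. bilin n (A t) (bilin n (B t) (u t))"] flow_solves A B u) auto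
  ultimately show ?thesis by (simp add: mcov_def)
qed

lemma evolves_solution:
  assumes "solves u" "decaying n {0..1} u"
  shows "evolves n (bilin n G) (u 0) (u 1)"
  using assms strong_solutionI[OF assms(2)]
  unfolding evolves_def solves_def by (blast intro: has_vector_derivative_at_within)

end

subsection \<open>Invariance of the spectrum\<close>

lemma sum_list_triangle:
  fixes f :: "'b \<Rightarrow> complex"
  shows "sum_list (map f (concat (map (\<lambda>k. map (\<lambda>j. c j k) [0..<k]) [0..<n]))) = (\<Sum>k<n. \<Sum>j<k. f (c j k))"
proof (induction n)
  case (Suc n)
  have "sum_list (map f (map (\<lambda>j. c j n) [0..<n])) = (\<Sum>j<n. f (c j n))"
    by (simp add: o_def interv_sum_list_conv_sum_set_nat atLeast0LessThan)
  with Suc show ?case by simp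
qed simp

lemma sum_root_list:
  fixes f :: "root \<Rightarrow> complex"
  shows "(\<Sum>i<length (root_list n). f (root_list n ! i))
    = (\<Sum>j<n. f (Long j)) + (\<Sum>k<n. \<Sum>j<k. f (Minus j k) + f (Plus j k))"
proof -
  have "(\<Sum>i<length (root_list n). f (root_list n ! i)) = sum_list (map f (root_list n))"
    by (simp add: sum_list_sum_nth atLeast0LessThan)
  also have "\<dots> = (\<Sum>j<n. f (Long j)) + (\<Sum>k<n. \<Sum>j<k. f (Minus j k) + f (Plus j k))"
    unfolding root_list_def map_append sum_list_append sum_list_triangle
    by (simp add: o_def interv_sum_list_conv_sum_set_nat atLeast0LessThan sum.distrib)
  finally show ?thesis .
qed

lemma sum_idx_triangle:
  fixes f :: "nat \<times> nat \<Rightarrow> complex"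
  shows "(\<Sum>p\<in>idx n. f p) = (\<Sum>j<n. f (j, j)) + (\<Sum>k<n. \<Sum>j<k. f (j, k) + f (k, j))"
proof -
  have "(\<Sum>j<n. \<Sum>k<n. f (j, k)) = (\<Sum>j<n. f (j, j)) + (\<Sum>k<n. \<Sum>j<k. f (j, k) + f (k, j))"
    by (induction n) (simp_all add: sum.distrib)
  then show ?thesis by (simp only: sum_idx)
qed

text \<open>The generators span all complex matrices: the \<open>Minus\<close> and
  \<open>Plus\<close> terms of a pair together return its two off-diagonal entries. Transposing
  \<open>A\<close> in the coefficient makes that coefficient the trace form of \<open>A\<close> with
  the generator.\<close>

lemma root_completeness:
  "(\<Sum>p\<in>idx n. A p * X p) = (\<Sum>i<length (root_list n).
    root_comb (root_list n ! i) (\<lambda>p. A (prod.swap p)) * root_comb (root_list n ! i) X)"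
proof -
  have sqrt2: "1 / complex_of_real (sqrt 2) * (1 / complex_of_real (sqrt 2)) = 1 / 2"
    by (simp flip: of_real_mult)
  define s where "s = 1 / complex_of_real (sqrt 2)"
  have s: "s * s = 1 / 2" using sqrt2 by (simp only: s_def)
  have "root_comb (Minus j k) (\<lambda>p. A (prod.swap p)) * root_comb (Minus j k) X
      + root_comb (Plus j k) (\<lambda>p. A (prod.swap p)) * root_comb (Plus j k) X
      = A (j, k) * X (j, k) + A (k, j) * X (k, j)" for j k
  proof -
    have r: "root_comb (Minus j k) X = - \<i> * s * (X (j, k) - X (k, j))"
      "root_comb (Plus j k) X = s * (X (j, k) + X (k, j))" for X
      by (simp_all add: s_def)
    have "root_comb (Minus j k) (\<lambda>p. A (prod.swap p)) * root_comb (Minus j k) X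
      + root_comb (Plus j k) (\<lambda>p. A (prod.swap p)) * root_comb (Plus j k) X
      = (s * s) * ((A (k, j) + A (j, k)) * (X (j, k) + X (k, j)) - (A (k, j) - A (j, k)) * (X (j, k) - X (k, j)))"
      unfolding r by (simp add: algebra_simps)
    also have "\<dots> = A (j, k) * X (j, k) + A (k, j) * X (k, j)"
      unfolding s by (simp add: algebra_simps)
    finally show ?thesis .
  qed
  note pair = this
  show ?thesis
    unfolding sum_root_list[where f = "\<lambda>\<beta>. root_comb \<beta> (\<lambda>p. A (prod.swap p)) * root_comb \<beta> X"]
      sum_idx_triangle pair by simp
qed

lemma root_orthonormal:
  assumes "\<alpha> \<in> pos_roots n" "\<beta> \<in> pos_roots n"
  shows "tr2 n (root_mat \<alpha>) (root_mat \<beta>) = (if \<alpha> = \<beta> then 1 else 0)"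
proof -
  have sqrt2: "complex_of_real (sqrt 2) * complex_of_real (sqrt 2) = 2"
    by (simp flip: of_real_mult)
  have "tr2 n (root_mat \<alpha>) (root_mat \<beta>) = root_comb \<alpha> (\<lambda>p. root_mat \<beta> (prod.swap p))"
    by (simp add: tr2_def root_comb_sum[OF assms(1)])
  also have "\<dots> = (if \<alpha> = \<beta> then 1 else 0)"
    using assms by (cases \<alpha>; cases \<beta>) (auto simp: root_mat_def pos_roots_def sqrt2 field_simps)
  finally show ?thesis .
qed

lemma quadratic_bilin: "quadratic n h = bilin n (\<lambda>p. h $$ p)"
  by (auto simp: fun_eq_iff quadratic_def bilin_def sum_idx hop_def)

text \<open>Expanding the transported generators at time 1 in the original ones gives a matrix
  \<open>T\<close>. Conservation of covariances relates the two Fisher matrices through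
  \<open>T\<close>, and conservation of the trace form makes the transpose of \<open>T\<close> its
  inverse. The phase \<open>c\<close> drops out since every moment contains it once with its
  conjugate.\<close>

lemma passive_fisher_similar:
  assumes h: "h \<in> carrier_mat n n" "mat_adjoint h = h" and c: "cmod c = 1"
    and \<psi>: "decaying n {\<psi>} (\<lambda>\<psi>. \<psi>)" "fnorm \<psi> = 1"
    and \<phi>: "\<phi> = (\<lambda>m. c * op_exp n (\<lambda>\<phi> m. - \<i> * quadratic n h \<phi> m) \<psi> m)"
  shows "similar_mat (fisher_mat n \<phi>) (fisher_mat n \<psi>)"
proof -
  define G where "G p = - \<i> * h $$ p" for p
  have hswap: "cnj (h $$ (k, j)) = h $$ (j, k)" if "j < n" "k < n" for j k
  proof -
    have "mat_adjoint h $$ (j, k) = cnj (h $$ (k, j))"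
      using that h(1) by (auto simp: mat_adjoint_def mat_of_rows_def)
    then show ?thesis using h(2) by simp
  qed
  interpret passive_generator n G
    by unfold_locales (auto simp: G_def hswap)
  have K: "(\<lambda>\<phi> m. - \<i> * quadratic n h \<phi> m) = bilin n G"
    by (simp add: quadratic_bilin bilin_def G_def fun_eq_iff sum_distrib_left mult.assoc sum_negf)
  obtain u where u: "solves u" "u 0 = \<psi>" "decaying n {0..1} u"
    using solution_exists[OF \<psi>(1)] .
  have "op_exp n (bilin n G) \<psi> = u 1" "fnorm (u 1) = 1"
    using op_exp_eqI[OF evolves_solution[OF u(1,3)]] evolves_fnorm[OF evolves_solution[OF u(1,3)]] u(2) \<psi>(2) by auto
  then have \<phi>u: "\<phi> = (\<lambda>m. c * u 1 m)" and \<phi>1: "fnorm \<phi> = 1"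
    using \<phi> c unfolding K by (simp_all add: fnorm_cmult)
  have u1: "decaying n {u 1} (\<lambda>\<psi>. \<psi>)"
    using decaying_subset[OF u(3), of "{1}"] decaying_image[of n "{1}" "\<lambda>\<psi>. \<psi>" u] by simp
  have \<phi>d: "decaying n {\<phi>} (\<lambda>\<psi>. \<psi>)"
    using decaying_const_cmult[OF u1, of c] decaying_image[of n "{u 1}" "\<lambda>\<psi>. \<psi>" "\<lambda>\<psi> m. c * \<psi> m"]
    by (simp add: \<phi>u)
  have cc: "c * cnj c = 1" using c complex_norm_square[of c] by simp
  have mcov\<phi>: "mcov n \<phi> A B = mcov n (u 1) A B" for A B
    using cc by (simp add: mcov_def \<phi>u bilin_cmult ip_cmult ip_cmult_left) (simp add: mult.assoc[symmetric])
  define N where "N = length (root_list n)"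
  define rl where "rl i = root_list n ! i" for i
  have rl: "rl i \<in> pos_roots n" if "i < N" for i
    using that nth_mem[of i "root_list n"] by (simp add: N_def rl_def set_root_list)
  have rl_eq: "rl i = rl j \<longleftrightarrow> i = j" if "i < N" "j < N" for i j
    using that distinct_root_list by (auto simp: N_def rl_def nth_eq_iff_index_eq)
  have "\<exists>A. flow A \<and> (\<forall>p\<in>idx n. A 0 p = root_mat (rl i) p)" for i
    by (rule flow_exists[of "root_mat (rl i)"]) (intro exI conjI ballI, assumption, simp)
  then have "\<exists>A. \<forall>i. flow (A i) \<and> (\<forall>p\<in>idx n. A i 0 p = root_mat (rl i) p)"
    by (intro choice allI)
  then obtain A where A: "\<And>i. flow (A i)" "\<And>i p. p \<in> idx n \<Longrightarrow> A i 0 p = root_mat (rl i) p"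
    by blast
  define T where "T i k = root_comb (rl k) (\<lambda>p. A i 1 (prod.swap p))" for i k
  have exp: "(\<Sum>p\<in>idx n. A i 1 p * X p) = (\<Sum>k<N. T i k * root_comb (rl k) X)" for i X
    unfolding root_completeness T_def N_def rl_def ..
  have ortho: "(\<Sum>k<N. T i k * T j k) = (if i = j then 1 else 0)" if "i < N" "j < N" for i j
  proof -
    have "(\<Sum>k<N. T i k * T j k) = tr2 n (A i 1) (A j 1)"
      unfolding tr2_def exp by (simp add: T_def)
    also have "\<dots> = tr2 n (A i 0) (A j 0)" by (rule tr2_conserved[OF A(1) A(1)])
    also have "\<dots> = tr2 n (root_mat (rl i)) (root_mat (rl j))"
      unfolding tr2_def by (intro sum.cong refl) (auto simp: A(2))
    finally show ?thesis using root_orthonormal[OF rl rl, OF that] rl_eq[OF that] by simp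
  qed
  have mc: "mcov n \<psi> (root_mat (rl i)) (root_mat (rl j))
      = (\<Sum>k<N. T i k * (\<Sum>l<N. T j l * mcov n \<phi> (root_mat (rl k)) (root_mat (rl l))))" for i j
  proof -
    \<comment> \<open>By \<open>mcov_cov\<close> only entries on \<open>idx n\<close> enter, and
      there \<open>A i 0\<close> agrees with \<open>root_mat (rl i)\<close>.\<close>
    have "mcov n \<psi> (root_mat (rl i)) (root_mat (rl j)) = mcov n (u 0) (A i 0) (A j 0)"
      unfolding u(2) mcov_cov[OF \<psi>(1)] by (simp add: A(2))
    also have "\<dots> = mcov n \<phi> (A i 1) (A j 1)"
      unfolding mcov\<phi> by (rule mcov_conserved[OF u(1,3) A(1) A(1), symmetric])
    also have "\<dots> = (\<Sum>k<N. T i k * (\<Sum>l<N. T j l * root_comb (rl k) (\<lambda>p. root_comb (rl l) (cov \<phi> p))))"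
    proof -
      have lin: "root_comb \<alpha> (\<lambda>p. \<Sum>l<N. x l * Y l p) = (\<Sum>l<N. x l * root_comb \<alpha> (Y l))"
        for \<alpha> and x :: "nat \<Rightarrow> complex" and Y
        by (cases \<alpha>; simp only: root_comb.simps sum_subtractf[symmetric] sum.distrib[symmetric] sum_distrib_left;
            intro sum.cong refl; simp add: algebra_simps)
      show ?thesis unfolding mcov_cov[OF \<phi>d] exp lin ..
    qed
    also have "\<dots> = (\<Sum>k<N. T i k * (\<Sum>l<N. T j l * mcov n \<phi> (root_mat (rl k)) (root_mat (rl l))))"
      unfolding mcov_cov[OF \<phi>d] by (intro sum.cong refl) (simp add: root_comb_sum[where n = n] rl)
    finally show ?thesis .
  qed
  define TT where "TT = Matrix.mat N N (\<lambda>(i, k). T i k)"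
  have dims: "TT \<in> carrier_mat N N" "fisher_mat n \<psi> \<in> carrier_mat N N" "fisher_mat n \<phi> \<in> carrier_mat N N"
    by (auto simp: TT_def fisher_mat_def N_def)
  have one: "TT * transpose_mat TT = 1\<^sub>m N"
    by (rule eq_matI) (auto simp: TT_def scalar_prod_def ortho atLeast0LessThan)
  have fm: "fisher_mat n \<psi> = TT * fisher_mat n \<phi> * transpose_mat TT"
  proof (rule eq_matI)
    fix i j assume "i < dim_row (TT * fisher_mat n \<phi> * transpose_mat TT)"
      "j < dim_col (TT * fisher_mat n \<phi> * transpose_mat TT)"
    then have ij: "i < N" "j < N" by (auto simp: TT_def)
    have F: "fisher_mat n \<xi> $$ (k, l) = 2 * (mcov n \<xi> (root_mat (rl k)) (root_mat (rl l))
        + mcov n \<xi> (root_mat (rl l)) (root_mat (rl k)))"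
      if "decaying n {\<xi>} (\<lambda>\<psi>. \<psi>)" "fnorm \<xi> = 1" "k < N" "l < N" for \<xi> k l
      using fisher_mcov[OF that(1,2) rl rl, OF that(3,4)] that(3,4)
      by (simp add: fisher_mat_def N_def rl_def)
    have "fisher_mat n \<psi> $$ (i, j) = 2 * ((\<Sum>k<N. \<Sum>l<N. T i k * T j l * mcov n \<phi> (root_mat (rl k)) (root_mat (rl l)))
        + (\<Sum>k<N. \<Sum>l<N. T j k * T i l * mcov n \<phi> (root_mat (rl k)) (root_mat (rl l))))"
      unfolding F[OF \<psi> ij] mc by (simp add: sum_distrib_left mult.assoc)
    \<comment> \<open>Renaming \<open>k\<close> and \<open>l\<close> gives both orders the same
      coefficient \<open>T i k * T j l\<close>, so that the two covariances recombine to a Fisher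
      entry.\<close>
    also have "(\<Sum>k<N. \<Sum>l<N. T j k * T i l * mcov n \<phi> (root_mat (rl k)) (root_mat (rl l)))
        = (\<Sum>k<N. \<Sum>l<N. T i k * T j l * mcov n \<phi> (root_mat (rl l)) (root_mat (rl k)))"
      by (subst sum.swap) (simp add: ac_simps)
    also have "2 * ((\<Sum>k<N. \<Sum>l<N. T i k * T j l * mcov n \<phi> (root_mat (rl k)) (root_mat (rl l)))
        + (\<Sum>k<N. \<Sum>l<N. T i k * T j l * mcov n \<phi> (root_mat (rl l)) (root_mat (rl k))))
        = (\<Sum>k<N. \<Sum>l<N. T i k * T j l * fisher_mat n \<phi> $$ (k, l))"
      unfolding sum.distrib[symmetric] sum_distrib_left
      by (intro sum.cong refl) (simp add: F[OF \<phi>d \<phi>1] algebra_simps)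
    also have "\<dots> = (\<Sum>l<N. (\<Sum>k<N. T i k * fisher_mat n \<phi> $$ (k, l)) * T j l)"
      unfolding sum_distrib_right by (subst sum.swap) (simp add: ac_simps)
    also have "\<dots> = (TT * fisher_mat n \<phi> * transpose_mat TT) $$ (i, j)"
      using ij dims(3) by (simp add: TT_def scalar_prod_def atLeast0LessThan)
    finally show "fisher_mat n \<psi> $$ (i, j) = (TT * fisher_mat n \<phi> * transpose_mat TT) $$ (i, j)" .
  qed (auto simp: TT_def fisher_mat_def N_def)
  have "similar_mat_wit (fisher_mat n \<psi>) (fisher_mat n \<phi>) TT (transpose_mat TT)"
    using dims one fm mat_mult_left_right_inverse[OF dims(1) _ one]
    by (auto simp: similar_mat_wit_def)
  then show ?thesis
    using similar_mat_sym unfolding similar_mat_def by blast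
qed

subsection \<open>Maximizing the smallest weight\<close>

lemma finite_pos_roots: "finite (pos_roots n)"
  by (metis List.finite_set set_root_list)

text \<open>The common closed form of \<open>min_weight\<close> and \<open>min_eigenvalue\<close>,
  which reduces both optimizations to one.\<close>

definition min_root :: "nat \<Rightarrow> real Matrix.vec \<Rightarrow> real" where
  "min_root n r = Min ((\<lambda>\<alpha>. 2 * (sinh (root_val \<alpha> r))\<^sup>2) ` pos_roots n)"

lemma min_weight_probe: "min_weight n (probe n r) = min_root n r"
proof -
  have "(\<lambda>\<alpha>. Re (fisher (probe n r) \<alpha> \<alpha>)) ` pos_roots n = (\<lambda>\<alpha>. 2 * (sinh (root_val \<alpha> r))\<^sup>2) ` pos_roots n"
    by (rule image_cong) (auto simp: fisher_probe simp del: of_real_power of_real_mult)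
  then show ?thesis by (simp only: min_weight_def min_root_def)
qed

text \<open>The matrix is diagonal, in particular upper triangular, so its characteristic polynomial
  splits over the diagonal entries.\<close>

lemma spectrum_fisher_probe:
  "spectrum (fisher_mat n (probe n r)) = (\<lambda>\<alpha>. complex_of_real (2 * (sinh (root_val \<alpha> r))\<^sup>2)) ` pos_roots n"
proof -
  define N where "N = length (root_list n)"
  define F where "F = fisher_mat n (probe n r)"
  have F: "F \<in> carrier_mat N N" by (simp add: F_def fisher_mat_def N_def)
  have mem: "root_list n ! i \<in> pos_roots n" if "i < N" for i
    using that nth_mem[of i "root_list n"] by (simp add: N_def set_root_list)
  have ent: "F $$ (i, j) = (if i = j then complex_of_real (2 * (sinh (root_val (root_list n ! i) r))\<^sup>2) else 0)"
    if "i < N" "j < N" for i j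
    using fisher_probe[OF mem mem, OF that] that distinct_root_list[of n]
    by (simp add: F_def fisher_mat_def N_def nth_eq_iff_index_eq)
  have "upper_triangular F"
    using F by (intro upper_triangularI) (auto simp: ent)
  then have "char_poly F = (\<Prod>a\<leftarrow>diag_mat F. [:- a, 1:])"
    by (rule char_poly_upper_triangular[OF F])
  then have "spectrum F = set (diag_mat F)"
    using eigenvalue_root_char_poly[OF F] by (auto simp: spectrum_def poly_prod_list prod_list_zero_iff)
  also have "\<dots> = (\<lambda>i. complex_of_real (2 * (sinh (root_val (root_list n ! i) r))\<^sup>2)) ` {..<N}"
    using F by (auto simp: diag_mat_def ent atLeast0LessThan intro!: image_cong)
  also have "\<dots> = (\<lambda>\<alpha>. complex_of_real (2 * (sinh (root_val \<alpha> r))\<^sup>2)) ` (!) (root_list n) ` {..<N}"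
    by (simp add: image_image)
  also have "(!) (root_list n) ` {..<N} = pos_roots n"
    unfolding N_def set_root_list[symmetric] by (auto simp: set_conv_nth)
  finally show ?thesis by (simp only: F_def)
qed

lemma min_eigenvalue_probe: "min_eigenvalue (fisher_mat n (probe n r)) = min_root n r"
  unfolding min_eigenvalue_def spectrum_fisher_probe min_root_def image_image Re_complex_of_real ..

lemma passive_similar:
  assumes "passive_gaussian n U"
  shows "similar_mat (fisher_mat n (U (probe n r))) (fisher_mat n (probe n r))"
proof -
  have "probe n r \<in> fock n" using decaying_fock[OF probe_decaying] by simp
  then obtain h c where "h \<in> carrier_mat n n" "mat_adjoint h = h" "cmod c = 1"
    "U (probe n r) = (\<lambda>m. c * op_exp n (\<lambda>\<phi> m. - \<i> * quadratic n h \<phi> m) (probe n r) m)"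
    using assms unfolding passive_gaussian_def by blast
  then show ?thesis
    using passive_fisher_similar probe_decaying probe_eq(2) by blast
qed

lemma similar_spectrum:
  fixes A B :: "complex mat"
  assumes "similar_mat A B"
  shows "spectrum A = spectrum B"
proof -
  obtain m where "A \<in> carrier_mat m m" "B \<in> carrier_mat m m"
    using similar_matD[OF assms] by blast
  then show ?thesis
    using char_poly_similar[OF assms] by (auto simp: spectrum_def eigenvalue_root_char_poly)
qed

text \<open>On this ray every positive root is a multiple \<open>c * a\<close> with
  \<open>2 \<le> c\<close>, and the long root of the last mode attains \<open>c = 2\<close>.\<close>

lemma min_root_dual_weyl:
  assumes "n \<ge> 1" "0 < a"
  shows "min_root n (dual_weyl n a) = 2 * (sinh (2 * a))\<^sup>2"
  unfolding min_root_def
proof (rule Min_eqI)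
  have le: "2 * (sinh (2 * a))\<^sup>2 \<le> 2 * (sinh x)\<^sup>2" if "2 * a \<le> x" for x
    using that assms(2) by (intro mult_left_mono power_mono) auto
  have d: "dual_weyl n a $ j = (2 * real n - 2 * real j - 1) * a" if "j < n" for j
    using that by (simp add: dual_weyl_def)
  have root: "2 * a \<le> root_val \<alpha> (dual_weyl n a)" if "\<alpha> \<in> pos_roots n" for \<alpha>
  proof -
    have s: "2 * a \<le> x" if "x = c * a" "2 \<le> c" for x c :: real
      using that assms(2) by (auto intro: mult_right_mono)
    from that consider (1) j where "\<alpha> = Long j" "j < n" | (2) j k where "\<alpha> = Minus j k" "j < k" "k < n"
      | (3) j k where "\<alpha> = Plus j k" "j < k" "k < n"
      by (auto simp: pos_roots_def)
    then show ?thesis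
    proof cases
      case 1
      then have "2 \<le> 2 * (2 * real n - 2 * real j - 1)" by simp
      then show ?thesis by (rule s[rotated]) (use 1 in \<open>auto simp: d\<close>)
    next
      case 2
      then have "2 \<le> 2 * (real k - real j)" by simp
      then show ?thesis by (rule s[rotated]) (use 2 in \<open>auto simp: d algebra_simps\<close>)
    next
      case 3
      then have "2 \<le> 4 * real n - 2 * real j - 2 * real k - 2" by simp
      then show ?thesis by (rule s[rotated]) (use 3 in \<open>auto simp: d algebra_simps\<close>)
    qed
  qed
  show "2 * (sinh (2 * a))\<^sup>2 \<le> y"
    if "y \<in> (\<lambda>\<alpha>. 2 * (sinh (root_val \<alpha> (dual_weyl n a)))\<^sup>2) ` pos_roots n" for y
    using that le root by auto
  have "Long (n - 1) \<in> pos_roots n" using assms(1) by (auto simp: pos_roots_def)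
  moreover have "root_val (Long (n - 1)) (dual_weyl n a) = 2 * a"
    using assms(1) d[of "n - 1"] by (simp add: of_nat_diff)
  ultimately show "2 * (sinh (2 * a))\<^sup>2 \<in> (\<lambda>\<alpha>. 2 * (sinh (root_val \<alpha> (dual_weyl n a)))\<^sup>2) ` pos_roots n"
    by (intro image_eqI[where x = "Long (n - 1)"]) (simp_all only:)
qed (simp add: finite_pos_roots)

text \<open>The long root of the last mode bounds the last entry below by \<open>a\<close>, and each
  difference of neighbours adds at least \<open>2 * a\<close>. In the chamber these roots are
  nonnegative, so the square on \<open>sinh\<close> can be removed.\<close>

lemma min_root_dominates:
  assumes r: "r \<in> chamber n" and a: "0 < a" and le: "2 * (sinh (2 * a))\<^sup>2 \<le> min_root n r" and j: "j < n"
  shows "(2 * real n - 2 * real j - 1) * a \<le> r $ j"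
proof -
  have nonneg: "0 \<le> r $ j" if "j < n" for j using r that by (auto simp: chamber_def)
  have root: "2 * a \<le> root_val \<alpha> r" if "\<alpha> \<in> pos_roots n" "0 \<le> root_val \<alpha> r" for \<alpha>
  proof -
    have "min_root n r \<le> 2 * (sinh (root_val \<alpha> r))\<^sup>2"
      unfolding min_root_def using that(1) finite_pos_roots by (intro Min_le) auto
    with le have "(sinh (2 * a))\<^sup>2 \<le> (sinh (root_val \<alpha> r))\<^sup>2" by simp
    then have "sinh (2 * a) \<le> sinh (root_val \<alpha> r)"
      using that(2) by (rule_tac power2_le_imp_le) auto
    then show ?thesis by simp
  qed
  \<comment> \<open>The induction climbs from the smallest entry, so \<open>i\<close> counts modes
    from the end.\<close>
  have "\<forall>i<n. (2 * real i + 1) * a \<le> r $ (n - 1 - i)"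
  proof (intro allI impI)
    fix i assume "i < n"
    then show "(2 * real i + 1) * a \<le> r $ (n - 1 - i)"
    proof (induction i)
      case 0
      then have "Long (n - 1) \<in> pos_roots n" by (auto simp: pos_roots_def)
      from root[OF this] show ?case using nonneg[of "n - 1"] 0 by simp
    next
      case (Suc i)
      have "Minus (n - 1 - Suc i) (n - 1 - i) \<in> pos_roots n"
        using Suc.prems by (auto simp: pos_roots_def)
      moreover have "r $ (n - 1 - i) \<le> r $ (n - 1 - Suc i)"
        using r Suc.prems by (auto simp: chamber_def)
      ultimately have "2 * a \<le> r $ (n - 1 - Suc i) - r $ (n - 1 - i)"
        using root by fastforce
      moreover have "(2 * real i + 1) * a \<le> r $ (n - 1 - i)" using Suc by simp
      ultimately show ?case by (simp add: algebra_simps)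
    qed
  qed
  from this[rule_format, of "n - 1 - j"] j show ?thesis
    by (simp add: of_nat_diff algebra_simps)
qed

lemma dual_weyl_chamber:
  assumes "0 < a"
  shows "dual_weyl n a \<in> chamber n"
proof -
  have "(2 * real n - 2 * real k - 1) * a \<le> (2 * real n - 2 * real j - 1) * a" if "j \<le> k" for j k
    using that assms by (intro mult_right_mono) auto
  moreover have "0 \<le> (2 * real n - 2 * real j - 1) * a" if "j < n" for j
    using that assms by (intro mult_nonneg_nonneg) auto
  ultimately show ?thesis by (auto simp: chamber_def dual_weyl_def)
qed

lemma photon_number_dual_weyl:
  "photon_number n (dual_weyl n a) = (\<Sum>j<n. (sinh ((2 * real n - 2 * real j - 1) * a))\<^sup>2)"
  by (simp add: photon_number_def dual_weyl_def)

lemma photon_number_dual_weyl_strict_mono: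
  assumes "n \<ge> 1" "0 \<le> a" "a < b"
  shows "photon_number n (dual_weyl n a) < photon_number n (dual_weyl n b)"
  unfolding photon_number_dual_weyl
proof (rule sum_strict_mono)
  fix j assume "j \<in> {..<n}"
  then have c: "0 < 2 * real n - 2 * real j - 1" by auto
  then have "(2 * real n - 2 * real j - 1) * a < (2 * real n - 2 * real j - 1) * b"
    using assms by (intro mult_strict_left_mono) auto
  then show "(sinh ((2 * real n - 2 * real j - 1) * a))\<^sup>2 < (sinh ((2 * real n - 2 * real j - 1) * b))\<^sup>2"
    using c assms by (intro power_strict_mono) auto
next
  show "{..<n} \<noteq> {}" using lessThan_iff[of 0 n] assms(1) by fastforce
qed simp

lemma ex_dual_weyl:
  assumes n: "n \<ge> 1" and N: "0 < N"
  obtains a where "0 < a" "photon_number n (dual_weyl n a) = N"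
proof -
  define f where "f a = photon_number n (dual_weyl n a)" for a
  \<comment> \<open>Chosen so that \<open>sinh x\<close> is at least \<open>x / 2 = N + 1\<close>;
    this exceeds 1, so squaring only enlarges it. The last mode alone, with coefficient 1, then
    contributes more than \<open>N\<close>.\<close>
  define x where "x = 2 * N + 2"
  have cont: "continuous_on {0..x} f"
    unfolding f_def[abs_def] photon_number_dual_weyl by (intro continuous_intros)
  have "f 0 = 0" by (simp add: f_def photon_number_dual_weyl)
  moreover have "N \<le> f x"
  proof -
    have x: "0 \<le> x" "x / 2 = N + 1" using N by (simp_all add: x_def)
    have "exp (- x) \<le> 1" "1 + x \<le> exp x" using x exp_ge_add_one_self[of x] by simp_all
    then have "x \<le> exp x - exp (- x)" by linarith
    then have "x / 2 \<le> sinh x" by (simp add: sinh_field_def)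
    with x have "N + 1 \<le> sinh x" by simp
    moreover from this have "sinh x \<le> (sinh x)\<^sup>2" using N by (intro self_le_power) auto
    moreover have "(sinh x)\<^sup>2 \<le> f x"
      using n member_le_sum[of "n - 1" "{..<n}" "\<lambda>j. (sinh ((2 * real n - 2 * real j - 1) * x))\<^sup>2"]
      by (simp add: f_def photon_number_dual_weyl of_nat_diff)
    ultimately show ?thesis by simp
  qed
  ultimately obtain a where a: "0 \<le> a" "f a = N"
    using IVT'[of f 0 N x] cont N by (auto simp: x_def)
  with \<open>f 0 = 0\<close> N have "a \<noteq> 0" by auto
  with a show ?thesis by (intro that[of a]) (auto simp: f_def)
qed

lemma maximizers_min_root:
  assumes n: "n \<ge> 1" and a: "0 < a" "photon_number n (dual_weyl n a) = N"
  shows "maximizers n N (min_root n) = {dual_weyl n a}"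
proof -
  \<comment> \<open>Competitors that merely tie are included, so this single fact gives both
    optimality and uniqueness. Entrywise domination makes every \<open>d j\<close> nonnegative, and
    equal photon numbers force them to vanish.\<close>
  have eq: "r = dual_weyl n a"
    if r: "r \<in> chamber n" "photon_number n r = N" "min_root n (dual_weyl n a) \<le> min_root n r" for r
  proof -
    have dom: "(2 * real n - 2 * real j - 1) * a \<le> r $ j" if "j < n" for j
      using min_root_dominates[OF r(1) a(1) _ that] r(3) min_root_dual_weyl[OF n a(1)] by simp
    define d where "d j = (sinh (r $ j))\<^sup>2 - (sinh ((2 * real n - 2 * real j - 1) * a))\<^sup>2" for j
    have nn: "0 \<le> (2 * real n - 2 * real j - 1) * a" if "j < n" for j
      using that a by (intro mult_nonneg_nonneg) auto
    have "0 \<le> d j" if "j < n" for j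
      using dom[OF that] nn[OF that] by (simp add: d_def power_mono)
    moreover have "(\<Sum>j<n. d j) = 0"
      using r(2) a(2)[unfolded photon_number_dual_weyl] by (simp add: d_def sum_subtractf photon_number_def)
    ultimately have z: "d j = 0" if "j < n" for j
      using sum_nonneg_eq_0_iff[of "{..<n}" d] that by auto
    have "r $ j = (2 * real n - 2 * real j - 1) * a" if "j < n" for j
    proof -
      have "0 \<le> r $ j" using dom[OF that] nn[OF that] by linarith
      then have "sinh (r $ j) = sinh ((2 * real n - 2 * real j - 1) * a)"
        using z[OF that] nn[OF that] by (simp add: d_def)
      then show ?thesis by simp
    qed
    then show ?thesis
      using r(1) by (intro eq_vecI) (auto simp: chamber_def dual_weyl_def)
  qed
  have mem: "dual_weyl n a \<in> chamber n" by (rule dual_weyl_chamber[OF a(1)])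
  show ?thesis
  proof (intro equalityI subsetI)
    fix r assume "r \<in> maximizers n N (min_root n)"
    then have r: "r \<in> chamber n" "photon_number n r = N"
      and max: "\<And>s. s \<in> chamber n \<Longrightarrow> photon_number n s = N \<Longrightarrow> \<not> min_root n r < min_root n s"
      by (auto simp: maximizers_def is_arg_max_def)
    then show "r \<in> {dual_weyl n a}" using eq[OF r] max[OF mem a(2)] by auto
  next
    fix r assume "r \<in> {dual_weyl n a}"
    moreover have "\<not> min_root n (dual_weyl n a) < min_root n s" if "s \<in> chamber n" "photon_number n s = N" for s
    proof
      assume less: "min_root n (dual_weyl n a) < min_root n s"
      then have "s = dual_weyl n a" using eq[OF that] by simp
      with less show False by simp
    qed
    ultimately show "r \<in> maximizers n N (min_root n)"
      using mem a(2) by (auto simp: maximizers_def is_arg_max_def)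
  qed
qed

theorem theoremS23:
  fixes n :: nat
  assumes "n \<ge> 1"
  shows
    "(\<forall>r\<in>carrier_vec n. \<forall>\<alpha>\<in>pos_roots n. \<forall>\<beta>\<in>pos_roots n.
        fisher (probe n r) \<alpha> \<beta> =
          (if \<alpha> = \<beta> then complex_of_real (2 * (sinh (root_val \<alpha> r))\<^sup>2) else 0)) \<and>
     (\<forall>U. passive_gaussian n U \<longrightarrow> (\<forall>r\<in>carrier_vec n.
        eigenvalue_mset (fisher_mat n (U (probe n r))) = eigenvalue_mset (fisher_mat n (probe n r)))) \<and>
     (\<forall>N>0. \<exists>a.
        (\<forall>b. 0 < b \<and> photon_number n (dual_weyl n b) = N \<longleftrightarrow> b = a) \<and>
        maximizers n N (\<lambda>r. min_weight n (probe n r)) = {dual_weyl n a} \<and>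
        (\<forall>U. passive_gaussian n U \<longrightarrow>
           maximizers n N (\<lambda>r. min_eigenvalue (fisher_mat n (U (probe n r)))) = {dual_weyl n a}))"
proof (intro conjI allI impI ballI)
  show "fisher (probe n r) \<alpha> \<beta> =
      (if \<alpha> = \<beta> then complex_of_real (2 * (sinh (root_val \<alpha> r))\<^sup>2) else 0)"
    if "\<alpha> \<in> pos_roots n" "\<beta> \<in> pos_roots n" for r \<alpha> \<beta>
    by (rule fisher_probe[OF that])
  show "eigenvalue_mset (fisher_mat n (U (probe n r))) = eigenvalue_mset (fisher_mat n (probe n r))"
    if "passive_gaussian n U" for U r
    using char_poly_similar[OF passive_similar[OF that]] by (simp add: eigenvalue_mset_def)
  fix N :: real assume "0 < N"
  then obtain a where a: "0 < a" "photon_number n (dual_weyl n a) = N"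
    using ex_dual_weyl[OF assms] by blast
  have uniq: "0 < b \<and> photon_number n (dual_weyl n b) = N \<longleftrightarrow> b = a" for b
    using a photon_number_dual_weyl_strict_mono[OF assms, of a b]
      photon_number_dual_weyl_strict_mono[OF assms, of b a]
    by (cases a b rule: linorder_cases) auto
  have eig: "min_eigenvalue (fisher_mat n (U (probe n r))) = min_root n r" if "passive_gaussian n U" for U r
    using similar_spectrum[OF passive_similar[OF that, of r]] min_eigenvalue_probe[of n r]
    by (simp add: min_eigenvalue_def)
  show "\<exists>a. (\<forall>b. 0 < b \<and> photon_number n (dual_weyl n b) = N \<longleftrightarrow> b = a) \<and>
        maximizers n N (\<lambda>r. min_weight n (probe n r)) = {dual_weyl n a} \<and>
        (\<forall>U. passive_gaussian n U \<longrightarrow>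
           maximizers n N (\<lambda>r. min_eigenvalue (fisher_mat n (U (probe n r)))) = {dual_weyl n a})"
    using uniq maximizers_min_root[OF assms a]
    by (intro exI[of _ a]) (simp add: min_weight_probe eig)
qed

end
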